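(* Assume that the number $K$ of budget constraints in $\mathcal{U}^{\mathcal{HP}}_1$ is constant and that, for every $\epsilon=1/t$ with $t$ a positive integer, the problem $$\min\ \mathbf{C}^T\mathbf{x}+\underline{\mathbf{c}}^T\mathbf{y}\quad\text{s.t.}\quad\mathbf{H}(\mathbf{y}+\mathbf{x})\ge\mathbf{g},\ \mathbf{x}+\mathbf{y}\le\mathbf{1},\ \mathbf{0}\le\mathbf{y}\le\mathbf{d},\ \mathbf{x}\in\{0,1\}^n$$ is polynomially solvable whenever $d_i\in\{0,\epsilon,2\epsilon,\dots,1\}$ for all $i\in[n]$. Then problem $(\mathrm{MM})$ under $\mathcal{U}^{\mathcal{HP}}_1$ admits a fully polynomial time approximation scheme (FPTAS).
   Context: Let $\mathcal{X}=\{\mathbf{x}\in\{0,1\}^n:\mathbf{H}\mathbf{x}\ge\mathbf{g}\}$ where the polyhedron $\{\mathbf{x}\in\mathbb{R}^n:\mathbf{H}\mathbf{x}\ge\mathbf{g},\ \mathbf{0}\le\mathbf{x}\le\mathbf{1}\}$ is integral. Let $\mathbf{C}\in\mathbb{R}^n_{\ge0}$ be first-stage costs, $\mathcal{X}'=\{\mathbf{x}\in\{0,1\}^n:\exists\mathbf{y}\in\{0,1\}^n,\ \mathbf{x}+\mathbf{y}\in\mathcal{X}\}$, and $\mathcal{U}\subset\mathbb{R}^n_+$ a convex compact uncertainty set. Problem $(\mathrm{MM})$ is $\min_{\mathbf{x}\in\mathcal{X}'}\min_{\{\mathbf{y}\in\mathbb{R}^n:\mathbf{H}(\mathbf{y}+\mathbf{x})\ge\mathbf{g},\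 \mathbf{0}\le\mathbf{y}\le\mathbf{1}-\mathbf{x}\}}\max_{\mathbf{c}\in\mathcal{U}}(\mathbf{C}^T\mathbf{x}+\mathbf{c}^T\mathbf{y})$ (equivalent, under these assumptions, to the robust two-stage problem). The uncertainty set is $\mathcal{U}^{\mathcal{HP}}_1=\{\underline{\mathbf{c}}+\boldsymbol{\delta}:\sum_{i\in U_j}\delta_i\le\Gamma_j,\ j\in[K],\ \boldsymbol{\delta}\ge\mathbf{0}\}$ for given $\underline{\mathbf{c}}\in\mathbb{R}^n_{\ge0}$, subsets $U_1,\dots,U_K\subseteq[n]$ (not necessarily disjoint) and budgets $\Gamma_j\ge0$. An FPTAS is an algorithm that for every $\epsilon>0$ returns a feasible solution of value at most $(1+\epsilon)$ times the optimum, in time polynomial in the input size and $1/\epsilon$. *)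

theory Defs
  imports
    "Jordan_Normal_Form.Matrix"
    "HOL-Analysis.Function_Topology"
    "HOL-Library.Log_Nat"
    "HOL-Computational_Algebra.Polynomial"
begin

section \<open>Polyhedra, the two-stage problem and its subproblem\<close>

text \<open>Vectors in \<open>\<real>\<^sup>n\<close> are the vectors of dimension \<open>n\<close> of Jordan_Normal_Form, with indices
  \<open>0, \<dots>, n - 1\<close>; their order \<open>\<le>\<close> is componentwise and includes equality of dimensions.
  The number \<open>n\<close> of variables is the number of columns of \<open>H\<close>.\<close>

abbreviation ones_vec :: "nat \<Rightarrow> real vec" where
  "ones_vec n \<equiv> vec n (\<lambda>_. 1)"

definition binary_vecs :: "nat \<Rightarrow> real vec set" where
  "binary_vecs n = {x \<in> carrier_vec n. \<forall>i<n. x $ i = 0 \<or> x $ i = 1}"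

definition box_polyhedron :: "real mat \<Rightarrow> real vec \<Rightarrow> real vec set" where
  "box_polyhedron H g = {x \<in> carrier_vec (dim_col H).
     g \<le> H *\<^sub>v x \<and> 0\<^sub>v (dim_col H) \<le> x \<and> x \<le> ones_vec (dim_col H)}"

definition vec_convex_hull :: "nat \<Rightarrow> real vec set \<Rightarrow> real vec set" where
  "vec_convex_hull n S = {z \<in> carrier_vec n. \<exists>T w. finite T \<and> T \<subseteq> S \<and> (\<forall>v\<in>T. 0 \<le> w v) \<and>
     (\<Sum>v\<in>T. w v) = 1 \<and> (\<forall>i<n. z $ i = (\<Sum>v\<in>T. w v * v $ i))}"

text \<open>A polyhedron is integral if it is the convex hull of its integer points.\<close>

definition integral_polyhedron :: "nat \<Rightarrow> real vec set \<Rightarrow> bool" where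
  "integral_polyhedron n P \<longleftrightarrow> P = vec_convex_hull n {v \<in> P. \<forall>i<n. v $ i \<in> \<int>}"

definition feasible_set :: "real mat \<Rightarrow> real vec \<Rightarrow> real vec set" where
  "feasible_set H g = {x \<in> binary_vecs (dim_col H). g \<le> H *\<^sub>v x}"

definition first_stage_set :: "real mat \<Rightarrow> real vec \<Rightarrow> real vec set" where
  "first_stage_set H g =
     {x \<in> binary_vecs (dim_col H). \<exists>y \<in> binary_vecs (dim_col H). x + y \<in> feasible_set H g}"

definition recourse_set :: "real mat \<Rightarrow> real vec \<Rightarrow> real vec \<Rightarrow> real vec set" where
  "recourse_set H g x = {y \<in> carrier_vec (dim_col H).
     g \<le> H *\<^sub>v (y + x) \<and> 0\<^sub>v (dim_col H) \<le> y \<and> y \<le> ones_vec (dim_col H) - x}"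

definition worst_case_cost :: "real vec \<Rightarrow> real vec set \<Rightarrow> real vec \<Rightarrow> real vec \<Rightarrow> real" where
  "worst_case_cost C U x y = (SUP c\<in>U. C \<bullet> x + c \<bullet> y)"

definition MM_value :: "real mat \<Rightarrow> real vec \<Rightarrow> real vec \<Rightarrow> real vec set \<Rightarrow> real" where
  "MM_value H g C U =
     (INF x\<in>first_stage_set H g. INF y\<in>recourse_set H g x. worst_case_cost C U x y)"

definition HP1_set :: "real vec \<Rightarrow> nat set list \<Rightarrow> real vec \<Rightarrow> real vec set" where
  "HP1_set c Us \<Gamma> = {c + \<delta> | \<delta>. \<delta> \<in> carrier_vec (dim_vec c) \<and>
     (\<forall>j<length Us. (\<Sum>i\<in>Us ! j. \<delta> $ i) \<le> \<Gamma> $ j) \<and> 0\<^sub>v (dim_vec c) \<le> \<delta>}"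

text \<open>Compactness in \<open>\<real>\<^sup>n\<close>, where \<open>\<real>\<^sup>n\<close> is embedded by zero padding into the product space
  of all real sequences.\<close>

definition compact_vecs :: "nat \<Rightarrow> real vec set \<Rightarrow> bool" where
  "compact_vecs n S \<longleftrightarrow> compact ((\<lambda>v i. if i < n then v $ i else 0 :: real) ` S)"

definition sub_feasible :: "real mat \<Rightarrow> real vec \<Rightarrow> real vec \<Rightarrow> (real vec \<times> real vec) set" where
  "sub_feasible H g d = {(x, y). x \<in> binary_vecs (dim_col H) \<and> y \<in> carrier_vec (dim_col H) \<and>
     g \<le> H *\<^sub>v (y + x) \<and> x + y \<le> ones_vec (dim_col H) \<and> 0\<^sub>v (dim_col H) \<le> y \<and> y \<le> d}"

definition sub_optimal ::
  "real mat \<Rightarrow> real vec \<Rightarrow> real vec \<Rightarrow> real vec \<Rightarrow> real vec \<Rightarrow> real vec \<times> real vec \<Rightarrow> bool" where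
  "sub_optimal H g C c d = is_arg_min (\<lambda>(x, y). C \<bullet> x + c \<bullet> y) (\<lambda>z. z \<in> sub_feasible H g d)"


section \<open>Model of computation\<close>

text \<open>Structured programs over finitely many registers, each of which holds a stack of integers,
  with the logarithmic cost criterion: an arithmetic expression costs the total binary length of
  all values that occur in its evaluation, and copying a register costs the size of its contents.
  Up to polynomial factors, the running time is that of a multitape Turing machine.\<close>

definition int_size :: "int \<Rightarrow> nat" where
  "int_size a = 1 + nat (bitlen \<bar>a\<bar>)"

definition list_size :: "int list \<Rightarrow> nat" where
  "list_size xs = (\<Sum>a\<leftarrow>xs. int_size a)"

type_synonym state = "nat \<Rightarrow> int list"

datatype aexp = Const int | Top nat | Add aexp aexp | Sub aexp aexp | Mul aexp aexp | Div aexp aexp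

datatype bexp = Nonempty nat | Less aexp aexp

datatype prog = Skip | Push nat aexp | Pop nat | Copy nat nat | Seq prog prog
  | Cond bexp prog prog | While bexp prog

fun aval :: "aexp \<Rightarrow> state \<Rightarrow> int" where
  "aval (Const a) s = a"
| "aval (Top r) s = (case s r of [] \<Rightarrow> 0 | a # _ \<Rightarrow> a)"
| "aval (Add e f) s = aval e s + aval f s"
| "aval (Sub e f) s = aval e s - aval f s"
| "aval (Mul e f) s = aval e s * aval f s"
| "aval (Div e f) s = aval e s div aval f s"

fun acost :: "aexp \<Rightarrow> state \<Rightarrow> nat" where
  "acost (Const a) s = int_size a"
| "acost (Top r) s = int_size (aval (Top r) s)"
| "acost (Add e f) s = acost e s + acost f s + int_size (aval (Add e f) s)"
| "acost (Sub e f) s = acost e s + acost f s + int_size (aval (Sub e f) s)"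
| "acost (Mul e f) s = acost e s + acost f s + int_size (aval (Mul e f) s)"
| "acost (Div e f) s = acost e s + acost f s + int_size (aval (Div e f) s)"

fun bval :: "bexp \<Rightarrow> state \<Rightarrow> bool" where
  "bval (Nonempty r) s \<longleftrightarrow> s r \<noteq> []"
| "bval (Less e f) s \<longleftrightarrow> aval e s < aval f s"

fun bcost :: "bexp \<Rightarrow> state \<Rightarrow> nat" where
  "bcost (Nonempty r) s = 1"
| "bcost (Less e f) s = acost e s + acost f s"

text \<open>\<open>exec p s \<tau> s'\<close>: started in state \<open>s\<close>, the program \<open>p\<close> halts in state \<open>s'\<close> after time \<open>\<tau>\<close>.
  The assignment \<open>Copy r q\<close> overwrites \<open>r\<close> with the contents of \<open>q\<close>.\<close>

inductive exec :: "prog \<Rightarrow> state \<Rightarrow> nat \<Rightarrow> state \<Rightarrow> bool" where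
  Skip: "exec Skip s 1 s"
| Push: "exec (Push r e) s (1 + acost e s) (s(r := aval e s # s r))"
| Pop: "exec (Pop r) s 1 (s(r := tl (s r)))"
| Copy: "exec (Copy r q) s (1 + list_size (s q)) (s(r := s q))"
| Seq: "exec p s \<tau>\<^sub>1 s' \<Longrightarrow> exec q s' \<tau>\<^sub>2 s'' \<Longrightarrow> exec (Seq p q) s (\<tau>\<^sub>1 + \<tau>\<^sub>2) s''"
| CondTrue: "bval b s \<Longrightarrow> exec p s \<tau> s' \<Longrightarrow> exec (Cond b p q) s (1 + bcost b s + \<tau>) s'"
| CondFalse: "\<not> bval b s \<Longrightarrow> exec q s \<tau> s' \<Longrightarrow> exec (Cond b p q) s (1 + bcost b s + \<tau>) s'"
| WhileFalse: "\<not> bval b s \<Longrightarrow> exec (While b p) s (1 + bcost b s) s"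
| WhileTrue: "bval b s \<Longrightarrow> exec p s \<tau>\<^sub>1 s' \<Longrightarrow> exec (While b p) s' \<tau>\<^sub>2 s'' \<Longrightarrow>
    exec (While b p) s (1 + bcost b s + \<tau>\<^sub>1 + \<tau>\<^sub>2) s''"

text \<open>Input and output are passed in register \<open>0\<close>; all other registers are initially empty.\<close>

definition outputs_within :: "prog \<Rightarrow> int list \<Rightarrow> nat \<Rightarrow> int list \<Rightarrow> bool" where
  "outputs_within p inp T out \<longleftrightarrow>
     (\<exists>\<tau> s'. exec p ((\<lambda>_. [])(0 := inp)) \<tau> s' \<and> \<tau> \<le> T \<and> s' 0 = out)"


section \<open>Encodings\<close>

definition enc_rat :: "rat \<Rightarrow> int list" where
  "enc_rat r = [fst (quotient_of r), snd (quotient_of r)]"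

definition enc_vec :: "rat vec \<Rightarrow> int list" where
  "enc_vec v = concat (map enc_rat (list_of_vec v))"

definition enc_system :: "rat mat \<Rightarrow> rat vec \<Rightarrow> int list" where
  "enc_system H g = [int (dim_row H), int (dim_col H)] @ concat (map enc_vec (rows H)) @ enc_vec g"

definition enc_subset :: "nat \<Rightarrow> nat set \<Rightarrow> int list" where
  "enc_subset n A = map (\<lambda>i. if i \<in> A then 1 else 0) [0..<n]"

text \<open>The bounds \<open>d\<close> of the subproblem are multiples of \<open>1 / t\<close>, given by \<open>t\<close> and the
  multipliers \<open>k\<close>.\<close>

definition enc_sub_instance ::
  "rat mat \<Rightarrow> rat vec \<Rightarrow> rat vec \<Rightarrow> rat vec \<Rightarrow> nat \<Rightarrow> nat vec \<Rightarrow> int list" where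
  "enc_sub_instance H g C c t k =
     enc_system H g @ enc_vec C @ enc_vec c @ [int t] @ map int (list_of_vec k)"

definition enc_MM_instance ::
  "rat mat \<Rightarrow> rat vec \<Rightarrow> rat vec \<Rightarrow> rat vec \<Rightarrow> nat set list \<Rightarrow> rat vec \<Rightarrow> rat \<Rightarrow> int list" where
  "enc_MM_instance H g C c Us \<Gamma> \<epsilon> =
     enc_system H g @ enc_vec C @ enc_vec c @ concat (map (enc_subset (dim_col H)) Us) @
     enc_vec \<Gamma> @ enc_rat \<epsilon>"

text \<open>An algorithm either returns a solution \<open>(x, y)\<close> or reports infeasibility.\<close>

fun enc_solution :: "(rat vec \<times> rat vec) option \<Rightarrow> int list" where
  "enc_solution None = [0]"
| "enc_solution (Some (x, y)) = 1 # enc_vec x @ enc_vec y"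


section \<open>Polynomial solvability and approximation schemes\<close>

abbreviation real_vec :: "rat vec \<Rightarrow> real vec" where
  "real_vec \<equiv> map_vec real_of_rat"

abbreviation real_mat :: "rat mat \<Rightarrow> real mat" where
  "real_mat \<equiv> map_mat real_of_rat"

text \<open>A set \<open>\<H>\<close> of pairs \<open>(H, g)\<close> describes a class of combinatorial problems. One algorithm has to
  serve all \<open>t\<close>. As only grids with \<open>1 / \<epsilon> = t\<close> are considered, its running time
  may depend polynomially on the number \<open>t\<close>, not only on the binary length of \<open>t\<close>.\<close>

definition subproblem_poly_solvable :: "(rat mat \<times> rat vec) set \<Rightarrow> bool" where
  "subproblem_poly_solvable \<H> \<longleftrightarrow> (\<exists>(p :: prog) (q :: nat poly).
     \<forall>(H, g) \<in> \<H>. \<forall>C \<in> carrier_vec (dim_col H). \<forall>c \<in> carrier_vec (dim_col H).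
     \<forall>t. \<forall>k \<in> carrier_vec (dim_col H).
       0\<^sub>v (dim_col H) \<le> C \<longrightarrow> 0\<^sub>v (dim_col H) \<le> c \<longrightarrow> 1 \<le> t \<longrightarrow> (\<forall>i<dim_col H. k $ i \<le> t) \<longrightarrow>
       (let inp = enc_sub_instance H g C c t k;
            d = vec (dim_col H) (\<lambda>i. real (k $ i) / real t)
        in \<exists>sol. outputs_within p inp (poly q (list_size inp + t)) (enc_solution sol) \<and>
             (case sol of
                None \<Rightarrow> sub_feasible (real_mat H) (real_vec g) d = {}
              | Some (x, y) \<Rightarrow> sub_optimal (real_mat H) (real_vec g) (real_vec C) (real_vec c) d
                                 (real_vec x, real_vec y))))"

definition MM_HP1_has_FPTAS :: "(rat mat \<times> rat vec) set \<Rightarrow> nat \<Rightarrow> bool" where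
  "MM_HP1_has_FPTAS \<H> K \<longleftrightarrow> (\<exists>(p :: prog) (q :: nat poly).
     \<forall>(H, g) \<in> \<H>. \<forall>C \<in> carrier_vec (dim_col H). \<forall>c \<in> carrier_vec (dim_col H).
     \<forall>Us. \<forall>\<Gamma> \<in> carrier_vec K. \<forall>\<epsilon> > 0.
       0\<^sub>v (dim_col H) \<le> C \<longrightarrow> 0\<^sub>v (dim_col H) \<le> c \<longrightarrow>
       length Us = K \<longrightarrow> (\<forall>j<K. Us ! j \<subseteq> {..<dim_col H}) \<longrightarrow> 0\<^sub>v K \<le> \<Gamma> \<longrightarrow>
       compact_vecs (dim_col H) (HP1_set (real_vec c) Us (real_vec \<Gamma>)) \<longrightarrow>
       (let inp = enc_MM_instance H g C c Us \<Gamma> \<epsilon>;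
            U = HP1_set (real_vec c) Us (real_vec \<Gamma>)
        in \<exists>sol. outputs_within p inp (poly q (list_size inp + nat \<lceil>1 / \<epsilon>\<rceil>)) (enc_solution sol) \<and>
             (case sol of
                None \<Rightarrow> first_stage_set (real_mat H) (real_vec g) = {}
              | Some (x, y) \<Rightarrow>
                  real_vec x \<in> first_stage_set (real_mat H) (real_vec g) \<and>
                  real_vec y \<in> recourse_set (real_mat H) (real_vec g) (real_vec x) \<and>
                  worst_case_cost (real_vec C) U (real_vec x) (real_vec y)
                    \<le> (1 + real_of_rat \<epsilon>) * MM_value (real_mat H) (real_vec g) (real_vec C) U)))"

end

theory Submission
  imports Defs
begin

text \<open>For fixed \<open>y\<close> the worst case over the uncertainty set is a linear program with dual
  \<open>min \<Gamma> u\<close> subject to \<open>y\<^sub>i \<le> \<Sum>{u\<^sub>j | i \<in> U\<^sub>j}\<close> and \<open>u \<ge> 0\<close>, so the problem becomes a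
  minimization over \<open>x\<close>, \<open>y\<close> and \<open>u\<close>. For fixed \<open>u\<close> it is the subproblem with
  \<open>d\<^sub>i = min 1 (\<Sum>{u\<^sub>j | i \<in> U\<^sub>j})\<close>, and since \<open>K\<close> is constant, only polynomially many \<open>u\<close> on the
  grid of multiples of \<open>1 / t\<close> have to be tried, where \<open>t\<close> is polynomial in \<open>n\<close> and \<open>1 / \<epsilon>\<close>.
  Rounding \<open>u\<close> causes only a small relative error because \<open>y\<close> can be assumed to have no small
  nonzero entries: by integrality \<open>x + y\<close> is a convex combination of binary vectors, and those that
  use an index \<open>i\<close> with \<open>0 < y\<^sub>i < \<eta>\<close> have total weight at most \<open>n \<eta>\<close> and can be dropped.\<close>

section \<open>Duality for the worst-case cost\<close>

text \<open>Multipliers need to be tried only up to 1, because \<open>y \<le> 1\<close> lets a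
  larger one be cut down to 1. Compactness enters through one consequence: every index lies in some
  \<open>U_j\<close>, since otherwise its cost is unbounded; this makes the inner maximum finite.
  Integrality serves twice. It allows small entries of \<open>y\<close> to be dropped, and it shows
  that an \<open>x\<close> returned with a fractional \<open>y\<close> can also be completed by a
  binary recourse, so that it belongs to the first-stage set.

  On the machine side the obstacle is that the given algorithm is an unknown program, run in
  polynomially many rounds. It can be called because it leaves alone the registers it does not
  mention, and because everything it writes is bounded by its running time. Size bounds carried
  through the body of a loop would multiply from round to round; therefore one bound
  \<open>W\<close> is fixed in advance, and the invariants keep every register below it (or below
  \<open>2 * W\<close> while stacks are being moved). Reversal of stacks by moving explains why most
  data are stored backwards.\<close>

inductive_set ineq_cone :: "((nat \<Rightarrow> real) \<times> real) set \<Rightarrow> ((nat \<Rightarrow> real) \<times> real) set" for S where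
  base: "s \<in> S \<Longrightarrow> s \<in> ineq_cone S"
| scale: "(a, b) \<in> ineq_cone S \<Longrightarrow> 0 \<le> r \<Longrightarrow> (\<lambda>j. r * a j, r * b) \<in> ineq_cone S"
| add: "(a, b) \<in> ineq_cone S \<Longrightarrow> (a', b') \<in> ineq_cone S \<Longrightarrow> (\<lambda>j. a j + a' j, b + b') \<in> ineq_cone S"

lemma ineq_cone_subset:
  assumes "S' \<subseteq> ineq_cone S"
  shows "ineq_cone S' \<subseteq> ineq_cone S"
proof
  fix s assume "s \<in> ineq_cone S'"
  then show "s \<in> ineq_cone S"
    by induction (use assms in \<open>auto intro: ineq_cone.intros\<close>)
qed

lemma ineq_cone_coeff_zero:
  assumes "s \<in> ineq_cone S" and "\<And>s. s \<in> S \<Longrightarrow> fst s k = 0"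
  shows "fst s k = 0"
  using assms by induction auto

lemma exists_between_finite:
  fixes L R :: "real set"
  assumes "finite L" "finite R" and le: "\<And>l r. l \<in> L \<Longrightarrow> r \<in> R \<Longrightarrow> l \<le> r"
  obtains v where "\<And>l. l \<in> L \<Longrightarrow> l \<le> v" "\<And>r. r \<in> R \<Longrightarrow> v \<le> r"
proof (cases "L = {}")
  case True
  show ?thesis
  proof (cases "R = {}")
    case False
    show ?thesis by (rule that[of "Min R"]) (use True False assms in auto)
  qed (use True that in auto)
next
  case False
  show ?thesis by (rule that[of "Max L"]) (use False assms in auto)
qed

text \<open>A pair \<open>(a, b)\<close> stands for the inequality
  \<open>b \<le> (\<Sum>j. a j * u j)\<close>, and \<open>ineq_cone\<close> collects the nonnegative
  combinations. This is Farkas' lemma by Fourier-Motzkin elimination of the last variable: each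
  lower bound on it is paired with each upper bound, and a contradiction among the pairs is again a
  combination of rows of \<open>S\<close>. Using an inductive cone keeps explicit multipliers out of
  the induction.\<close>

lemma farkas_cone:
  assumes "finite S"
  shows "(\<exists>u. \<forall>(a, b)\<in>S. b \<le> (\<Sum>j<K. a j * u j)) \<or>
    (\<exists>(a, b)\<in>ineq_cone S. (\<forall>j<K. a j = 0) \<and> 0 < b)"
  using assms
proof (induction K arbitrary: S)
  case 0
  then show ?case by (force intro: ineq_cone.base)
next
  case (Suc K)
  define pos where "pos = {s \<in> S. 0 < fst s K}"
  define neg where "neg = {s \<in> S. fst s K < 0}"
  define zer where "zer = {s \<in> S. fst s K = 0}"
  \<comment> \<open>The scalings make the coefficients of variable \<open>K\<close> equal to 1 and
    -1, so that it cancels in the sum.\<close>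
  define comb where "comb = (\<lambda>(p :: (nat \<Rightarrow> real) \<times> real, q :: (nat \<Rightarrow> real) \<times> real).
    (\<lambda>j. (1 / fst p K) * fst p j + (- 1 / fst q K) * fst q j,
     (1 / fst p K) * snd p + (- 1 / fst q K) * snd q))"
  define S' where "S' = zer \<union> comb ` (pos \<times> neg)"
  have fin: "finite pos" "finite neg" "finite zer" "finite S'"
    using Suc.prems by (auto simp: pos_def neg_def zer_def S'_def)
  have comb_cone: "comb (p, q) \<in> ineq_cone S" if "p \<in> pos" "q \<in> neg" for p q
  proof -
    have "(\<lambda>j. (1 / fst p K) * fst p j, (1 / fst p K) * snd p) \<in> ineq_cone S"
      using that by (intro ineq_cone.scale) (auto simp: pos_def intro: ineq_cone.base)
    moreover have "(\<lambda>j. (- 1 / fst q K) * fst q j, (- 1 / fst q K) * snd q) \<in> ineq_cone S"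
      using that by (intro ineq_cone.scale)
        (auto simp: neg_def divide_nonneg_neg divide_nonpos_neg intro: ineq_cone.base)
    ultimately show ?thesis
      unfolding comb_def prod.case by (rule ineq_cone.add)
  qed
  have S'_cone: "S' \<subseteq> ineq_cone S"
    using comb_cone by (auto simp: S'_def zer_def intro: ineq_cone.base)
  have S'_zero: "fst s K = 0" if "s \<in> S'" for s
    using that by (auto simp: S'_def zer_def comb_def pos_def neg_def)
  from Suc.IH[OF fin(4)] show ?case
  proof
    assume "\<exists>u. \<forall>(a, b)\<in>S'. b \<le> (\<Sum>j<K. a j * u j)"
    then obtain u where u: "\<And>s. s \<in> S' \<Longrightarrow> snd s \<le> (\<Sum>j<K. fst s j * u j)"
      by fastforce
    \<comment> \<open>Solved for the last variable, a row of \<open>pos\<close> gives a lower bound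
      and a row of \<open>neg\<close> an upper bound, since dividing by a negative coefficient
      reverses the inequality.\<close>
    define bd where "bd s = (snd s - (\<Sum>j<K. fst s j * u j)) / fst s K" for s :: "(nat \<Rightarrow> real) \<times> real"
    have le: "l \<le> r" if l: "l \<in> bd ` pos" and r: "r \<in> bd ` neg" for l r
    proof -
      obtain p q where p: "p \<in> pos" "l = bd p" and q: "q \<in> neg" "r = bd q"
        using l r by auto
      have "snd (comb (p, q)) \<le> (\<Sum>j<K. fst (comb (p, q)) j * u j)"
        using p q by (intro u) (auto simp: S'_def)
      also have "\<dots> = (1 / fst p K) * (\<Sum>j<K. fst p j * u j) + (- 1 / fst q K) * (\<Sum>j<K. fst q j * u j)"
        by (simp add: comb_def sum_distrib_left sum.distrib[symmetric] algebra_simps)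
      finally show ?thesis
        using p q by (simp add: comb_def bd_def diff_divide_distrib)
    qed
    obtain v where v: "\<And>l. l \<in> bd ` pos \<Longrightarrow> l \<le> v" "\<And>r. r \<in> bd ` neg \<Longrightarrow> v \<le> r"
      by (rule exists_between_finite[of "bd ` pos" "bd ` neg"]) (use fin le in auto)
    have "snd s \<le> (\<Sum>j<Suc K. fst s j * (u(K := v)) j)" if s: "s \<in> S" for s
    proof -
      consider "s \<in> pos" | "s \<in> neg" | "s \<in> zer"
        using s unfolding pos_def neg_def zer_def by force
      then show ?thesis
      proof cases
        case 1
        then show ?thesis using v(1)[OF imageI[OF 1]] by (simp add: bd_def pos_def field_simps)
      next
        case 2
        then show ?thesis using v(2)[OF imageI[OF 2]] by (simp add: bd_def neg_def field_simps)
      next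
        case 3
        then show ?thesis using u[of s] by (simp add: S'_def zer_def)
      qed
    qed
    then show ?thesis by (intro disjI1 exI[of _ "u(K := v)"]) auto
  next
    assume "\<exists>(a, b)\<in>ineq_cone S'. (\<forall>j<K. a j = 0) \<and> 0 < b"
    then obtain a b where ab: "(a, b) \<in> ineq_cone S'" "\<forall>j<K. a j = 0" "0 < b" by auto
    \<comment> \<open>All rows of \<open>S'\<close> have coefficient 0 at \<open>K\<close>, hence so
      has every combination; the certificate for \<open>K\<close> variables therefore works for
      \<open>Suc K\<close>.\<close>
    moreover have "a K = 0" using ineq_cone_coeff_zero[OF ab(1) S'_zero] by simp
    ultimately show ?thesis
      using ineq_cone_subset[OF S'_cone]
      by (intro disjI2 bexI[of _ "(a, b)"]) (auto simp: less_Suc_eq)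
  qed
qed

text \<open>LP duality for a packing problem. Farkas' lemma is applied to the system in
  \<open>u\<close> made of the covering rows, the sign conditions and the objective row
  \<open>\<Gamma> u \<le> V\<close>; a contradiction would hand over a packing
  \<open>\<delta>\<close> of value above \<open>V\<close>.\<close>

lemma covering_dual:
  fixes y :: "nat \<Rightarrow> real" and \<Gamma> :: "nat \<Rightarrow> real" and A :: "nat \<Rightarrow> nat set"
  assumes A: "\<And>j. j < K \<Longrightarrow> A j \<subseteq> {..<n}"
    and \<Gamma>: "\<And>j. j < K \<Longrightarrow> 0 \<le> \<Gamma> j"
    and V: "\<And>\<delta>. \<lbrakk>\<And>i. 0 \<le> \<delta> i; \<And>j. j < K \<Longrightarrow> (\<Sum>i\<in>A j. \<delta> i) \<le> \<Gamma> j\<rbrakk> \<Longrightarrow> (\<Sum>i<n. \<delta> i * y i) \<le> V"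
  obtains u where "\<And>j. j < K \<Longrightarrow> 0 \<le> u j" "\<And>i. i < n \<Longrightarrow> y i \<le> (\<Sum>j<K. if i \<in> A j then u j else 0)"
    "(\<Sum>j<K. \<Gamma> j * u j) \<le> V"
proof -
  define S1 where "S1 = (\<lambda>i. (\<lambda>j. of_bool (i \<in> A j) :: real, y i)) ` {..<n}"
  define S2 where "S2 = (\<lambda>j. (\<lambda>j'. of_bool (j = j') :: real, 0 :: real)) ` {..<K}"
  define S where "S = S1 \<union> S2 \<union> {(\<lambda>j. - \<Gamma> j, - V)}"
  have finA: "finite (A j)" if "j < K" for j using A[OF that] finite_subset by blast
  have "finite S" by (simp add: S_def S1_def S2_def)
  \<comment> \<open>The weights of the covering rows, the sign rows and the objective row in a
    combination are \<open>\<delta>\<close>, \<open>\<sigma>\<close> and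
    \<open>\<mu>\<close>.\<close>
  define multipliers where "multipliers a b \<delta> \<sigma> \<mu> \<longleftrightarrow>
      (\<forall>i. 0 \<le> \<delta> i) \<and> (\<forall>j. 0 \<le> \<sigma> j) \<and> 0 \<le> \<mu> \<and>
      (\<forall>j<K. a j = (\<Sum>i\<in>A j. \<delta> i) + \<sigma> j - \<mu> * \<Gamma> j) \<and> b = (\<Sum>i<n. \<delta> i * y i) - \<mu> * V"
    for a b \<delta> \<sigma> \<mu>
  have mult: "\<exists>\<delta> \<sigma> \<mu>. multipliers a b \<delta> \<sigma> \<mu>" if "(a, b) \<in> ineq_cone S" for a b
    using that
  proof (induction "(a, b)" arbitrary: a b)
    case base
    then consider i where "i < n" "a = (\<lambda>j. of_bool (i \<in> A j))" "b = y i"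
      | j where "j < K" "a = (\<lambda>j'. of_bool (j = j'))" "b = 0" | "a = (\<lambda>j. - \<Gamma> j)" "b = - V"
      by (auto simp: S_def S1_def S2_def)
    then show ?case
    proof cases
      case 1
      then have "multipliers a b (\<lambda>i'. if i' = i then 1 else 0) (\<lambda>_. 0) 0"
        by (auto simp: multipliers_def finA if_distrib[of "\<lambda>x. x * _"] cong: if_cong)
      then show ?thesis by blast
    next
      case 2
      then have "multipliers a b (\<lambda>_. 0) (\<lambda>j'. of_bool (j = j')) 0"
        by (auto simp: multipliers_def)
      then show ?thesis by blast
    next
      case 3
      then have "multipliers a b (\<lambda>_. 0) (\<lambda>_. 0) 1" by (auto simp: multipliers_def)
      then show ?thesis by blast
    qed
  next
    case (scale a b r)
    then obtain \<delta> \<sigma> \<mu> where "multipliers a b \<delta> \<sigma> \<mu>" by blast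
    with scale(3) have "multipliers (\<lambda>j. r * a j) (r * b) (\<lambda>i. r * \<delta> i) (\<lambda>j. r * \<sigma> j) (r * \<mu>)"
      by (auto simp: multipliers_def sum_distrib_left right_diff_distrib distrib_left mult.assoc)
    then show ?case by blast
  next
    case (add a b a' b')
    then obtain \<delta> \<sigma> \<mu> \<delta>' \<sigma>' \<mu>' where
      "multipliers a b \<delta> \<sigma> \<mu>" "multipliers a' b' \<delta>' \<sigma>' \<mu>'" by blast
    then have "multipliers (\<lambda>j. a j + a' j) (b + b') (\<lambda>i. \<delta> i + \<delta>' i) (\<lambda>j. \<sigma> j + \<sigma>' j) (\<mu> + \<mu>')"
      by (auto simp: multipliers_def sum.distrib distrib_right)
    then show ?case by blast
  qed
  have "\<not> (\<exists>(a, b)\<in>ineq_cone S. (\<forall>j<K. a j = 0) \<and> 0 < b)"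
  proof safe
    fix a b assume ab: "(a, b) \<in> ineq_cone S" "\<forall>j<K. a j = 0" "0 < b"
    from mult[OF ab(1)] obtain \<delta>0 \<sigma>0 \<mu>0 where "multipliers a b \<delta>0 \<sigma>0 \<mu>0" by blast
    with ab(2,3) have "(\<forall>i. 0 \<le> \<delta>0 i) \<and> (\<forall>j. 0 \<le> \<sigma>0 j) \<and> 0 \<le> \<mu>0 \<and>
        (\<forall>j<K. (\<Sum>i\<in>A j. \<delta>0 i) + \<sigma>0 j - \<mu>0 * \<Gamma> j = 0) \<and> 0 < (\<Sum>i<n. \<delta>0 i * y i) - \<mu>0 * V"
      by (simp add: multipliers_def)
    then obtain \<delta> \<sigma> \<mu> where \<delta>: "\<And>i. 0 \<le> \<delta> i" and \<sigma>: "\<And>j. 0 \<le> \<sigma> j" and \<mu>: "0 \<le> \<mu>"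
      and a: "\<And>j. j < K \<Longrightarrow> (\<Sum>i\<in>A j. \<delta> i) + \<sigma> j - \<mu> * \<Gamma> j = 0"
      and b: "0 < (\<Sum>i<n. \<delta> i * y i) - \<mu> * V"
      by blast
    have A\<delta>: "(\<Sum>i\<in>A j. \<delta> i) \<le> \<mu> * \<Gamma> j" if "j < K" for j
      using a[OF that] \<sigma>[of j] by linarith
    show False
    proof (cases "\<mu> = 0")
      case True
      define D where "D = (\<Sum>i<n. \<delta> i * y i)"
      \<comment> \<open>Without the objective row, \<open>\<delta>\<close> is a ray of the packing
        polyhedron with positive value \<open>D\<close>; stretched by \<open>r\<close> it reaches
        \<open>\<bar>V\<bar> + 1\<close>, which exceeds \<open>V\<close>.\<close>
      define r where "r = (\<bar>V\<bar> + 1) / D"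
      have D: "0 < D" using b True by (simp add: D_def)
      then have r: "0 \<le> r" by (simp add: r_def)
      have "(\<Sum>i<n. (r * \<delta> i) * y i) \<le> V"
      proof (rule V)
        fix j assume j: "j < K"
        have "(\<Sum>i\<in>A j. r * \<delta> i) = r * (\<Sum>i\<in>A j. \<delta> i)" by (simp add: sum_distrib_left)
        also have "\<dots> \<le> 0" using A\<delta>[OF j] True r by (simp add: mult_nonneg_nonpos)
        finally show "(\<Sum>i\<in>A j. r * \<delta> i) \<le> \<Gamma> j" using \<Gamma>[OF j] by linarith
      qed (use r \<delta> in auto)
      moreover have "(\<Sum>i<n. (r * \<delta> i) * y i) = r * D"
        by (simp add: D_def sum_distrib_left mult.assoc)
      ultimately show False using D by (simp add: r_def)
    next
      case False
      with \<mu> have \<mu>: "0 < \<mu>" by simp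
      \<comment> \<open>Normalizing the weight of the objective row to 1 turns
        \<open>\<delta>\<close> into a feasible packing.\<close>
      have "(\<Sum>i<n. (\<delta> i / \<mu>) * y i) \<le> V"
      proof (rule V)
        fix j assume j: "j < K"
        show "(\<Sum>i\<in>A j. \<delta> i / \<mu>) \<le> \<Gamma> j"
          using A\<delta>[OF j] \<mu> by (simp add: sum_divide_distrib[symmetric] field_simps)
      qed (use \<mu> \<delta> in auto)
      moreover have "(\<Sum>i<n. (\<delta> i / \<mu>) * y i) = (\<Sum>i<n. \<delta> i * y i) / \<mu>"
        by (simp add: sum_divide_distrib)
      ultimately have "(\<Sum>i<n. \<delta> i * y i) \<le> V * \<mu>" using \<mu> by (simp only: pos_divide_le_eq)
      then show False using b by (simp add: mult.commute)
    qed
  qed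
  with farkas_cone[OF \<open>finite S\<close>, of K] obtain u where "\<forall>(a, b)\<in>S. b \<le> (\<Sum>j<K. a j * u j)"
    by blast
  then have u: "b \<le> (\<Sum>j<K. a j * u j)" if "(a, b) \<in> S" for a b
    using that by blast
  show ?thesis
  proof (rule that[of u])
    fix j assume j: "j < K"
    then have "(\<lambda>j'. of_bool (j = j'), 0) \<in> S" by (auto simp: S_def S2_def)
    from u[OF this] j show "0 \<le> u j" by (simp add: of_bool_def if_distrib[of "\<lambda>x. x * _"] cong: if_cong)
  next
    fix i assume "i < n"
    then have "(\<lambda>j. of_bool (i \<in> A j), y i) \<in> S" by (auto simp: S_def S1_def)
    from u[OF this] show "y i \<le> (\<Sum>j<K. if i \<in> A j then u j else 0)"
      by (simp add: of_bool_def if_distrib[of "\<lambda>x. x * _"] cong: if_cong)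
  next
    have "(\<lambda>j. - \<Gamma> j, - V) \<in> S" by (simp add: S_def)
    from u[OF this] show "(\<Sum>j<K. \<Gamma> j * u j) \<le> V" by (simp add: sum_negf)
  qed
qed

section \<open>Enumeration of the grid of dual multipliers\<close>

definition digit :: "nat \<Rightarrow> nat \<Rightarrow> nat \<Rightarrow> nat" where
  "digit t N j = N div (t + 1) ^ j mod (t + 1)"

text \<open>A number \<open>N < (t + 1) ^ K\<close> codes a grid point by its digits in base
  \<open>t + 1\<close>: the multiplier of budget \<open>j\<close> is \<open>digit t N j / t\<close>,
  between 0 and 1. The caps are \<open>t\<close> times the upper bounds \<open>d\<close>; the
  minimum keeps \<open>d \<le> 1\<close>, as the subproblem demands, and excludes nothing because
  \<open>y \<le> 1\<close>.\<close>

definition grid_caps :: "nat \<Rightarrow> nat \<Rightarrow> nat set list \<Rightarrow> nat \<Rightarrow> nat vec" where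
  "grid_caps n t Us N = vec n (\<lambda>i. min t (\<Sum>j<length Us. if i \<in> Us ! j then digit t N j else 0))"

abbreviation grid_bounds :: "nat \<Rightarrow> nat \<Rightarrow> nat set list \<Rightarrow> nat \<Rightarrow> real vec" where
  "grid_bounds n t Us N \<equiv> vec n (\<lambda>i. real (grid_caps n t Us N $ i) / real t)"

text \<open>The objective in \<open>x\<close>, \<open>y\<close> and \<open>u\<close> at the grid
  point \<open>N\<close>; the last summand is the dual objective \<open>\<Gamma> u\<close>.\<close>

definition grid_cost :: "real vec \<Rightarrow> real vec \<Rightarrow> real vec \<Rightarrow> nat \<Rightarrow> nat \<Rightarrow> real vec \<times> real vec \<Rightarrow> real" where
  "grid_cost C c \<Gamma> t N = (\<lambda>(x, y). C \<bullet> x + c \<bullet> y + (\<Sum>j<dim_vec \<Gamma>. \<Gamma> $ j * (real (digit t N j) / real t)))"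

lemma digits_surj:
  assumes "\<And>j. j < K \<Longrightarrow> f j \<le> t"
  shows "\<exists>N<(t + 1) ^ K. \<forall>j<K. digit t N j = f j"
  using assms
proof (induction K)
  case (Suc K)
  then obtain N where N: "N < (t + 1) ^ K" "\<And>j. j < K \<Longrightarrow> digit t N j = f j" by auto
  define M where "M = N + f K * (t + 1) ^ K"
  have "M < (t + 1) ^ K + f K * (t + 1) ^ K" using N(1) by (simp add: M_def)
  also have "\<dots> = (f K + 1) * (t + 1) ^ K" by simp
  also have "\<dots> \<le> (t + 1) * (t + 1) ^ K" using Suc.prems[of K] by (intro mult_right_mono) auto
  finally have "M < (t + 1) ^ Suc K" by simp
  moreover have "digit t M j = f j" if "j < Suc K" for j
  proof (cases "j = K")
    case True
    have "M div (t + 1) ^ K = f K" using N(1) by (simp add: M_def)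
    then show ?thesis using True Suc.prems[of K] by (simp add: digit_def)
  next
    case False
    with that have "j < K" by simp
    then obtain r where r: "K = Suc (j + r)" using less_imp_Suc_add by blast
    have "M = N + (t + 1) ^ j * ((t + 1) * (f K * (t + 1) ^ r))"
      by (simp only: M_def r power_Suc power_add mult.assoc mult.left_commute)
    then have "M div (t + 1) ^ j = N div (t + 1) ^ j + (t + 1) * (f K * (t + 1) ^ r)"
      by (simp only: div_mult_self2 div_mult_self4 power_not_zero add_is_0 one_neq_zero simp_thms if_False)
    then have "digit t M j = digit t N j" by (simp only: digit_def mod_mult_self2)
    then show ?thesis using N(2)[OF \<open>j < K\<close>] by simp
  qed
  ultimately show ?case by blast
qed simp

lemma digit_le: "digit t N j \<le> t"
  unfolding digit_def by (metis Suc_eq_plus1 less_Suc_eq_le mod_less_divisor zero_less_Suc)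

section \<open>Duality for the worst-case cost of a fixed solution\<close>

locale HP1_instance =
  fixes n K :: nat and C c \<Gamma> :: "real vec" and Us :: "nat set list"
  assumes C: "C \<in> carrier_vec n" "0\<^sub>v n \<le> C"
    and c: "c \<in> carrier_vec n" "0\<^sub>v n \<le> c"
    and \<Gamma>: "\<Gamma> \<in> carrier_vec K" "0\<^sub>v K \<le> \<Gamma>"
    and Us: "length Us = K" "\<And>j. j < K \<Longrightarrow> Us ! j \<subseteq> {..<n}"
    and compact: "compact_vecs n (HP1_set c Us \<Gamma>)"
begin

abbreviation "U \<equiv> HP1_set c Us \<Gamma>"

lemma dims[simp]: "dim_vec C = n" "dim_vec c = n" "dim_vec \<Gamma> = K" "length Us = K"
  using C c \<Gamma> Us by auto

lemma \<Gamma>_nonneg: "j < K \<Longrightarrow> 0 \<le> \<Gamma> $ j"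
  using \<Gamma> by (auto simp: less_eq_vec_def)

lemma c_in_U: "c \<in> U"
proof -
  have "c = c + 0\<^sub>v n" using c by simp
  moreover have "(\<Sum>i\<in>Us ! j. 0\<^sub>v n $ i) \<le> \<Gamma> $ j" if "j < K" for j
  proof -
    have "(\<Sum>i\<in>Us ! j. 0\<^sub>v n $ i) = (\<Sum>i\<in>Us ! j. 0 :: real)"
      using Us(2)[OF that] by (intro sum.cong) auto
    then show ?thesis using \<Gamma>_nonneg[OF that] by simp
  qed
  ultimately show ?thesis unfolding HP1_set_def by (auto intro!: exI[of _ "0\<^sub>v n"])
qed

text \<open>If no budget contains \<open>i\<close>, then \<open>\<delta> $ i\<close> may be
  arbitrarily large, whereas coordinate \<open>i\<close> is continuous and hence bounded on a
  compact set.\<close>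

lemma covered:
  assumes i: "i < n"
  shows "\<exists>j<K. i \<in> Us ! j"
proof (rule ccontr)
  assume un: "\<not> (\<exists>j<K. i \<in> Us ! j)"
  define pad :: "real vec \<Rightarrow> nat \<Rightarrow> real" where "pad v = (\<lambda>i. if i < n then v $ i else 0)" for v
  have "compact (pad ` U)" using compact by (simp add: compact_vecs_def pad_def)
  moreover have "continuous_on (pad ` U) (\<lambda>v. v i)"
    by (rule continuous_on_subset[OF continuous_on_product_coordinates]) auto
  ultimately have "compact ((\<lambda>v. v i) ` pad ` U)" by (rule compact_continuous_image[rotated])
  then obtain B where B0: "\<And>b. b \<in> (\<lambda>v. v i) ` pad ` U \<Longrightarrow> b \<le> B"
    using compact_attains_sup[of "(\<lambda>v. v i) ` pad ` U"] c_in_U by blast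
  then have B: "v $ i \<le> B" if "v \<in> U" for v
  proof -
    have "pad v i \<in> (\<lambda>v. v i) ` pad ` U" using that by blast
    from B0[OF this] show ?thesis using i by (simp add: pad_def)
  qed
  \<comment> \<open>The entry \<open>\<bar>B\<bar> + 1\<close> exceeds the bound \<open>B\<close>
    even if the nominal cost of \<open>i\<close> is 0.\<close>
  define \<delta> where "\<delta> = vec n (\<lambda>i'. if i' = i then \<bar>B\<bar> + 1 else 0 :: real)"
  have "(\<Sum>i'\<in>Us ! j. \<delta> $ i') \<le> \<Gamma> $ j" if "j < K" for j
  proof -
    have "\<delta> $ i' = 0" if "i' \<in> Us ! j" for i'
    proof -
      have "i' < n" "i' \<noteq> i" using Us(2)[OF \<open>j < K\<close>] un \<open>j < K\<close> that by auto
      then show ?thesis by (simp add: \<delta>_def)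
    qed
    then show ?thesis using \<Gamma>_nonneg[OF that] by simp
  qed
  then have "c + \<delta> \<in> U"
    unfolding HP1_set_def by (auto intro!: exI[of _ \<delta>] simp: \<delta>_def less_eq_vec_def)
  from B[OF this] have "c $ i + (\<bar>B\<bar> + 1) \<le> B" using i by (simp add: \<delta>_def)
  moreover have "0 \<le> c $ i" using c i by (auto simp: less_eq_vec_def)
  ultimately show False by linarith
qed

text \<open>After \<open>y\<close> is bounded by the cover, exchanging the two sums turns
  \<open>\<delta> \<bullet> y\<close> into the left-hand sides of the budget constraints weighted by
  \<open>u\<close>.\<close>

lemma weak_duality:
  assumes x: "x \<in> carrier_vec n" and y: "y \<in> carrier_vec n" "0\<^sub>v n \<le> y"
    and u: "\<And>j. j < K \<Longrightarrow> 0 \<le> u j" "\<And>i. i < n \<Longrightarrow> y $ i \<le> (\<Sum>j<K. if i \<in> Us ! j then u j else 0)"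
    and c': "c' \<in> U"
  shows "C \<bullet> x + c' \<bullet> y \<le> C \<bullet> x + c \<bullet> y + (\<Sum>j<K. \<Gamma> $ j * u j)"
proof -
  obtain \<delta> where \<delta>: "c' = c + \<delta>" "\<delta> \<in> carrier_vec n" "\<And>j. j < K \<Longrightarrow> (\<Sum>i\<in>Us ! j. \<delta> $ i) \<le> \<Gamma> $ j"
    "0\<^sub>v n \<le> \<delta>"
    using c' unfolding HP1_set_def by auto
  have "\<delta> \<bullet> y = (\<Sum>i<n. \<delta> $ i * y $ i)"
    using y by (simp add: scalar_prod_def atLeast0LessThan)
  also have "\<dots> \<le> (\<Sum>i<n. \<delta> $ i * (\<Sum>j<K. if i \<in> Us ! j then u j else 0))"
    using \<delta>(2,4) u by (intro sum_mono mult_left_mono) (auto simp: less_eq_vec_def)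
  also have "\<dots> = (\<Sum>i<n. \<Sum>j<K. if i \<in> Us ! j then \<delta> $ i * u j else 0)"
    by (simp add: sum_distrib_left if_distrib cong: if_cong)
  also have "\<dots> = (\<Sum>j<K. \<Sum>i<n. if i \<in> Us ! j then \<delta> $ i * u j else 0)"
    by (rule sum.swap)
  also have "\<dots> = (\<Sum>j<K. (\<Sum>i\<in>Us ! j. \<delta> $ i) * u j)"
  proof (intro sum.cong refl)
    fix j assume "j \<in> {..<K}"
    then have "{..<n} \<inter> Us ! j = Us ! j" using Us(2) by auto
    then have "(\<Sum>i<n. if i \<in> Us ! j then \<delta> $ i * u j else 0) = (\<Sum>i\<in>Us ! j. \<delta> $ i * u j)"
      using sum.inter_restrict[OF finite_lessThan, of "\<lambda>i. \<delta> $ i * u j" n "Us ! j"] by simp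
    then show "(\<Sum>i<n. if i \<in> Us ! j then \<delta> $ i * u j else 0) = (\<Sum>i\<in>Us ! j. \<delta> $ i) * u j"
      by (simp add: sum_distrib_right)
  qed
  also have "\<dots> \<le> (\<Sum>j<K. \<Gamma> $ j * u j)"
    using \<delta>(3) u by (intro sum_mono mult_right_mono) auto
  finally have "\<delta> \<bullet> y \<le> (\<Sum>j<K. \<Gamma> $ j * u j)" .
  moreover have "c' \<bullet> y = c \<bullet> y + \<delta> \<bullet> y"
    using c y \<delta>(2) by (simp add: \<delta>(1) add_scalar_prod_distrib)
  ultimately show ?thesis by simp
qed

lemma worst_case_cost_le:
  assumes "x \<in> carrier_vec n" "y \<in> carrier_vec n" "0\<^sub>v n \<le> y"
    and "\<And>j. j < K \<Longrightarrow> 0 \<le> u j" "\<And>i. i < n \<Longrightarrow> y $ i \<le> (\<Sum>j<K. if i \<in> Us ! j then u j else 0)"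
  shows "worst_case_cost C U x y \<le> C \<bullet> x + c \<bullet> y + (\<Sum>j<K. \<Gamma> $ j * u j)"
  unfolding worst_case_cost_def using c_in_U weak_duality[OF assms] by (intro cSUP_least) auto

text \<open>A real supremum dominates its elements only if the set is bounded above. The constant
  multiplier 1 is dual feasible, as every index is covered and \<open>y \<le> 1\<close>, and weak
  duality turns it into such a bound.\<close>

lemma le_worst_case_cost:
  assumes x: "x \<in> carrier_vec n" and y: "y \<in> carrier_vec n" "0\<^sub>v n \<le> y" "y \<le> ones_vec n"
    and c': "c' \<in> U"
  shows "C \<bullet> x + c' \<bullet> y \<le> worst_case_cost C U x y"
proof -
  have "y $ i \<le> (\<Sum>j<K. if i \<in> Us ! j then 1 else 0)" if i: "i < n" for i
  proof -
    obtain j where j: "j < K" "i \<in> Us ! j" using covered[OF i] by blast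
    have "y $ i \<le> 1" using y i by (auto simp: less_eq_vec_def)
    also have "\<dots> \<le> (\<Sum>j\<in>{j}. if i \<in> Us ! j then 1 else 0)" using j by simp
    also have "\<dots> \<le> (\<Sum>j<K. if i \<in> Us ! j then 1 else 0)"
      using j by (intro sum_mono2) auto
    finally show ?thesis .
  qed
  then have "C \<bullet> x + c' \<bullet> y \<le> C \<bullet> x + c \<bullet> y + (\<Sum>j<K. \<Gamma> $ j * 1)" if "c' \<in> U" for c'
    using weak_duality[OF x y(1,2), of "\<lambda>_. 1"] that by simp
  then have "bdd_above ((\<lambda>c'. C \<bullet> x + c' \<bullet> y) ` U)" by (rule bdd_aboveI2)
  then show ?thesis unfolding worst_case_cost_def by (intro cSUP_upper c')
qed

text \<open>Every nonnegative \<open>\<delta>\<close> within the budgets is a scenario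
  \<open>c + \<delta>\<close>, so the worst-case cost minus the nominal cost is a valid
  \<open>V\<close> for \<open>covering_dual\<close>.\<close>

lemma strong_duality:
  assumes x: "x \<in> carrier_vec n" and y: "y \<in> carrier_vec n" "0\<^sub>v n \<le> y" "y \<le> ones_vec n"
  obtains u where "\<And>j. j < K \<Longrightarrow> 0 \<le> u j" "\<And>i. i < n \<Longrightarrow> y $ i \<le> (\<Sum>j<K. if i \<in> Us ! j then u j else 0)"
    "C \<bullet> x + c \<bullet> y + (\<Sum>j<K. \<Gamma> $ j * u j) \<le> worst_case_cost C U x y"
proof -
  define V where "V = worst_case_cost C U x y - (C \<bullet> x + c \<bullet> y)"
  have V: "(\<Sum>i<n. \<delta> i * y $ i) \<le> V"
    if \<delta>: "\<And>i. 0 \<le> \<delta> i" "\<And>j. j < K \<Longrightarrow> (\<Sum>i\<in>Us ! j. \<delta> i) \<le> \<Gamma> $ j" for \<delta>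
  proof -
    have "(\<Sum>i\<in>Us ! j. vec n \<delta> $ i) \<le> \<Gamma> $ j" if "j < K" for j
    proof -
      have "(\<Sum>i\<in>Us ! j. vec n \<delta> $ i) = (\<Sum>i\<in>Us ! j. \<delta> i)"
        using Us(2)[OF that] by (intro sum.cong) auto
      then show ?thesis using \<delta>(2)[OF that] by simp
    qed
    then have "c + vec n \<delta> \<in> U"
      unfolding HP1_set_def using \<delta> by (auto intro!: exI[of _ "vec n \<delta>"] simp: less_eq_vec_def)
    from le_worst_case_cost[OF x y this]
    have "C \<bullet> x + (c \<bullet> y + vec n \<delta> \<bullet> y) \<le> worst_case_cost C U x y"
      using c y by (simp add: add_scalar_prod_distrib[of _ n])
    moreover have "vec n \<delta> \<bullet> y = (\<Sum>i<n. \<delta> i * y $ i)"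
      using y by (simp add: scalar_prod_def atLeast0LessThan)
    ultimately show ?thesis by (simp add: V_def)
  qed
  show ?thesis
  proof (rule covering_dual[of K "\<lambda>j. Us ! j" n "\<lambda>j. \<Gamma> $ j" "\<lambda>i. y $ i" V])
    fix u assume u: "\<And>j. j < K \<Longrightarrow> 0 \<le> u j"
      "\<And>i. i < n \<Longrightarrow> y $ i \<le> (\<Sum>j<K. if i \<in> Us ! j then u j else 0)" "(\<Sum>j<K. \<Gamma> $ j * u j) \<le> V"
    have "C \<bullet> x + c \<bullet> y + (\<Sum>j<K. \<Gamma> $ j * u j) \<le> worst_case_cost C U x y"
      using u(3) by (simp add: V_def)
    from that[OF u(1,2) this] show ?thesis .
  qed (use Us(2) \<Gamma>_nonneg V in auto)
qed

end

section \<open>Coordinatewise descriptions of the feasible sets\<close>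

lemma vec_le_iff:
  assumes "v \<in> carrier_vec n" "w \<in> carrier_vec n"
  shows "v \<le> w \<longleftrightarrow> (\<forall>i<n. v $ i \<le> w $ i)"
proof -
  have "dim_vec v = n" "dim_vec w = n" using assms by auto
  then show ?thesis by (simp add: less_eq_vec_def)
qed

lemma mem_box_polyhedron_iff:
  "v \<in> box_polyhedron H g \<longleftrightarrow> v \<in> carrier_vec (dim_col H) \<and> g \<le> H *\<^sub>v v \<and>
     (\<forall>i<dim_col H. 0 \<le> v $ i \<and> v $ i \<le> 1)"
proof -
  have "0\<^sub>v (dim_col H) \<le> v \<and> v \<le> ones_vec (dim_col H) \<longleftrightarrow> (\<forall>i<dim_col H. 0 \<le> v $ i \<and> v $ i \<le> 1)"
    if v: "v \<in> carrier_vec (dim_col H)"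
    using vec_le_iff[OF zero_carrier_vec v] vec_le_iff[OF v, of "ones_vec (dim_col H)"] by auto
  then show ?thesis unfolding box_polyhedron_def by blast
qed

lemma mem_recourse_set_iff:
  assumes x: "x \<in> carrier_vec (dim_col H)"
  shows "y \<in> recourse_set H g x \<longleftrightarrow> y \<in> carrier_vec (dim_col H) \<and> g \<le> H *\<^sub>v (y + x) \<and>
     (\<forall>i<dim_col H. 0 \<le> y $ i \<and> y $ i \<le> 1 - x $ i)"
proof -
  have "0\<^sub>v (dim_col H) \<le> y \<and> y \<le> ones_vec (dim_col H) - x \<longleftrightarrow> (\<forall>i<dim_col H. 0 \<le> y $ i \<and> y $ i \<le> 1 - x $ i)"
    if y: "y \<in> carrier_vec (dim_col H)"
    using x vec_le_iff[OF zero_carrier_vec y] vec_le_iff[OF y, of "ones_vec (dim_col H) - x"] by auto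
  then show ?thesis unfolding recourse_set_def by blast
qed

lemma sub_feasible_bounds:
  assumes "(x, y) \<in> sub_feasible H g d"
  shows "x \<in> binary_vecs (dim_col H)" "x \<in> carrier_vec (dim_col H)" "y \<in> carrier_vec (dim_col H)"
    "0\<^sub>v (dim_col H) \<le> y" "y \<le> ones_vec (dim_col H)" "y \<in> recourse_set H g x"
proof -
  have xb: "x \<in> binary_vecs (dim_col H)" and y: "y \<in> carrier_vec (dim_col H)" "0\<^sub>v (dim_col H) \<le> y"
    and xy: "x + y \<le> ones_vec (dim_col H)" and H: "g \<le> H *\<^sub>v (y + x)"
    using assms by (simp_all add: sub_feasible_def)
  have xn: "x \<in> carrier_vec (dim_col H)" using xb by (simp add: binary_vecs_def)
  have bd: "0 \<le> x $ i \<and> 0 \<le> y $ i \<and> x $ i + y $ i \<le> 1" if i: "i < dim_col H" for i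
  proof -
    have "0 \<le> x $ i" using xb i by (auto simp: binary_vecs_def)
    moreover have "0 \<le> y $ i" using y i vec_le_iff[OF zero_carrier_vec y(1)] by simp
    moreover have "(x + y) $ i \<le> 1"
      using xy i vec_le_iff[OF add_carrier_vec[OF xn y(1)], of "ones_vec (dim_col H)"] by simp
    ultimately show ?thesis using xn y(1) i by simp
  qed
  show "y \<le> ones_vec (dim_col H)"
  proof -
    have "y $ i \<le> 1" if "i < dim_col H" for i using bd[OF that] by linarith
    then show ?thesis using vec_le_iff[OF y(1), of "ones_vec (dim_col H)"] by simp
  qed
  have "y $ i \<le> 1 - x $ i" if "i < dim_col H" for i using bd[OF that] by linarith
  then show "y \<in> recourse_set H g x"
    using bd y(1) H by (simp add: mem_recourse_set_iff[OF xn])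
qed (use assms in \<open>simp_all add: sub_feasible_def binary_vecs_def\<close>)

lemma box_polyhedron_bounds:
  assumes "v \<in> box_polyhedron H g" "i < dim_col H"
  shows "0 \<le> v $ i" "v $ i \<le> 1"
  using assms by (simp_all add: mem_box_polyhedron_iff)

lemma integral_bounded_01:
  fixes a :: real
  assumes "a \<in> \<int>" "0 \<le> a" "a \<le> 1"
  shows "a = 0 \<or> a = 1"
  using assms by (elim Ints_cases) auto

section \<open>Rounding to the grid\<close>

text \<open>Besides the decomposition of \<open>z\<close> into binary points, the last clause keeps
  the other half of integrality: any convex weights on points of \<open>T\<close> give a point of
  the polyhedron again. This licenses dropping points and renormalizing.\<close>

definition box_combination :: "real mat \<Rightarrow> real vec \<Rightarrow> real vec \<Rightarrow> real vec set \<Rightarrow> (real vec \<Rightarrow> real) \<Rightarrow> bool" where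
  "box_combination H g z T w \<longleftrightarrow> finite T \<and> T \<subseteq> box_polyhedron H g \<and> (\<forall>v\<in>T. 0 \<le> w v) \<and> (\<Sum>v\<in>T. w v) = 1 \<and>
    (\<forall>v\<in>T. \<forall>i<dim_col H. v $ i = 0 \<or> v $ i = 1) \<and>
    (\<forall>i<dim_col H. z $ i = (\<Sum>v\<in>T. w v * v $ i)) \<and>
    (\<forall>T' w'. T' \<subseteq> T \<longrightarrow> (\<forall>v\<in>T'. 0 \<le> w' v) \<longrightarrow> (\<Sum>v\<in>T'. w' v) = 1 \<longrightarrow>
       vec (dim_col H) (\<lambda>i. \<Sum>v\<in>T'. w' v * v $ i) \<in> box_polyhedron H g)"

lemma integral_box_combination:
  assumes int: "integral_polyhedron (dim_col H) (box_polyhedron H g)"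
    and z: "z \<in> box_polyhedron H g"
  shows "\<exists>T w. box_combination H g z T w"
proof -
  define n where "n = dim_col H"
  define P where "P = box_polyhedron H g"
  define I where "I = {v \<in> P. \<forall>i<n. v $ i \<in> \<int>}"
  have P: "P = vec_convex_hull n I" using int by (simp add: integral_polyhedron_def P_def I_def n_def)
  with z obtain T w where T: "finite T" "T \<subseteq> I" "\<forall>v\<in>T. 0 \<le> w v" "(\<Sum>v\<in>T. w v) = 1"
    "\<forall>i<n. z $ i = (\<Sum>v\<in>T. w v * v $ i)"
    unfolding P_def[symmetric] by (auto simp: vec_convex_hull_def)
  have "v $ i = 0 \<or> v $ i = 1" if "v \<in> T" "i < n" for v i
    using that T(2) box_polyhedron_bounds[of v H g i]
    by (intro integral_bounded_01) (auto simp: I_def P_def n_def)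
  moreover have "vec n (\<lambda>i. \<Sum>v\<in>T'. w' v * v $ i) \<in> P"
    if T': "T' \<subseteq> T" and w': "\<forall>v\<in>T'. 0 \<le> w' v" "(\<Sum>v\<in>T'. w' v) = (1 :: real)" for T' w'
  proof -
    have "finite T'" "T' \<subseteq> I" using T T' finite_subset by auto
    with w' show ?thesis
      unfolding P vec_convex_hull_def by (auto intro!: exI[of _ T'] exI[of _ w'])
  qed
  moreover have "T \<subseteq> P" using T(2) by (auto simp: I_def)
  ultimately have "box_combination H g z T w"
    using T unfolding box_combination_def P_def n_def by blast
  then show ?thesis by blast
qed

lemma recourse_sum_in_box:
  assumes x: "x \<in> binary_vecs (dim_col H)" and y: "y \<in> recourse_set H g x"
  shows "y + x \<in> box_polyhedron H g"
proof -
  have xn: "x \<in> carrier_vec (dim_col H)" using x by (simp add: binary_vecs_def)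
  have "0 \<le> x $ i" if "i < dim_col H" for i using x that by (auto simp: binary_vecs_def)
  then show ?thesis
    using y xn unfolding mem_recourse_set_iff[OF xn] mem_box_polyhedron_iff
    by (auto simp: add_increasing2)
qed

text \<open>Where \<open>x_i = 1\<close>, the vector \<open>y + x\<close> has value at least 1, so
  every binary point of positive weight in its decomposition has entry 1 at \<open>i\<close>. For
  any such point \<open>v\<close>, the difference \<open>v - x\<close> is a binary recourse.\<close>

lemma recourse_imp_first_stage:
  assumes int: "integral_polyhedron (dim_col H) (box_polyhedron H g)"
    and x: "x \<in> binary_vecs (dim_col H)" and y: "y \<in> recourse_set H g x"
  shows "x \<in> first_stage_set H g"
proof -
  define n where "n = dim_col H"
  have xn: "x \<in> carrier_vec n" and x01: "\<And>i. i < n \<Longrightarrow> x $ i = 0 \<or> x $ i = 1"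
    using x by (auto simp: binary_vecs_def n_def)
  have yn: "y \<in> carrier_vec n" "\<And>i. i < n \<Longrightarrow> 0 \<le> y $ i"
    using y xn by (auto simp: mem_recourse_set_iff n_def)
  obtain T w where bc: "box_combination H g (y + x) T w"
    using integral_box_combination[OF int recourse_sum_in_box[OF x y]] by blast
  have T: "finite T" "T \<subseteq> box_polyhedron H g" "\<And>v. v \<in> T \<Longrightarrow> 0 \<le> w v" "(\<Sum>v\<in>T. w v) = 1"
    "\<And>v i. v \<in> T \<Longrightarrow> i < n \<Longrightarrow> v $ i = 0 \<or> v $ i = 1"
    "\<And>i. i < n \<Longrightarrow> (y + x) $ i = (\<Sum>v\<in>T. w v * v $ i)"
    using bc[unfolded box_combination_def, folded n_def] by blast+
  from T(4) have "\<exists>v\<in>T. w v \<noteq> 0" by (intro ccontr[of "\<exists>v\<in>T. w v \<noteq> 0"]) auto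
  then obtain v where v: "v \<in> T" "0 < w v" using T(3) by force
  have vP: "v \<in> box_polyhedron H g" using v T by auto
  have one: "v $ i = 1" if i: "i < n" and xi: "x $ i = 1" for i
  proof (rule ccontr)
    assume "v $ i \<noteq> 1"
    then have vi: "v $ i = 0" using T(5) v i by blast
    have "1 \<le> (y + x) $ i" using i xi yn xn by simp
    also have "\<dots> = (\<Sum>v\<in>T. w v * v $ i)" using T(6) i by simp
    also have "\<dots> = w v * v $ i + (\<Sum>v\<in>T - {v}. w v * v $ i)"
      using T(1) v by (subst sum.remove[of _ v]) auto
    \<comment> \<open>The point \<open>v\<close> contributes nothing and the others at most their
      weights, which leaves a total below 1.\<close>
    also have "\<dots> \<le> 0 + (\<Sum>v\<in>T - {v}. w v)"
      using T i vi by (intro add_mono sum_mono) (auto intro!: mult_left_le simp: n_def dest!: box_polyhedron_bounds)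
    also have "\<dots> = 1 - w v" using T(1,4) v by (simp add: sum_diff1)
    finally show False using v by simp
  qed
  have "v \<in> carrier_vec n" using vP by (simp add: box_polyhedron_def n_def)
  have bin: "v - x \<in> binary_vecs n"
    unfolding binary_vecs_def using T(5)[OF v(1)] x01 one xn \<open>v \<in> carrier_vec n\<close> by fastforce
  have "x + (v - x) = v" using xn \<open>v \<in> carrier_vec n\<close> by auto
  then have "x + (v - x) \<in> feasible_set H g"
    using vP T(5)[OF v(1)] by (simp add: feasible_set_def mem_box_polyhedron_iff binary_vecs_def n_def)
  then show ?thesis using x bin by (auto simp: first_stage_set_def n_def)
qed

lemma first_stage_recourse:
  assumes "x \<in> first_stage_set H g"
  shows "x \<in> binary_vecs (dim_col H)" "recourse_set H g x \<noteq> {}"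
proof -
  from assms obtain y where x: "x \<in> binary_vecs (dim_col H)" and y: "y \<in> binary_vecs (dim_col H)"
    "x + y \<in> feasible_set H g" by (auto simp: first_stage_set_def)
  then have xy: "y + x = x + y" by (auto simp: binary_vecs_def comm_add_vec)
  have xn: "x \<in> carrier_vec (dim_col H)" and yn: "y \<in> carrier_vec (dim_col H)"
    using x y by (auto simp: binary_vecs_def)
  have "0 \<le> y $ i \<and> y $ i \<le> 1 - x $ i" if i: "i < dim_col H" for i
  proof -
    have "(x + y) $ i = 0 \<or> (x + y) $ i = 1" "x $ i = 0 \<or> x $ i = 1" "y $ i = 0 \<or> y $ i = 1"
      using x y i by (auto simp: feasible_set_def binary_vecs_def)
    then show ?thesis using xn yn i by auto
  qed
  then have "y \<in> recourse_set H g x"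
    using y xy xn yn by (simp add: mem_recourse_set_iff feasible_set_def)
  then show "recourse_set H g x \<noteq> {}" by blast
  show "x \<in> binary_vecs (dim_col H)" by fact
qed

text \<open>Write \<open>x + y\<close> as a convex combination of binary vectors and drop those that use an index
  \<open>i\<close> with \<open>y\<^sub>i < \<eta>\<close>: the dropped weight is at most \<open>n \<eta>\<close>.\<close>

lemma remove_small_recourse:
  assumes int: "integral_polyhedron (dim_col H) (box_polyhedron H g)"
    and x: "x \<in> binary_vecs (dim_col H)" and y: "y \<in> recourse_set H g x"
    and \<eta>: "0 \<le> \<eta>" "real (dim_col H) * \<eta> < 1"
  obtains y' where "y' \<in> recourse_set H g x"
    "\<And>i. i < dim_col H \<Longrightarrow> y' $ i \<le> y $ i / (1 - real (dim_col H) * \<eta>)"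
    "\<And>i. i < dim_col H \<Longrightarrow> y $ i < \<eta> \<Longrightarrow> y' $ i = 0"
proof -
  define n where "n = dim_col H"
  have xn: "x \<in> carrier_vec n" and x01: "\<And>i. i < n \<Longrightarrow> x $ i = 0 \<or> x $ i = 1"
    using x by (auto simp: binary_vecs_def n_def)
  have yn: "y \<in> carrier_vec n" "\<And>i. i < n \<Longrightarrow> 0 \<le> y $ i" "\<And>i. i < n \<Longrightarrow> y $ i \<le> 1 - x $ i"
    using y xn by (auto simp: mem_recourse_set_iff n_def)
  obtain T w where bc: "box_combination H g (y + x) T w"
    using integral_box_combination[OF int recourse_sum_in_box[OF x y]] by blast
  have T: "finite T" "T \<subseteq> box_polyhedron H g" "\<And>v. v \<in> T \<Longrightarrow> 0 \<le> w v" "(\<Sum>v\<in>T. w v) = 1"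
    "\<And>v i. v \<in> T \<Longrightarrow> i < n \<Longrightarrow> v $ i = 0 \<or> v $ i = 1"
    "\<And>i. i < n \<Longrightarrow> (y + x) $ i = (\<Sum>v\<in>T. w v * v $ i)"
    using bc[unfolded box_combination_def, folded n_def] by blast+
  have T': "vec n (\<lambda>i. \<Sum>v\<in>T'. w' v * v $ i) \<in> box_polyhedron H g"
    if "T' \<subseteq> T" "\<And>v. v \<in> T' \<Longrightarrow> 0 \<le> w' v" "(\<Sum>v\<in>T'. w' v) = 1" for T' w'
  proof -
    have "\<forall>T' w'. T' \<subseteq> T \<longrightarrow> (\<forall>v\<in>T'. 0 \<le> w' v) \<longrightarrow> (\<Sum>v\<in>T'. w' v) = 1 \<longrightarrow>
        vec n (\<lambda>i. \<Sum>v\<in>T'. w' v * v $ i) \<in> box_polyhedron H g"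
      using bc[unfolded box_combination_def, folded n_def] by blast
    then show ?thesis using that by simp
  qed
  have wv: "0 \<le> w v * v $ i" if "v \<in> T" "i < n" for v i
    using T(3)[OF that(1)] T(5)[OF that] by auto
  \<comment> \<open>Indices with \<open>x_i = 1\<close> are excluded. There \<open>y_i = 0\<close>
    is small, but every point of positive weight uses \<open>i\<close> on account of
    \<open>x\<close>, so no point may be dropped because of it.\<close>
  define J where "J = {i. i < n \<and> x $ i = 0 \<and> y $ i < \<eta>}"
  define B where "B = {v \<in> T. \<exists>i\<in>J. v $ i = 1}"
  define T' where "T' = T - B"
  define W where "W = sum w T'"
  have finJ: "finite J" by (auto simp: J_def)
  \<comment> \<open>Union bound: a dropped point uses some index of \<open>J\<close>, so its weight
    is counted at least once in the total use of \<open>J\<close>. As \<open>x\<close> vanishes on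
    \<open>J\<close>, that total is the sum of the small entries of \<open>y\<close>.\<close>
  have "sum w B \<le> (\<Sum>v\<in>T. \<Sum>i\<in>J. w v * v $ i)"
  proof -
    have "sum w B \<le> (\<Sum>v\<in>B. \<Sum>i\<in>J. w v * v $ i)"
    proof (rule sum_mono)
      fix v assume "v \<in> B"
      then obtain i where i: "v \<in> T" "i \<in> J" "v $ i = 1" by (auto simp: B_def)
      then have "w v = (\<Sum>i\<in>{i}. w v * v $ i)" by simp
      also have "\<dots> \<le> (\<Sum>i\<in>J. w v * v $ i)"
        using i finJ wv by (intro sum_mono2) (auto simp: J_def)
      finally show "w v \<le> (\<Sum>i\<in>J. w v * v $ i)" .
    qed
    also have "\<dots> \<le> (\<Sum>v\<in>T. \<Sum>i\<in>J. w v * v $ i)"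
      using T(1) wv by (intro sum_mono2 sum_nonneg) (auto simp: B_def J_def)
    finally show ?thesis .
  qed
  also have "\<dots> = (\<Sum>i\<in>J. \<Sum>v\<in>T. w v * v $ i)" by (rule sum.swap)
  also have "\<dots> = (\<Sum>i\<in>J. y $ i)"
    using T(6)[symmetric] xn yn(1) by (intro sum.cong) (auto simp: J_def)
  also have "\<dots> \<le> (\<Sum>i\<in>J. \<eta>)" by (intro sum_mono) (auto simp: J_def)
  also have "\<dots> \<le> real n * \<eta>"
  proof -
    have "J \<subseteq> {..<n}" by (auto simp: J_def)
    then have "card J \<le> n" using card_mono[of "{..<n}" J] by simp
    then show ?thesis using \<eta> by (simp add: mult_right_mono)
  qed
  finally have "sum w B \<le> real n * \<eta>" .
  moreover have "sum w T = W + sum w B"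
    unfolding W_def T'_def using T(1) by (intro sum.subset_diff) (auto simp: B_def)
  ultimately have W: "1 - real n * \<eta> \<le> W" using T(4) by linarith
  have \<eta>1: "0 < 1 - real n * \<eta>" using \<eta> by (simp add: n_def)
  then have W0: "0 < W" using W by linarith
  have T'T: "T' \<subseteq> T" by (auto simp: T'_def)
  then have "finite T'" using T(1) finite_subset by blast
  define z where "z = vec n (\<lambda>i. \<Sum>v\<in>T'. w v / W * v $ i)"
  have "(\<Sum>v\<in>T'. w v / W) = 1" using W0 by (simp add: sum_divide_distrib[symmetric] W_def)
  then have zP: "z \<in> box_polyhedron H g"
    unfolding z_def using T'T T(3) W0 by (intro T') auto
  have zn: "z \<in> carrier_vec n" by (simp add: z_def)
  have z1: "z $ i = 1" if i: "i < n" and xi: "x $ i = 1" for i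
  proof -
    have "y $ i = 0" using yn(2,3)[OF i] xi by simp
    \<comment> \<open>Here \<open>y + x\<close> has the largest possible value 1, so every point of
      positive weight has entry 1 at \<open>i\<close>, and renormalizing the remaining weights
      preserves this.\<close>
    then have "(\<Sum>v\<in>T. w v * (1 - v $ i)) = 0"
      using T(4) T(6)[OF i] xn yn xi i by (simp add: right_diff_distrib sum_subtractf)
    moreover have "\<And>v. v \<in> T \<Longrightarrow> 0 \<le> w v * (1 - v $ i)" using T(3,5) i by force
    ultimately have "\<forall>v\<in>T. w v * (1 - v $ i) = 0" using T(1) by (simp add: sum_nonneg_eq_0_iff)
    then have "(\<Sum>v\<in>T'. w v / W * v $ i) = (\<Sum>v\<in>T'. w v / W)"
      using T'T by (intro sum.cong) auto
    then show ?thesis using i \<open>(\<Sum>v\<in>T'. w v / W) = 1\<close> by (simp add: z_def)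
  qed
  define y' where "y' = z - x"
  have y'i: "y' $ i = z $ i - x $ i" if "i < n" for i using that xn zn by (simp add: y'_def)
  have y'n: "y' \<in> carrier_vec n" using xn zn by (simp add: y'_def)
  have y'_ge: "0 \<le> y' $ i" if "i < n" for i
    using y'i[OF that] z1[OF that] x01[OF that] box_polyhedron_bounds(1)[OF zP] that
    by (auto simp: n_def)
  have zx: "y' + x = z" using xn zn by (auto simp: y'_def)
  have "y' $ i \<le> 1 - x $ i" if "i < n" for i
    using y'i[OF that] box_polyhedron_bounds(2)[OF zP] that by (simp add: n_def)
  then have "y' \<in> recourse_set H g x"
    using zP zx y'_ge y'n xn by (simp add: mem_recourse_set_iff mem_box_polyhedron_iff n_def)
  moreover have "y' $ i \<le> y $ i / (1 - real n * \<eta>)" if i: "i < n" for i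
  proof (cases "x $ i = 1")
    case True
    then have "y' $ i = 0" using y'i[OF i] z1[OF i] by simp
    then show ?thesis using yn(2)[OF i] \<eta>1 by simp
  next
    case False
    then have xi: "x $ i = 0" using x01[OF i] by simp
    have "y' $ i = (\<Sum>v\<in>T'. w v * v $ i) / W"
      using i xi y'i[OF i] by (simp add: z_def sum_divide_distrib)
    also have "\<dots> \<le> (\<Sum>v\<in>T. w v * v $ i) / W"
      using W0 T(1) wv i T'T by (intro divide_right_mono sum_mono2) auto
    also have "\<dots> = y $ i / W" using T(6)[OF i, symmetric] xi i xn yn by simp
    also have "\<dots> \<le> y $ i / (1 - real n * \<eta>)"
      using W \<eta>1 yn(2)[OF i] by (intro divide_left_mono) auto
    finally show ?thesis .
  qed
  moreover have "y' $ i = 0" if i: "i < n" and small: "y $ i < \<eta>" for i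
  proof (cases "x $ i = 1")
    case True
    then show ?thesis using y'i[OF i] z1[OF i] by simp
  next
    case False
    then have xi: "x $ i = 0" using x01[OF i] by simp
    then have "i \<in> J" using i small by (simp add: J_def)
    then have "v $ i = 0" if "v \<in> T'" for v
      using that T(5)[of v i] i by (auto simp: T'_def B_def)
    then show ?thesis using y'i[OF i] xi i by (simp add: z_def)
  qed
  ultimately show ?thesis using that by (simp add: n_def)
qed


section \<open>Approximation of the optimum by grid points\<close>

context HP1_instance
begin

text \<open>The digits divided by \<open>t\<close> are dual feasible for \<open>y\<close>, since the
  caps are at most the digit sums. By weak duality a solution may therefore be judged by its grid
  cost, which never underestimates the worst case.\<close>

lemma grid_point_cost:
  assumes H: "dim_col H = n"
    and sub: "(x, y) \<in> sub_feasible H g (grid_bounds n t Us N)" and t: "1 \<le> t"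
  shows "worst_case_cost C U x y \<le> grid_cost C c \<Gamma> t N (x, y)"
proof -
  note f = sub_feasible_bounds[OF sub, unfolded H]
  have "y $ i \<le> (\<Sum>j<K. if i \<in> Us ! j then real (digit t N j) / real t else 0)" if i: "i < n" for i
  proof -
    have "y \<le> grid_bounds n t Us N" using sub by (simp add: sub_feasible_def)
    then have "y $ i \<le> real (grid_caps n t Us N $ i) / real t"
      using vec_le_iff[OF f(3), of "grid_bounds n t Us N"] i by simp
    also have "\<dots> \<le> real (\<Sum>j<K. if i \<in> Us ! j then digit t N j else 0) / real t"
    proof (intro divide_right_mono of_nat_mono)
      show "grid_caps n t Us N $ i \<le> (\<Sum>j<K. if i \<in> Us ! j then digit t N j else 0)"
        using i by (simp add: grid_caps_def)
    qed simp
    also have "\<dots> = (\<Sum>j<K. if i \<in> Us ! j then real (digit t N j) / real t else 0)"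
      by (auto simp: sum_divide_distrib intro!: sum.cong)
    finally show ?thesis .
  qed
  then have "worst_case_cost C U x y \<le> C \<bullet> x + c \<bullet> y + (\<Sum>j<K. \<Gamma> $ j * (real (digit t N j) / real t))"
    by (intro worst_case_cost_le f) auto
  then show ?thesis by (simp add: grid_cost_def)
qed

lemma worst_case_cost_nonneg:
  assumes "x \<in> carrier_vec n" "0\<^sub>v n \<le> x" "y \<in> carrier_vec n" "0\<^sub>v n \<le> y" "y \<le> ones_vec n"
  shows "0 \<le> worst_case_cost C U x y"
proof -
  have "0 \<le> C $ i * x $ i + c $ i * y $ i" if "i < n" for i
    using that C c assms vec_le_iff[OF zero_carrier_vec] by (auto intro!: add_nonneg_nonneg mult_nonneg_nonneg)
  then have "0 \<le> C \<bullet> x + c \<bullet> y"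
    using assms by (auto simp: scalar_prod_def sum.distrib[symmetric] intro!: sum_nonneg)
  then show ?thesis using le_worst_case_cost[OF assms(1,3-5) c_in_U] by linarith
qed

text \<open>The solution \<open>y\<close> is replaced by \<open>y'\<close> without small nonzero
  entries, and an optimal dual \<open>u\<close> of \<open>y\<close> is stretched by
  \<open>\<kappa>\<close> and then rounded down. Stretching makes room for both the growth of
  \<open>y'\<close> and the rounding; rounding down keeps the dual cost within the factor
  \<open>\<kappa>\<close>.\<close>

lemma exists_grid_point:
  fixes e :: nat
  assumes H: "dim_col H = n" and int: "integral_polyhedron n (box_polyhedron H g)"
    and e: "1 \<le> e" and t: "t = 9 * (K + 1) * (n + 1) * e\<^sup>2"
    and x: "x \<in> binary_vecs n" and y: "y \<in> recourse_set H g x"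
  shows "\<exists>N<(t + 1) ^ K. \<exists>y'. (x, y') \<in> sub_feasible H g (grid_bounds n t Us N) \<and>
     grid_cost C c \<Gamma> t N (x, y') \<le> (1 + 1 / real e) * worst_case_cost C U x y"
proof -
  \<comment> \<open>Dropping the entries below \<open>\<eta>\<close> costs at most the factor
    \<open>\<beta>\<close>, and the room for rounding is a further factor \<open>1 + 1 / E\<close>.
    Their product \<open>\<kappa> = (E + 1) / (E - 1)\<close> is at most \<open>1 + 1 / e\<close>
    for \<open>E = 3 * e\<close> and \<open>e \<ge> 1\<close>.\<close>
  define E where "E = 3 * real e"
  define \<eta> where "\<eta> = 1 / (E * (real n + 1))"
  define \<beta> where "\<beta> = E / (E - 1)"
  define \<kappa> where "\<kappa> = (E + 1) / (E - 1)"
  have E: "3 \<le> E" using e by (simp add: E_def)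
  have \<eta>: "0 < \<eta>" "real n * \<eta> \<le> 1 / E" "real n * \<eta> < 1"
  proof -
    show "0 < \<eta>" using E by (simp add: \<eta>_def)
    have "real n * \<eta> = (real n / (real n + 1)) * (1 / E)" by (simp add: \<eta>_def)
    also have "\<dots> \<le> 1 * (1 / E)" using E by (intro mult_right_mono) auto
    finally show "real n * \<eta> \<le> 1 / E" by simp
    moreover have "1 / E < 1" using E by simp
    ultimately show "real n * \<eta> < 1" by linarith
  qed
  have \<beta>: "1 \<le> \<beta>" "1 / (1 - real n * \<eta>) \<le> \<beta>"
  proof -
    show "1 \<le> \<beta>" using E by (simp add: \<beta>_def)
    have "1 / (1 - real n * \<eta>) \<le> 1 / (1 - 1 / E)" using \<eta> E by (intro divide_left_mono) auto
    also have "\<dots> = \<beta>" using E by (simp add: \<beta>_def field_simps)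
    finally show "1 / (1 - real n * \<eta>) \<le> \<beta>" .
  qed
  have \<kappa>: "\<kappa> = \<beta> * (1 + 1 / E)" using E by (simp add: \<kappa>_def \<beta>_def field_simps)
  have \<beta>\<kappa>: "\<beta> \<le> \<kappa>" using \<beta>(1) E by (simp add: \<kappa>)
  have \<kappa>_le: "\<kappa> \<le> 1 + 1 / real e" using E e by (simp add: \<kappa>_def E_def field_simps)
  \<comment> \<open>The factor \<open>9 * e\<^sup>2\<close> in \<open>t\<close> is
    \<open>E\<^sup>2\<close>: one \<open>E\<close> comes from \<open>1 / \<eta>\<close>, the other
    from the relative room \<open>1 / E\<close>. Measured in units of \<open>1 / t\<close>, the room
    at an entry of size \<open>\<eta>\<close> is thus \<open>K + 1\<close>, more than
    \<open>K\<close> roundings can use up.\<close>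
  have "real t = (real K + 1) * (E * (real n + 1) * E)"
    by (simp add: t E_def power2_eq_square algebra_simps)
  then have t\<eta>: "real t * \<eta> / E = real K + 1"
    using E by (simp add: \<eta>_def)
  have "0 < t" using e by (simp add: t)
  have xn: "x \<in> carrier_vec n" and x0: "\<And>i. i < n \<Longrightarrow> 0 \<le> x $ i" using x by (auto simp: binary_vecs_def)
  note rec_iff = mem_recourse_set_iff[of x H, unfolded H, OF xn]
  have yn: "y \<in> carrier_vec n" and y0: "\<And>i. i < n \<Longrightarrow> 0 \<le> y $ i"
    and yx: "\<And>i. i < n \<Longrightarrow> y $ i \<le> 1 - x $ i"
    using y by (simp_all add: rec_iff)
  have y1: "y $ i \<le> 1" if "i < n" for i using yx[OF that] x0[OF that] by linarith
  have y01: "0\<^sub>v n \<le> y" "y \<le> ones_vec n"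
    using y0 y1 vec_le_iff[OF zero_carrier_vec yn] vec_le_iff[OF yn, of "ones_vec n"] by simp_all
  then obtain u where u: "\<And>j. j < K \<Longrightarrow> 0 \<le> u j"
    "\<And>i. i < n \<Longrightarrow> y $ i \<le> (\<Sum>j<K. if i \<in> Us ! j then u j else 0)"
    "C \<bullet> x + c \<bullet> y + (\<Sum>j<K. \<Gamma> $ j * u j) \<le> worst_case_cost C U x y"
    using strong_duality[OF xn yn] by blast
  obtain y' where y': "y' \<in> recourse_set H g x"
    "\<And>i. i < n \<Longrightarrow> y' $ i \<le> y $ i / (1 - real n * \<eta>)"
    "\<And>i. i < n \<Longrightarrow> y $ i < \<eta> \<Longrightarrow> y' $ i = 0"
    using remove_small_recourse[of H g x y \<eta>, unfolded H, OF int x y] \<eta> by auto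
  have y'n: "y' \<in> carrier_vec n" and y'0: "\<And>i. i < n \<Longrightarrow> 0 \<le> y' $ i"
    and y'x: "\<And>i. i < n \<Longrightarrow> y' $ i \<le> 1 - x $ i" and Hy': "g \<le> H *\<^sub>v (y' + x)"
    using y'(1) by (simp_all add: rec_iff)
  have y'1: "y' $ i \<le> 1" if "i < n" for i using y'x[OF that] x0[OF that] by linarith
  have y'\<beta>: "y' $ i \<le> \<beta> * y $ i" if i: "i < n" for i
  proof -
    have "y' $ i \<le> 1 / (1 - real n * \<eta>) * y $ i" using y'(2)[OF i] by simp
    also have "\<dots> \<le> \<beta> * y $ i" using \<beta>(2) y0[OF i] by (intro mult_right_mono)
    finally show ?thesis .
  qed
  \<comment> \<open>Rounding \<open>\<kappa> u\<close> down costs at most \<open>K / t\<close> in each constraint; the slack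
    \<open>(\<kappa> - \<beta>) y\<^sub>i \<ge> \<eta> / E\<close> pays for it because only indices with \<open>y\<^sub>i \<ge> \<eta>\<close> matter.\<close>
  define f where "f j = min t (nat \<lfloor>real t * (\<kappa> * u j)\<rfloor>)" for j
  obtain N where N: "N < (t + 1) ^ K" "\<And>j. j < K \<Longrightarrow> digit t N j = f j"
    using digits_surj[of K f t] by (auto simp: f_def)
  have \<kappa>u: "0 \<le> real t * (\<kappa> * u j)" if "j < K" for j
    using u(1)[OF that] \<beta>(1) \<beta>\<kappa> by simp
  have f_le: "real (f j) \<le> real t * (\<kappa> * u j)" if "j < K" for j
  proof -
    have "real (f j) \<le> real (nat \<lfloor>real t * (\<kappa> * u j)\<rfloor>)" by (simp add: f_def)
    also have "\<dots> \<le> real t * (\<kappa> * u j)" using \<kappa>u[OF that] by (simp add: of_nat_floor)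
    finally show ?thesis .
  qed
  have f_ge: "real t * (\<kappa> * u j) - 1 \<le> real (f j)" if "j < K" "f j < t" for j
  proof -
    have "f j = nat \<lfloor>real t * (\<kappa> * u j)\<rfloor>" using that(2) by (auto simp: f_def)
    moreover have "real t * (\<kappa> * u j) - 1 \<le> real_of_int \<lfloor>real t * (\<kappa> * u j)\<rfloor>"
      by linarith
    moreover have "0 \<le> \<lfloor>real t * (\<kappa> * u j)\<rfloor>" using \<kappa>u[OF that(1)] by simp
    ultimately show ?thesis by simp
  qed
  have caps: "real t * y' $ i \<le> real (grid_caps n t Us N $ i)" if i: "i < n" for i
  proof -
    define s where "s = (\<Sum>j<K. if i \<in> Us ! j then f j else 0)"
    have "(\<Sum>j<K. if i \<in> Us ! j then digit t N j else 0) = s"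
      unfolding s_def using N(2) by (intro sum.cong) auto
    then have caps_eq: "grid_caps n t Us N $ i = min t s" using i by (simp add: grid_caps_def)
    have "real t * y' $ i \<le> real t" using y'1[OF i] by (simp add: mult_left_le)
    moreover have "real t * y' $ i \<le> real s"
    proof (cases "y $ i < \<eta>")
      case True
      then show ?thesis using y'(3)[OF i] by simp
    next
      case big: False
      \<comment> \<open>If a multiplier relevant to \<open>i\<close> reaches the end of the grid,
        the cap is \<open>t\<close> and \<open>y' \<le> 1\<close> suffices. Otherwise none was
        truncated, and each rounding loses at most one unit.\<close>
      show ?thesis
      proof (cases "\<exists>j<K. i \<in> Us ! j \<and> f j \<ge> t")
        case True
        then obtain j where j: "j < K" "i \<in> Us ! j" "t \<le> f j" by blast
        have "f j = (\<Sum>j\<in>{j}. if i \<in> Us ! j then f j else 0)" using j by simp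
        also have "\<dots> \<le> s" unfolding s_def using j by (intro sum_mono2) auto
        finally have "t \<le> s" using j by simp
        then show ?thesis using \<open>real t * y' $ i \<le> real t\<close> by simp
      next
        case False
        have "real t * (\<beta> * y $ i) + real K \<le> real t * (\<beta> * y $ i) + real t * \<eta> / E"
          by (simp add: t\<eta>)
        also have "real t * \<eta> / E \<le> real t * (\<beta> * y $ i) / E"
        proof -
          have "\<eta> \<le> 1 * y $ i" using big by simp
          also have "\<dots> \<le> \<beta> * y $ i" using \<beta>(1) y0[OF i] by (intro mult_right_mono)
          finally show ?thesis using E by (intro divide_right_mono mult_left_mono) auto
        qed
        also have "real t * (\<beta> * y $ i) + real t * (\<beta> * y $ i) / E = real t * (\<kappa> * y $ i)"
          by (simp add: \<kappa> algebra_simps)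
        also have "\<dots> \<le> real t * (\<kappa> * (\<Sum>j<K. if i \<in> Us ! j then u j else 0))"
          using u(2)[OF i] \<beta>(1) \<beta>\<kappa> by (intro mult_left_mono) auto
        also have "\<dots> = (\<Sum>j<K. if i \<in> Us ! j then real t * (\<kappa> * u j) else 0)"
          by (auto simp: sum_distrib_left intro!: sum.cong)
        also have "\<dots> \<le> (\<Sum>j<K. (if i \<in> Us ! j then real (f j) else 0) + 1)"
          using False f_ge by (intro sum_mono) force
        also have "\<dots> = real s + real K"
          by (auto simp: sum.distrib s_def intro!: sum.cong)
        finally have "real t * (\<beta> * y $ i) \<le> real s" by simp
        moreover have "real t * y' $ i \<le> real t * (\<beta> * y $ i)"
          using y'\<beta>[OF i] by (intro mult_left_mono) auto
        ultimately show ?thesis by linarith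
      qed
    qed
    ultimately show ?thesis by (simp add: caps_eq)
  qed
  have "y' \<le> grid_bounds n t Us N"
    using caps \<open>0 < t\<close> vec_le_iff[OF y'n, of "grid_bounds n t Us N"]
    by (simp add: pos_le_divide_eq mult.commute)
  moreover have "x + y' \<le> ones_vec n"
  proof -
    have "(x + y') $ i \<le> 1" if "i < n" for i using y'x[OF that] xn y'n that by simp
    then show ?thesis using vec_le_iff[OF add_carrier_vec[OF xn y'n], of "ones_vec n"] by simp
  qed
  moreover have "0\<^sub>v n \<le> y'" using y'0 vec_le_iff[OF zero_carrier_vec y'n] by simp
  ultimately have sub: "(x, y') \<in> sub_feasible H g (grid_bounds n t Us N)"
    using x y'n Hy' by (simp add: sub_feasible_def H)
  \<comment> \<open>The dual part is at most \<open>\<kappa>\<close> times the old one by rounding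
    down, the second-stage part grows by at most \<open>\<beta> \<le> \<kappa>\<close>, and the
    first-stage part is unchanged and nonnegative.\<close>
  have cost: "C \<bullet> x + c \<bullet> y' + (\<Sum>j<K. \<Gamma> $ j * (real (digit t N j) / real t)) \<le> \<kappa> * (C \<bullet> x + c \<bullet> y + (\<Sum>j<K. \<Gamma> $ j * u j))"
  proof -
    have C0: "0 \<le> C $ i" "0 \<le> c $ i" if "i < n" for i
      using C c vec_le_iff[OF zero_carrier_vec C(1)] vec_le_iff[OF zero_carrier_vec c(1)] that by auto
    have "0 \<le> C \<bullet> x" using xn x0 C0 by (auto simp: scalar_prod_def intro!: sum_nonneg)
    then have 1: "C \<bullet> x \<le> \<kappa> * (C \<bullet> x)" using \<beta>(1) \<beta>\<kappa> by (simp add: mult_le_cancel_right1)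
    have "c \<bullet> y' \<le> (\<Sum>i<n. \<kappa> * (c $ i * y $ i))"
      unfolding scalar_prod_def using y'n
    proof (simp add: atLeast0LessThan, intro sum_mono)
      fix i assume "i \<in> {..<n}"
      then have i: "i < n" by simp
      have "c $ i * y' $ i \<le> c $ i * (\<kappa> * y $ i)"
        using y'\<beta>[OF i] mult_right_mono[OF \<beta>\<kappa> y0[OF i]] C0(2)[OF i] by (intro mult_left_mono) auto
      then show "c $ i * y' $ i \<le> \<kappa> * (c $ i * y $ i)" by (simp add: mult.left_commute)
    qed
    then have 2: "c \<bullet> y' \<le> \<kappa> * (c \<bullet> y)"
      using yn by (simp add: scalar_prod_def atLeast0LessThan sum_distrib_left)
    have "(\<Sum>j<K. \<Gamma> $ j * (real (digit t N j) / real t)) \<le> (\<Sum>j<K. \<kappa> * (\<Gamma> $ j * u j))"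
    proof (intro sum_mono)
      fix j assume "j \<in> {..<K}"
      then have j: "j < K" by simp
      have "real (digit t N j) / real t \<le> \<kappa> * u j"
        using f_le[OF j] N(2)[OF j] \<open>0 < t\<close> by (simp add: pos_divide_le_eq mult.commute mult.left_commute)
      then have "\<Gamma> $ j * (real (digit t N j) / real t) \<le> \<Gamma> $ j * (\<kappa> * u j)"
        using \<Gamma>_nonneg[OF j] by (rule mult_left_mono)
      then show "\<Gamma> $ j * (real (digit t N j) / real t) \<le> \<kappa> * (\<Gamma> $ j * u j)"
        by (simp add: mult.left_commute)
    qed
    then have 3: "(\<Sum>j<K. \<Gamma> $ j * (real (digit t N j) / real t)) \<le> \<kappa> * (\<Sum>j<K. \<Gamma> $ j * u j)"
      by (simp add: sum_distrib_left)
    show ?thesis using 1 2 3 by (simp add: distrib_left)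
  qed
  have "0\<^sub>v n \<le> x" using x0 vec_le_iff[OF zero_carrier_vec xn] by simp
  then have "0 \<le> worst_case_cost C U x y"
    using worst_case_cost_nonneg[OF xn _ yn y01] by simp
  have "grid_cost C c \<Gamma> t N (x, y') \<le> \<kappa> * (C \<bullet> x + c \<bullet> y + (\<Sum>j<K. \<Gamma> $ j * u j))"
    using cost by (simp add: grid_cost_def)
  also have "\<dots> \<le> \<kappa> * worst_case_cost C U x y"
    using u(3) \<beta>(1) \<beta>\<kappa> by (intro mult_left_mono) auto
  also have "\<dots> \<le> (1 + 1 / real e) * worst_case_cost C U x y"
    using \<kappa>_le \<open>0 \<le> worst_case_cost C U x y\<close> by (rule mult_right_mono)
  finally show ?thesis using N(1) sub by blast
qed

text \<open>Here \<open>v\<close> may be any lower bound on the grid costs. It is divided by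
  \<open>1 + 1 / e\<close> so that it becomes a lower bound of \<open>worst_case_cost\<close> at
  every feasible pair and passes through both infima.\<close>

lemma grid_minimum_approximates:
  fixes e :: nat
  assumes H: "dim_col H = n" and int: "integral_polyhedron n (box_polyhedron H g)"
    and e: "1 \<le> e" and t: "t = 9 * (K + 1) * (n + 1) * e\<^sup>2"
    and fs: "first_stage_set H g \<noteq> {}"
    and v: "\<And>N z. N < (t + 1) ^ K \<Longrightarrow> z \<in> sub_feasible H g (grid_bounds n t Us N) \<Longrightarrow> v \<le> grid_cost C c \<Gamma> t N z"
  shows "v \<le> (1 + 1 / real e) * MM_value H g C U"
proof -
  have e1: "0 < 1 + 1 / real e" by (simp add: add_pos_nonneg)
  have "v / (1 + 1 / real e) \<le> worst_case_cost C U x y"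
    if x: "x \<in> first_stage_set H g" and y: "y \<in> recourse_set H g x" for x y
  proof -
    have "x \<in> binary_vecs n" using first_stage_recourse(1)[OF x] H by simp
    from exists_grid_point[OF H int e t this y]
    have "v \<le> (1 + 1 / real e) * worst_case_cost C U x y" using v by fastforce
    then show ?thesis using e1 by (simp add: pos_divide_le_eq mult.commute)
  qed
  then have "v / (1 + 1 / real e) \<le> MM_value H g C U"
    unfolding MM_value_def using fs first_stage_recourse(2) by (intro cINF_greatest) auto
  then show ?thesis using e1 by (simp add: pos_divide_le_eq mult.commute)
qed

text \<open>Justifies the report of infeasibility when every subproblem of the grid is
  infeasible.\<close>

lemma sub_feasible_nonempty:
  assumes H: "dim_col H = n" and int: "integral_polyhedron n (box_polyhedron H g)"
    and t: "t = 9 * (K + 1) * (n + 1) * e\<^sup>2" and e: "1 \<le> e"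
    and fs: "first_stage_set H g \<noteq> {}"
  shows "\<exists>N<(t + 1) ^ K. sub_feasible H g (grid_bounds n t Us N) \<noteq> {}"
proof -
  obtain x y where "x \<in> first_stage_set H g" "y \<in> recourse_set H g x"
    using fs first_stage_recourse(2) by blast
  then show ?thesis
    using exists_grid_point[OF H int e t, of x y] first_stage_recourse(1)[of x H g] H by auto
qed

end

section \<open>Running times and sizes\<close>

lemma int_size_le_iff: "int_size a \<le> Suc w \<longleftrightarrow> \<bar>a\<bar> < 2 ^ w"
proof -
  have "int_size a \<le> Suc w \<longleftrightarrow> bitlen \<bar>a\<bar> \<le> int w"
    by (auto simp: int_size_def nat_le_iff)
  also have "\<dots> \<longleftrightarrow> \<bar>a\<bar> < 2 ^ w" by (simp add: bitlen_le_iff_power)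
  finally show ?thesis .
qed

lemma int_size_pos [simp]: "1 \<le> int_size a" "0 < int_size a" "int_size a \<noteq> 0" "Suc 0 \<le> int_size a"
  by (simp_all add: int_size_def)

lemma abs_less_int_size: "\<bar>a\<bar> < 2 ^ (int_size a - 1)"
  using int_size_le_iff[of a "int_size a - 1"] by simp

lemma int_size_leI:
  assumes "\<bar>a\<bar> < 2 ^ (w - 1)" "1 \<le> w"
  shows "int_size a \<le> w"
  using int_size_le_iff[of a "w - 1"] assms by simp

lemma int_size_mono: "\<bar>a\<bar> \<le> \<bar>b\<bar> \<Longrightarrow> int_size a \<le> int_size b"
  by (rule int_size_leI) (use abs_less_int_size[of b] in auto)

lemma int_size_mult: "int_size (a * b) \<le> int_size a + int_size b"
proof (rule int_size_leI)
  have "\<bar>a * b\<bar> \<le> 2 ^ (int_size a - 1) * 2 ^ (int_size b - 1)"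
    unfolding abs_mult using abs_less_int_size[of a] abs_less_int_size[of b]
    by (intro mult_mono) auto
  also have "\<dots> < 2 ^ (int_size a + int_size b - 1)"
    unfolding power_add[symmetric]
  proof (rule power_strict_increasing)
    show "int_size a - 1 + (int_size b - 1) < int_size a + int_size b - 1"
      using int_size_pos(1)[of a] int_size_pos(1)[of b] by linarith
  qed simp
  finally show "\<bar>a * b\<bar> < 2 ^ (int_size a + int_size b - 1)" .
qed (use int_size_pos(1)[of a] in linarith)

lemma int_size_add_le:
  assumes "int_size a \<le> w" "int_size b \<le> w"
  shows "int_size (a + b) \<le> w + 1"
proof (rule int_size_leI)
  have w: "1 \<le> w" using assms(1) int_size_pos(1)[of a] by linarith
  have "\<bar>a\<bar> < 2 ^ (w - 1)" "\<bar>b\<bar> < 2 ^ (w - 1)"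
    using assms int_size_le_iff[of a "w - 1"] int_size_le_iff[of b "w - 1"] w by simp_all
  then have "\<bar>a + b\<bar> < 2 * 2 ^ (w - 1)" by linarith
  also have "\<dots> = 2 ^ (w + 1 - 1)" using w by (simp flip: power_Suc)
  finally show "\<bar>a + b\<bar> < 2 ^ (w + 1 - 1)" .
qed simp

lemma int_size_add: "int_size (a + b) \<le> int_size a + int_size b"
proof -
  have "int_size (a + b) \<le> max (int_size a) (int_size b) + 1" by (rule int_size_add_le) auto
  also have "\<dots> \<le> int_size a + int_size b"
    using int_size_pos(1)[of a] int_size_pos(1)[of b] by linarith
  finally show ?thesis .
qed

lemma int_size_uminus [simp]: "int_size (- a) = int_size a"
  by (simp add: int_size_def)

lemma int_size_diff: "int_size (a - b) \<le> int_size a + int_size b"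
  using int_size_add[of a "- b"] by simp

text \<open>Rounding towards minus infinity can enlarge a negative quotient, but
  \<open>c * d \<le> c\<close> for negative \<open>c\<close> and positive \<open>d\<close> keeps it
  above \<open>c\<close>. Negative divisors are reduced to positive ones by negating both
  arguments.\<close>

lemma abs_div_le: "\<bar>a div b\<bar> \<le> \<bar>a\<bar>" for a b :: int
proof (cases "b = 0")
  case False
  then have "1 \<le> \<bar>b\<bar>" by simp
  have main: "\<bar>c div d\<bar> \<le> \<bar>c\<bar>" if d: "0 < d" for c d :: int
  proof (cases "0 \<le> c")
    case True
    then show ?thesis using d zdiv_mono2[of c 1 d] by (simp add: pos_imp_zdiv_nonneg_iff)
  next
    case False
    then have "c * d \<le> c * 1" using d by (intro mult_left_mono_neg) auto
    then have "c \<le> c div d" using d by (metis mult.right_neutral nonzero_mult_div_cancel_right order_less_irrefl zdiv_mono1)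
    moreover have "c div d < 0" using False d by (simp add: pos_imp_zdiv_neg_iff)
    ultimately show ?thesis by simp
  qed
  show ?thesis
  proof (cases "0 < b")
    case True
    then show ?thesis by (rule main)
  next
    case False
    with \<open>b \<noteq> 0\<close> main[of "- b" "- a"] show ?thesis by simp
  qed
qed simp

lemma int_size_div: "int_size (a div b) \<le> int_size a + int_size b"
  using int_size_mono[OF abs_div_le[of a b]] by simp

text \<open>Bounding the length by the value is crude but sufficient: \<open>e\<close>,
  \<open>t\<close> and the grid index are themselves polynomially bounded.\<close>

lemma int_size_le_abs: "int_size a \<le> nat \<bar>a\<bar> + 1"
proof -
  have "nat \<bar>a\<bar> < 2 ^ nat \<bar>a\<bar>" by (rule less_exp)
  then have "int (nat \<bar>a\<bar>) < int (2 ^ nat \<bar>a\<bar>)" by (simp only: of_nat_less_iff)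
  then show ?thesis using int_size_le_iff[of a "nat \<bar>a\<bar>"] by simp
qed

lemma int_size_int_le: "int_size (int m) \<le> m + 1"
  using int_size_le_abs[of "int m"] by simp

lemma list_size_simps [simp]:
  "list_size [] = 0" "list_size (a # xs) = int_size a + list_size xs"
  "list_size (xs @ ys) = list_size xs + list_size ys" "list_size (rev xs) = list_size xs"
  by (simp_all add: list_size_def rev_map[symmetric])

lemma list_size_take_drop: "list_size (take k xs) + list_size (drop k xs) = list_size xs"
  by (metis append_take_drop_id list_size_simps(3))

lemma list_size_take: "list_size (take k xs) \<le> list_size xs"
  and list_size_drop: "list_size (drop k xs) \<le> list_size xs"
  using list_size_take_drop[of k xs] by linarith+

lemma list_size_tl: "list_size (tl xs) \<le> list_size xs"
  by (cases xs) auto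

lemma length_le_list_size: "length xs \<le> list_size xs"
proof (induction xs)
  case (Cons a xs)
  then show ?case using int_size_pos(1)[of a] by (simp del: int_size_pos)
qed simp

lemma list_size_le_length:
  assumes "\<And>a. a \<in> set xs \<Longrightarrow> int_size a \<le> w"
  shows "list_size xs \<le> length xs * w"
  using assms by (induction xs) (auto intro: add_mono)

section \<open>Loop-free programs: exact semantics and linear bounds\<close>

definition bounded_state :: "nat \<Rightarrow> state \<Rightarrow> bool" where
  "bounded_state W s \<longleftrightarrow> (\<forall>r. list_size (s r) \<le> W)"

lemma bounded_state_mono: "bounded_state W s \<Longrightarrow> W \<le> W' \<Longrightarrow> bounded_state W' s"
  unfolding bounded_state_def using order_trans by blast

lemma bounded_stateD: "bounded_state W s \<Longrightarrow> list_size (s r) \<le> W"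
  by (simp add: bounded_state_def)

lemma bounded_state_upd: "bounded_state W s \<Longrightarrow> list_size xs \<le> W \<Longrightarrow> bounded_state W (s(r := xs))"
  by (simp add: bounded_state_def)

primrec loop_free :: "prog \<Rightarrow> bool" where
  "loop_free Skip = True"
| "loop_free (Push r e) = True"
| "loop_free (Pop r) = True"
| "loop_free (Copy r q) = True"
| "loop_free (Seq p q) = (loop_free p \<and> loop_free q)"
| "loop_free (Cond b p q) = (loop_free p \<and> loop_free q)"
| "loop_free (While b p) = False"

text \<open>For loop-free programs, result and running time are functions of the state, so that
  simplification can execute them. The \<open>While\<close> equations here and in
  \<open>lf_time\<close> are fillers.\<close>

fun lf_state :: "prog \<Rightarrow> state \<Rightarrow> state" where
  "lf_state Skip s = s"
| "lf_state (Push r e) s = s(r := aval e s # s r)"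
| "lf_state (Pop r) s = s(r := tl (s r))"
| "lf_state (Copy r q) s = s(r := s q)"
| "lf_state (Seq p q) s = lf_state q (lf_state p s)"
| "lf_state (Cond b p q) s = (if bval b s then lf_state p s else lf_state q s)"
| "lf_state (While b p) s = s"

primrec lf_time :: "prog \<Rightarrow> state \<Rightarrow> nat" where
  "lf_time Skip s = 1"
| "lf_time (Push r e) s = 1 + acost e s"
| "lf_time (Pop r) s = 1"
| "lf_time (Copy r q) s = 1 + list_size (s q)"
| "lf_time (Seq p q) s = lf_time p s + lf_time q (lf_state p s)"
| "lf_time (Cond b p q) s = 1 + bcost b s + (if bval b s then lf_time p s else lf_time q s)"
| "lf_time (While b p) s = 0"

lemma exec_loop_free: "loop_free p \<Longrightarrow> exec p s (lf_time p s) (lf_state p s)"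
proof (induction p arbitrary: s)
  case Skip
  then show ?case using exec.Skip by simp
next
  case (Push r e)
  then show ?case using exec.Push by (simp add: fun_upd_def)
next
  case (Pop r)
  then show ?case using exec.Pop by (simp add: fun_upd_def)
next
  case (Copy r q)
  then show ?case using exec.Copy by (simp add: fun_upd_def)
next
  case (Seq p q)
  then show ?case by (auto intro: exec.Seq)
next
  case (Cond b p q)
  then show ?case
    using exec.CondTrue[of b s p "lf_time p s" _ q] exec.CondFalse[of b s q "lf_time q s" _ p] by auto
qed simp

text \<open>Lengths at most add up under each of the four operations, so the value of an expression
  is longer than the register bound by at most this constant factor, which does not depend on the
  state.\<close>

primrec value_factor :: "aexp \<Rightarrow> nat" where
  "value_factor (Const a) = int_size a"
| "value_factor (Top r) = 1"
| "value_factor (Add e f) = value_factor e + value_factor f"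
| "value_factor (Sub e f) = value_factor e + value_factor f"
| "value_factor (Mul e f) = value_factor e + value_factor f"
| "value_factor (Div e f) = value_factor e + value_factor f"

primrec acost_factor :: "aexp \<Rightarrow> nat" where
  "acost_factor (Const a) = int_size a"
| "acost_factor (Top r) = 1"
| "acost_factor (Add e f) = acost_factor e + acost_factor f + value_factor (Add e f)"
| "acost_factor (Sub e f) = acost_factor e + acost_factor f + value_factor (Sub e f)"
| "acost_factor (Mul e f) = acost_factor e + acost_factor f + value_factor (Mul e f)"
| "acost_factor (Div e f) = acost_factor e + acost_factor f + value_factor (Div e f)"

primrec bcost_factor :: "bexp \<Rightarrow> nat" where
  "bcost_factor (Nonempty r) = 1"
| "bcost_factor (Less e f) = acost_factor e + acost_factor f"

lemma int_size_top:
  assumes "bounded_state W s" "1 \<le> W"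
  shows "int_size (aval (Top r) s) \<le> W"
  using bounded_stateD[OF assms(1), of r] assms(2) by (auto simp: int_size_def split: list.split)

lemma int_size_aval:
  assumes "bounded_state W s" "1 \<le> W"
  shows "int_size (aval e s) \<le> value_factor e * W"
proof (induction e)
  case (Const a)
  have "int_size a * 1 \<le> int_size a * W" using assms(2) by (intro mult_left_mono) auto
  then show ?case by simp
next
  case (Top r)
  then show ?case using int_size_top[OF assms] by simp
next
  case (Add e f)
  then show ?case using int_size_add[of "aval e s" "aval f s"] by (simp add: distrib_right)
next
  case (Sub e f)
  then show ?case using int_size_diff[of "aval e s" "aval f s"] by (simp add: distrib_right)
next
  case (Mul e f)
  then show ?case using int_size_mult[of "aval e s" "aval f s"] by (simp add: distrib_right)
next
  case (Div e f)
  then show ?case using int_size_div[of "aval e s" "aval f s"] by (simp add: distrib_right)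
qed

lemma acost_le:
  assumes "bounded_state W s" "1 \<le> W"
  shows "acost e s \<le> acost_factor e * W"
proof (induction e)
  case (Const a)
  then show ?case using int_size_aval[OF assms, of "Const a"] by simp
next
  case (Top r)
  then show ?case using int_size_top[OF assms] by (simp del: aval.simps)
next
  case (Add e f)
  then show ?case using int_size_aval[OF assms, of "Add e f"] by (simp add: distrib_right)
next
  case (Sub e f)
  then show ?case using int_size_aval[OF assms, of "Sub e f"] by (simp add: distrib_right)
next
  case (Mul e f)
  then show ?case using int_size_aval[OF assms, of "Mul e f"] by (simp add: distrib_right)
next
  case (Div e f)
  then show ?case using int_size_aval[OF assms, of "Div e f"] by (simp add: distrib_right)
qed

lemma bcost_le:
  assumes "bounded_state W s" "1 \<le> W"
  shows "bcost b s \<le> bcost_factor b * W"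
  using acost_le[OF assms] assms(2) by (cases b) (auto simp: distrib_right intro: add_mono)

text \<open>A loop-free program multiplies sizes by at most a constant factor, so its running time is
  linear in the size of the state.\<close>

primrec growth_factor :: "prog \<Rightarrow> nat" where
  "growth_factor Skip = 1"
| "growth_factor (Push r e) = 1 + value_factor e"
| "growth_factor (Pop r) = 1"
| "growth_factor (Copy r q) = 1"
| "growth_factor (Seq p q) = growth_factor p * growth_factor q"
| "growth_factor (Cond b p q) = growth_factor p + growth_factor q"
| "growth_factor (While b p) = 1"

primrec time_factor :: "prog \<Rightarrow> nat" where
  "time_factor Skip = 1"
| "time_factor (Push r e) = 1 + acost_factor e"
| "time_factor (Pop r) = 1"
| "time_factor (Copy r q) = 2"
| "time_factor (Seq p q) = time_factor p + growth_factor p * time_factor q"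
| "time_factor (Cond b p q) = 1 + bcost_factor b + time_factor p + time_factor q"
| "time_factor (While b p) = 0"

lemma growth_factor_pos: "1 \<le> growth_factor p"
proof (induction p)
  case (Seq p q)
  then show ?case using mult_le_mono[of 1 "growth_factor p" 1 "growth_factor q"] by simp
qed auto

lemma loop_free_bounds:
  assumes "loop_free p" "bounded_state W s" "1 \<le> W"
  shows "lf_time p s \<le> time_factor p * W \<and> bounded_state (growth_factor p * W) (lf_state p s)"
  using assms
proof (induction p arbitrary: s W)
  case (Push r e)
  have "list_size (aval e s # s r) \<le> value_factor e * W + W"
    using int_size_aval[OF Push(2,3), of e] bounded_stateD[OF Push(2), of r] by simp
  moreover have "list_size (s x) \<le> W + value_factor e * W" for x
    using bounded_stateD[OF Push(2), of x] by simp
  ultimately have "bounded_state (growth_factor (Push r e) * W) (lf_state (Push r e) s)"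
    by (simp add: bounded_state_def)
  then show ?case using acost_le[OF Push(2,3), of e] Push(3) by (simp del: lf_state.simps growth_factor.simps)
next
  case (Pop r)
  then show ?case
    using order_trans[OF list_size_tl bounded_stateD[OF Pop(2), of r]] by (simp add: bounded_state_def)
next
  case (Copy r q)
  have "1 + list_size (s q) \<le> 2 * W" using bounded_stateD[OF Copy(2), of q] Copy(3) by linarith
  then show ?case using Copy(2) by (simp add: bounded_state_def)
next
  case (Seq p q)
  have p: "lf_time p s \<le> time_factor p * W" "bounded_state (growth_factor p * W) (lf_state p s)"
    using Seq by auto
  have W1: "1 \<le> growth_factor p * W" using growth_factor_pos[of p] Seq.prems(3) mult_le_mono[of 1 _ 1] by simp
  have "lf_time q (lf_state p s) \<le> time_factor q * (growth_factor p * W) \<and>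
    bounded_state (growth_factor q * (growth_factor p * W)) (lf_state q (lf_state p s))"
    using Seq.IH(2)[OF _ p(2) W1] Seq.prems(1) by simp
  then show ?case using p by (simp add: distrib_right mult.assoc mult.left_commute)
next
  case (Cond b p q)
  have "bcost b s \<le> bcost_factor b * W" using bcost_le Cond.prems by blast
  moreover have "lf_time p s \<le> time_factor p * W" "bounded_state (growth_factor p * W) (lf_state p s)"
    "lf_time q s \<le> time_factor q * W" "bounded_state (growth_factor q * W) (lf_state q s)"
    using Cond by auto
  ultimately show ?case using Cond.prems(3)
    by (auto simp: distrib_right elim!: bounded_state_mono)
qed auto

section \<open>Time-bounded execution and loops\<close>

definition runs :: "prog \<Rightarrow> state \<Rightarrow> nat \<Rightarrow> state \<Rightarrow> bool" where
  "runs p s T s' \<longleftrightarrow> (\<exists>\<tau>\<le>T. exec p s \<tau> s')"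

lemma runs_mono: "runs p s T s' \<Longrightarrow> T \<le> T' \<Longrightarrow> runs p s T' s'"
  unfolding runs_def using order_trans by blast

lemma runs_Seq: "runs p s T s' \<Longrightarrow> runs q s' T' s'' \<Longrightarrow> runs (Seq p q) s (T + T') s''"
  unfolding runs_def by (meson add_mono exec.Seq)

lemma runs_loop_free:
  assumes "loop_free p" "bounded_state W s" "1 \<le> W"
  shows "runs p s (time_factor p * W) (lf_state p s)"
  unfolding runs_def using loop_free_bounds[OF assms] exec_loop_free[OF assms(1)] by blast

lemma runs_Cond:
  assumes "bounded_state W s" "1 \<le> W"
    and "bval b s \<Longrightarrow> runs p s T s'" "\<not> bval b s \<Longrightarrow> runs q s T s'"
  shows "runs (Cond b p q) s (1 + bcost_factor b * W + T) s'"
proof -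
  have b: "bcost b s \<le> bcost_factor b * W" using bcost_le[OF assms(1,2)] .
  show ?thesis
  proof (cases "bval b s")
    case True
    then obtain \<tau> where "\<tau> \<le> T" "exec p s \<tau> s'" using assms(3) by (auto simp: runs_def)
    then show ?thesis unfolding runs_def using exec.CondTrue[OF True] b by (meson add_mono order_refl)
  next
    case False
    then obtain \<tau> where "\<tau> \<le> T" "exec q s \<tau> s'" using assms(4) by (auto simp: runs_def)
    then show ?thesis unfolding runs_def using exec.CondFalse[OF False] b by (meson add_mono order_refl)
  qed
qed

text \<open>The extra round pays for the final failing test.\<close>

definition loop_time :: "bexp \<Rightarrow> nat \<Rightarrow> nat \<Rightarrow> nat \<Rightarrow> nat" where
  "loop_time b W T k = (k + 1) * (1 + bcost_factor b * W + T)"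

text \<open>The invariant is indexed by the number of remaining rounds. It must bound all states by
  the same \<open>W\<close>: growth factors of the body, applied once per round, would yield an
  exponential bound.\<close>

lemma runs_While:
  assumes W: "1 \<le> W" and bd: "\<And>k s. k \<le> m \<Longrightarrow> I k s \<Longrightarrow> bounded_state W s"
    and step: "\<And>k s. k < m \<Longrightarrow> I (Suc k) s \<Longrightarrow> bval b s \<and> (\<exists>s'. runs p s T s' \<and> I k s')"
    and stop: "\<And>s. I 0 s \<Longrightarrow> \<not> bval b s"
    and "I m s"
  shows "\<exists>s'. runs (While b p) s (loop_time b W T m) s' \<and> I 0 s'"
proof -
  have "k \<le> m \<Longrightarrow> I k s \<Longrightarrow> \<exists>s'. runs (While b p) s (loop_time b W T k) s' \<and> I 0 s'" for k
  proof (induction k arbitrary: s)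
    case 0
    then have "bcost b s \<le> bcost_factor b * W" using bcost_le[OF bd W] by blast
    then have "runs (While b p) s (loop_time b W T 0) s"
      unfolding runs_def using exec.WhileFalse[OF stop[OF 0(2)]]
      by (intro exI[of _ "1 + bcost b s"]) (auto simp: loop_time_def)
    with 0 show ?case by blast
  next
    case (Suc k)
    have b: "bcost b s \<le> bcost_factor b * W" using bcost_le[OF bd W] Suc.prems by blast
    obtain s1 where s1: "bval b s" "runs p s T s1" "I k s1" using step[of k s] Suc.prems by auto
    obtain s' where s': "runs (While b p) s1 (loop_time b W T k) s'" "I 0 s'"
      using Suc.IH[of s1] Suc.prems s1(3) by auto
    obtain \<tau>1 \<tau>2 where \<tau>: "\<tau>1 \<le> T" "exec p s \<tau>1 s1" "\<tau>2 \<le> loop_time b W T k" "exec (While b p) s1 \<tau>2 s'"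
      using s1(2) s'(1) by (auto simp: runs_def)
    have "exec (While b p) s (1 + bcost b s + \<tau>1 + \<tau>2) s'" by (rule exec.WhileTrue[OF s1(1) \<tau>(2,4)])
    moreover have "1 + bcost b s + \<tau>1 + \<tau>2 \<le> loop_time b W T (Suc k)"
      using b \<tau> by (simp add: loop_time_def)
    ultimately show ?case using s'(2) unfolding runs_def by blast
  qed
  then show ?thesis using assms by blast
qed

lemma runs_While_loop_free:
  assumes "loop_free p" and W: "1 \<le> W" and bd: "\<And>k s. k \<le> m \<Longrightarrow> I k s \<Longrightarrow> bounded_state W s"
    and step: "\<And>k s. k < m \<Longrightarrow> I (Suc k) s \<Longrightarrow> bval b s \<and> I k (lf_state p s)"
    and stop: "\<And>s. I 0 s \<Longrightarrow> \<not> bval b s"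
    and "I m s"
  shows "\<exists>s'. runs (While b p) s (loop_time b W (time_factor p * W) m) s' \<and> I 0 s'"
proof (rule runs_While[of W m I b p])
  show "bval b s \<and> (\<exists>s'. runs p s (time_factor p * W) s' \<and> I k s')" if "k < m" "I (Suc k) s" for k s
    using step[OF that] runs_loop_free[OF assms(1) bd[OF _ that(2)] W] that by auto
qed (use assms in auto)

section \<open>Calling a program as a subroutine\<close>

fun aexp_regs :: "aexp \<Rightarrow> nat set" where
  "aexp_regs (Const a) = {}"
| "aexp_regs (Top r) = {r}"
| "aexp_regs (Add e f) = aexp_regs e \<union> aexp_regs f"
| "aexp_regs (Sub e f) = aexp_regs e \<union> aexp_regs f"
| "aexp_regs (Mul e f) = aexp_regs e \<union> aexp_regs f"
| "aexp_regs (Div e f) = aexp_regs e \<union> aexp_regs f"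

fun bexp_regs :: "bexp \<Rightarrow> nat set" where
  "bexp_regs (Nonempty r) = {r}"
| "bexp_regs (Less e f) = aexp_regs e \<union> aexp_regs f"

fun prog_regs :: "prog \<Rightarrow> nat set" where
  "prog_regs Skip = {}"
| "prog_regs (Push r e) = insert r (aexp_regs e)"
| "prog_regs (Pop r) = {r}"
| "prog_regs (Copy r q) = {r, q}"
| "prog_regs (Seq p q) = prog_regs p \<union> prog_regs q"
| "prog_regs (Cond b p q) = bexp_regs b \<union> prog_regs p \<union> prog_regs q"
| "prog_regs (While b p) = bexp_regs b \<union> prog_regs p"

lemma finite_prog_regs: "finite (prog_regs p)"
proof -
  have e: "finite (aexp_regs e)" for e by (induction e) auto
  then have "finite (bexp_regs b)" for b by (cases b) auto
  with e show ?thesis by (induction p) auto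
qed

lemma aval_cong:
  assumes "\<And>r. r \<in> aexp_regs e \<Longrightarrow> s r = z r"
  shows "aval e s = aval e z" "acost e s = acost e z"
proof -
  have "aval e s = aval e z \<and> acost e s = acost e z" using assms by (induction e) auto
  then show "aval e s = aval e z" "acost e s = acost e z" by auto
qed

lemma bval_cong:
  assumes "\<And>r. r \<in> bexp_regs b \<Longrightarrow> s r = z r"
  shows "bval b s = bval b z" "bcost b s = bcost b z"
  using assms by (cases b; simp; metis UnCI aval_cong)+

text \<open>Expressions and tests read only registers below \<open>B\<close> and no instruction
  writes outside that range, so the same execution can be replayed inside a larger state at the same
  cost.\<close>

lemma exec_frame:
  assumes "exec p s \<tau> s'" "prog_regs p \<subseteq> {..<B}" "\<And>r. r < B \<Longrightarrow> z r = s r"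
  shows "exec p z \<tau> (\<lambda>r. if r < B then s' r else z r)"
  using assms
proof (induction arbitrary: z rule: exec.induct)
  case (Skip s)
  then have "(\<lambda>r. if r < B then s r else z r) = z" by auto
  then show ?case using exec.Skip by simp
next
  case (Push r e s)
  then have "aval e s = aval e z" "acost e s = acost e z" by (auto intro!: aval_cong)
  moreover have "(\<lambda>x. if x < B then (s(r := aval e s # s r)) x else z x) = z(r := aval e s # z r)"
    using Push by auto
  ultimately show ?case using exec.Push[of r e z] by simp
next
  case (Pop r s)
  then have "(\<lambda>x. if x < B then (s(r := tl (s r))) x else z x) = z(r := tl (z r))" by auto
  then show ?case using exec.Pop[of r z] by simp
next
  case (Copy r q s)
  then have "(\<lambda>x. if x < B then (s(r := s q)) x else z x) = z(r := z q)" "z q = s q" by auto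
  then show ?case using exec.Copy[of r q z] by simp
next
  case (Seq p s \<tau>1 s' q \<tau>2 s'')
  let ?z = "\<lambda>r. if r < B then s' r else z r"
  have 1: "exec p z \<tau>1 ?z" using Seq by auto
  have 2: "exec q ?z \<tau>2 (\<lambda>r. if r < B then s'' r else ?z r)" using Seq by (intro Seq.IH(2)) auto
  have 3: "(\<lambda>r. if r < B then s'' r else ?z r) = (\<lambda>r. if r < B then s'' r else z r)" by auto
  show ?case using exec.Seq[OF 1 2] unfolding 3 .
next
  case (CondTrue b s p \<tau> s' q)
  then have "\<And>r. r \<in> bexp_regs b \<Longrightarrow> s r = z r" by auto
  note b = bval_cong[OF this]
  have "exec p z \<tau> (\<lambda>r. if r < B then s' r else z r)" using CondTrue by auto
  then show ?case using CondTrue.hyps(1) b exec.CondTrue[of b z p] by simp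
next
  case (CondFalse b s q \<tau> s' p)
  then have "\<And>r. r \<in> bexp_regs b \<Longrightarrow> s r = z r" by auto
  note b = bval_cong[OF this]
  have "exec q z \<tau> (\<lambda>r. if r < B then s' r else z r)" using CondFalse by auto
  then show ?case using CondFalse.hyps(1) b exec.CondFalse[of b z q] by simp
next
  case (WhileFalse b s p)
  then have "\<And>r. r \<in> bexp_regs b \<Longrightarrow> s r = z r" by auto
  note b = bval_cong[OF this]
  have "(\<lambda>r. if r < B then s r else z r) = z" using WhileFalse by auto
  then show ?case using WhileFalse.hyps(1) exec.WhileFalse[of b z p] b by simp
next
  case (WhileTrue b s p \<tau>1 s' \<tau>2 s'')
  let ?z = "\<lambda>r. if r < B then s' r else z r"
  have "\<And>r. r \<in> bexp_regs b \<Longrightarrow> s r = z r" using WhileTrue.prems by auto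
  note b = bval_cong[OF this]
  have 1: "exec p z \<tau>1 ?z" using WhileTrue by auto
  have 2: "exec (While b p) ?z \<tau>2 (\<lambda>r. if r < B then s'' r else ?z r)"
    using WhileTrue by (intro WhileTrue.IH(2)) auto
  have 3: "(\<lambda>r. if r < B then s'' r else ?z r) = (\<lambda>r. if r < B then s'' r else z r)" by auto
  show ?case using exec.WhileTrue[OF _ 1 2] WhileTrue.hyps(1) b unfolding 3 by simp
qed

lemma int_size_aval_le_acost: "int_size (aval e s) \<le> acost e s"
  by (cases e) auto

text \<open>The logarithmic cost charges every pushed value and every copied stack in full, so sizes
  grow by at most the elapsed time. This bounds the answer of a program about which nothing but its
  running time is known.\<close>

lemma exec_size:
  assumes "exec p s \<tau> s'" "bounded_state W s"
  shows "bounded_state (W + \<tau>) s'"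
  using assms
proof (induction arbitrary: W rule: exec.induct)
  case (Push r e s)
  have "list_size (s x) \<le> W + (1 + acost e s)" for x using bounded_stateD[OF Push, of x] by simp
  moreover have "list_size (aval e s # s r) \<le> W + (1 + acost e s)"
    using int_size_aval_le_acost[of e s] bounded_stateD[OF Push, of r] by simp
  ultimately show ?case by (simp add: bounded_state_def)
next
  case (Pop r s)
  have "list_size (s x) \<le> W + 1" for x using bounded_stateD[OF Pop, of x] by simp
  moreover have "list_size (tl (s r)) \<le> W + 1"
    using order_trans[OF list_size_tl bounded_stateD[OF Pop, of r]] by simp
  ultimately show ?case by (simp add: bounded_state_def)
next
  case (Copy r q s)
  have "list_size (s x) \<le> W + (1 + list_size (s q))" for x using bounded_stateD[OF Copy, of x] by simp
  then show ?case by (simp add: bounded_state_def)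
next
  case (Seq p s \<tau>1 s' q \<tau>2 s'')
  then show ?case by (metis add.assoc)
next
  case (WhileTrue b s p \<tau>1 s' \<tau>2 s'')
  have "bounded_state (W + \<tau>1 + \<tau>2) s''" using WhileTrue by blast
  then show ?case by (rule bounded_state_mono) simp
next
  case (CondTrue b s p \<tau> s' q)
  show ?case using CondTrue.IH[OF CondTrue.prems] by (rule bounded_state_mono) simp
next
  case (CondFalse b s q \<tau> s' p)
  show ?case using CondFalse.IH[OF CondFalse.prems] by (rule bounded_state_mono) simp
qed (auto elim!: bounded_state_mono)

text \<open>The registers of \<open>p\<close> must look like a fresh machine: input in register 0
  and everything else below \<open>B\<close> empty. The caller's data survive above
  \<open>B\<close>.\<close>

lemma outputs_within_call:
  assumes "outputs_within p inp T out" "prog_regs p \<subseteq> {..<B}" "0 < B"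
    and s: "s 0 = inp" "\<And>r. 0 < r \<Longrightarrow> r < B \<Longrightarrow> s r = []"
  obtains s' where "runs p s T s'" "s' 0 = out" "\<And>r. B \<le> r \<Longrightarrow> s' r = s r"
    "\<And>r. r < B \<Longrightarrow> list_size (s' r) \<le> list_size inp + T"
proof -
  obtain \<tau> z where z: "exec p ((\<lambda>_. [])(0 := inp)) \<tau> z" "\<tau> \<le> T" "z 0 = out"
    using assms(1) by (auto simp: outputs_within_def)
  have "bounded_state (list_size inp) ((\<lambda>_. [])(0 := inp))" by (simp add: bounded_state_def)
  from exec_size[OF z(1) this] have sz: "list_size (z r) \<le> list_size inp + T" for r
    using z(2) by (meson add_left_mono bounded_stateD order_trans)
  have "exec p s \<tau> (\<lambda>r. if r < B then z r else s r)"
    by (rule exec_frame[OF z(1) assms(2)]) (use s in \<open>auto\<close>)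
  then have "runs p s T (\<lambda>r. if r < B then z r else s r)" using z(2) by (auto simp: runs_def)
  then show ?thesis by (rule that) (use z sz assms(3) in auto)
qed

section \<open>Polynomially bounded functions\<close>

definition poly_fun :: "(nat \<Rightarrow> nat) \<Rightarrow> bool" where
  "poly_fun f \<longleftrightarrow> (\<exists>q :: nat poly. f = poly q)"

lemma poly_fun_intros:
  "poly_fun (\<lambda>x. x)" "poly_fun (\<lambda>x. c)"
  "poly_fun f \<Longrightarrow> poly_fun g \<Longrightarrow> poly_fun (\<lambda>x. f x + g x)"
  "poly_fun f \<Longrightarrow> poly_fun g \<Longrightarrow> poly_fun (\<lambda>x. f x * g x)"
  "poly_fun f \<Longrightarrow> poly_fun (\<lambda>x. f x ^ k)"
  "poly_fun f \<Longrightarrow> poly_fun (\<lambda>x. poly q (f x))"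
proof -
  show "poly_fun (\<lambda>x. x)" unfolding poly_fun_def by (rule exI[of _ "[:0, 1:]"]) auto
  show "poly_fun (\<lambda>x. c)" unfolding poly_fun_def by (rule exI[of _ "[:c:]"]) auto
  show "poly_fun (\<lambda>x. f x + g x)" if fg: "poly_fun f" "poly_fun g"
  proof -
    obtain p q where "f = poly p" "g = poly q" using fg by (auto simp: poly_fun_def)
    then have "(\<lambda>x. f x + g x) = poly (p + q)" by auto
    then show ?thesis unfolding poly_fun_def by (rule exI)
  qed
  show "poly_fun (\<lambda>x. f x * g x)" if fg: "poly_fun f" "poly_fun g"
  proof -
    obtain p q where "f = poly p" "g = poly q" using fg by (auto simp: poly_fun_def)
    then have "(\<lambda>x. f x * g x) = poly (p * q)" by auto
    then show ?thesis unfolding poly_fun_def by (rule exI)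
  qed
  show "poly_fun (\<lambda>x. f x ^ k)" if f: "poly_fun f"
  proof -
    obtain p where "f = poly p" using f by (auto simp: poly_fun_def)
    then have "(\<lambda>x. f x ^ k) = poly (p ^ k)" by auto
    then show ?thesis unfolding poly_fun_def by (rule exI)
  qed
  show "poly_fun (\<lambda>x. poly q (f x))" if f: "poly_fun f"
  proof -
    obtain p where "f = poly p" using f by (auto simp: poly_fun_def)
    then have "(\<lambda>x. poly q (f x)) = poly (pcompose q p)" by (auto simp: poly_pcompose)
    then show ?thesis unfolding poly_fun_def by (rule exI)
  qed
qed

text \<open>Natural coefficients are nonnegative. This allows an instance size inside a running time
  to be replaced by an upper bound.\<close>

lemma poly_nat_mono: "x \<le> y \<Longrightarrow> poly (q :: nat poly) x \<le> poly q y"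
  by (induction q) (auto intro: add_mono mult_mono)

section \<open>The search over the grid\<close>

lemma loop_time_mono: "m \<le> m' \<Longrightarrow> T \<le> T' \<Longrightarrow> loop_time b W T m \<le> loop_time b W T' m'"
  unfolding loop_time_def by (intro mult_mono add_mono) auto

text \<open>Register names are static, but \<open>B\<close> and \<open>K\<close> are constants of
  the program; work on a whole family of registers is therefore unrolled instead of looped.\<close>

primrec seqn :: "(nat \<Rightarrow> prog) \<Rightarrow> nat \<Rightarrow> prog" where
  "seqn f 0 = Skip"
| "seqn f (Suc k) = Seq (seqn f k) (f k)"

lemma loop_free_seqn: "(\<And>j. j < k \<Longrightarrow> loop_free (f j)) \<Longrightarrow> loop_free (seqn f k)"
  by (induction k) auto

lemma copy_family:
  assumes "\<And>i j. i < k \<Longrightarrow> j < k \<Longrightarrow> i \<noteq> j \<Longrightarrow> a i \<noteq> a j" "\<And>i j. i < k \<Longrightarrow> j < k \<Longrightarrow> a i \<noteq> c j"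
  shows "(\<forall>j<k. lf_state (seqn (\<lambda>j. Copy (a j) (c j)) k) s (a j) = s (c j)) \<and>
    (\<forall>r. r \<notin> a ` {..<k} \<longrightarrow> lf_state (seqn (\<lambda>j. Copy (a j) (c j)) k) s r = s r)"
  using assms
proof (induction k)
  case (Suc k)
  then have IH: "\<And>j. j < k \<Longrightarrow> lf_state (seqn (\<lambda>j. Copy (a j) (c j)) k) s (a j) = s (c j)"
    "\<And>r. r \<notin> a ` {..<k} \<Longrightarrow> lf_state (seqn (\<lambda>j. Copy (a j) (c j)) k) s r = s r"
    by auto
  have "a i \<noteq> c k" if "i < k" for i using Suc.prems(2)[of i k] that by simp
  then have "c k \<notin> a ` {..<k}" by force
  moreover have "a j \<noteq> a k" if "j < k" for j using Suc.prems(1)[of j k] that by auto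
  ultimately show ?case using IH by (auto simp: less_Suc_eq lessThan_Suc)
qed simp

lemma pop_family:
  assumes "\<And>i j. i < k \<Longrightarrow> j < k \<Longrightarrow> i \<noteq> j \<Longrightarrow> a i \<noteq> a j"
  shows "(\<forall>j<k. lf_state (seqn (\<lambda>j. Pop (a j)) k) s (a j) = tl (s (a j))) \<and>
    (\<forall>r. r \<notin> a ` {..<k} \<longrightarrow> lf_state (seqn (\<lambda>j. Pop (a j)) k) s r = s r)"
  using assms
proof (induction k)
  case (Suc k)
  then have IH: "\<And>j. j < k \<Longrightarrow> lf_state (seqn (\<lambda>j. Pop (a j)) k) s (a j) = tl (s (a j))"
    "\<And>r. r \<notin> a ` {..<k} \<Longrightarrow> lf_state (seqn (\<lambda>j. Pop (a j)) k) s r = s r"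
    by auto
  have "a k \<notin> a ` {..<k}" using Suc.prems by fastforce
  moreover have "a j \<noteq> a k" if "j < k" for j using Suc.prems(1)[of j k] that by auto
  ultimately show ?case using IH by (auto simp: less_Suc_eq lessThan_Suc)
qed simp

definition flat :: "(int \<times> int) list \<Rightarrow> int list" where
  "flat ps = concat (map (\<lambda>(n, d). [n, d]) ps)"

text \<open>Moving a stack of fractions reverses it, which puts each denominator before its
  numerator.\<close>

definition flat_swap :: "(int \<times> int) list \<Rightarrow> int list" where
  "flat_swap ps = concat (map (\<lambda>(n, d). [d, n]) ps)"

lemma flat_simps [simp]:
  "flat [] = []" "flat ((n, d) # ps) = n # d # flat ps" "flat (ps @ qs) = flat ps @ flat qs"
  "flat_swap [] = []" "flat_swap ((n, d) # ps) = d # n # flat_swap ps"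
  "flat_swap (ps @ qs) = flat_swap ps @ flat_swap qs"
  by (simp_all add: flat_def flat_swap_def)

lemma rev_flat: "rev (flat ps) = flat_swap (rev ps)"
  by (induction ps) auto

lemma length_flat [simp]: "length (flat ps) = 2 * length ps" "length (flat_swap ps) = 2 * length ps"
  by (induction ps) auto

fun dot_value :: "(int \<times> int) list \<Rightarrow> (int \<times> int) list \<Rightarrow> real" where
  "dot_value ((n, d) # ps) ((n', d') # qs) = (of_int n / of_int d) * (of_int n' / of_int d') + dot_value ps qs"
| "dot_value _ _ = 0"

lemma dot_value_append:
  "length ps = length qs \<Longrightarrow> dot_value (ps @ ps') (qs @ qs') = dot_value ps qs + dot_value ps' qs'"
  by (induction ps qs rule: dot_value.induct) auto

lemma dot_value_rev: "length ps = length qs \<Longrightarrow> dot_value (rev ps) (rev qs) = dot_value ps qs"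
  by (induction ps qs rule: dot_value.induct) (auto simp: dot_value_append)

primrec pow_aexp :: "aexp \<Rightarrow> nat \<Rightarrow> aexp" where
  "pow_aexp e 0 = Const 1"
| "pow_aexp e (Suc k) = Mul (pow_aexp e k) e"

lemma aval_pow_aexp [simp]: "aval (pow_aexp e k) s = aval e s ^ k"
  by (induction k) auto

text \<open>The registers below \<open>B\<close> belong to the program \<open>p\<close> for the subproblem.\<close>

locale grid_program =
  fixes B K :: nat and p :: prog
  assumes B: "0 < B" and p_regs: "prog_regs p \<subseteq> {..<B}"
begin

text \<open>Roles: \<open>rX\<close> is scratch, \<open>rI\<close> a loop counter, \<open>rM\<close>
  and \<open>rN\<close> the dimensions, \<open>rT\<close> the fineness and \<open>rCnt\<close> the
  grid index. \<open>rPre\<close> holds the reversed common prefix of all subproblem inputs,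
  \<open>rA\<close> the reversed coefficients \<open>C\<close>, \<open>c\<close>,
  \<open>\<Gamma>\<close>. \<open>rSol\<close> is the current answer; \<open>rBest\<close>,
  \<open>rBestNum\<close> and \<open>rBestDen\<close> are the best answer and its value.
  \<open>rV j\<close> keeps the reversed membership row of \<open>U_j\<close> and
  \<open>rW j\<close> is a copy of it to be consumed. \<open>rEmpty\<close> stays empty, so that
  copying it clears a register.\<close>

abbreviation "rX \<equiv> B + 24"
abbreviation "rI \<equiv> B + 3"
abbreviation "rM \<equiv> B + 4"
abbreviation "rN \<equiv> B + 5"
abbreviation "rT \<equiv> B + 6"
abbreviation "rPre \<equiv> B + 7"
abbreviation "rA \<equiv> B + 8"
abbreviation "rCnt \<equiv> B + 9"
abbreviation "rSol \<equiv> B + 10"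
abbreviation "rBest \<equiv> B + 11"
abbreviation "rBestNum \<equiv> B + 12"
abbreviation "rBestDen \<equiv> B + 13"
abbreviation "rL \<equiv> B + 14"
abbreviation "rR \<equiv> B + 15"
abbreviation "rNum \<equiv> B + 16"
abbreviation "rDen \<equiv> B + 17"
abbreviation "rX1 \<equiv> B + 18"
abbreviation "rX2 \<equiv> B + 19"
abbreviation "rX3 \<equiv> B + 20"
abbreviation "rX4 \<equiv> B + 21"
abbreviation "rTmp \<equiv> B + 22"
abbreviation "rEmpty \<equiv> B + 23"
abbreviation "rW j \<equiv> B + (25 + j)"
abbreviation "rV j \<equiv> B + (25 + (K + j))"

lemma not_in_families [simp]:
  "r < B + 25 \<Longrightarrow> r \<notin> rW ` A" "r < B + 25 \<Longrightarrow> r \<notin> rV ` A"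
  "rV j \<notin> rW ` {..<K}" "rV j \<notin> rV ` {..<j}" "j < K \<Longrightarrow> rW j \<notin> rV ` A"
  by auto

text \<open>No instruction overwrites a register by a value, so the value passes through the empty
  register \<open>rX\<close>; copying that singleton stack discards the old contents.\<close>

definition assign :: "nat \<Rightarrow> aexp \<Rightarrow> prog" where
  "assign r e = Seq (Push rX e) (Seq (Copy r rX) (Pop rX))"

lemma loop_free_assign [simp]: "loop_free (assign r e)"
  by (simp add: assign_def)

lemma assign_state:
  assumes "s rX = []" "r \<noteq> rX"
  shows "lf_state (assign r e) s = s(r := [aval e s])"
  using assms by (auto simp: assign_def fun_eq_iff)

section \<open>Moving data between stacks\<close>

definition move_n_body :: "nat \<Rightarrow> nat \<Rightarrow> prog" where
  "move_n_body a b = Seq (Push b (Top a)) (Seq (Pop a) (assign rI (Sub (Top rI) (Const 1))))"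

definition move_n :: "nat \<Rightarrow> nat \<Rightarrow> prog" where
  "move_n a b = While (Less (Const 0) (Top rI))
     (move_n_body a b)"

definition move_all :: "nat \<Rightarrow> nat \<Rightarrow> prog" where
  "move_all a b = While (Nonempty a) (Seq (Push b (Top a)) (Pop a))"

text \<open>The target stack may double to \<open>2 * W\<close>, and at most \<open>W\<close> items
  are moved. The time factor of the body is the same for all registers, so 0 stands in for
  both.\<close>

definition move_n_time :: "nat \<Rightarrow> nat" where
  "move_n_time W = loop_time (Less (Const 0) (Top rI)) (2 * W) (time_factor (move_n_body 0 0) * (2 * W)) W"

definition move_all_time :: "nat \<Rightarrow> nat \<Rightarrow> nat \<Rightarrow> nat" where
  "move_all_time a b W = loop_time (Nonempty a) (2 * W)
     (time_factor (Seq (Push b (Top a)) (Pop a)) * (2 * W)) W"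

lemma move_n_time_eq:
  "move_n_time W = loop_time (Less (Const 0) (Top rI)) (2 * W) (time_factor (move_n_body a b) * (2 * W)) W"
  by (simp add: move_n_time_def move_n_body_def)

lemma runs_move_n:
  assumes s: "s rI = [int k]" "s rX = []" "k \<le> length (s a)"
    and ab: "a \<noteq> b" "a \<noteq> rI" "b \<noteq> rI" "a \<noteq> rX" "b \<noteq> rX"
    and W: "bounded_state W s" "1 \<le> W"
  shows "runs (move_n a b) s (move_n_time W) (s(rI := [0], a := drop k (s a), b := rev (take k (s a)) @ s b))"
proof -
  define Inv where "Inv j s' \<longleftrightarrow> (\<exists>ys. s a = ys @ s' a \<and> s' b = rev ys @ s b \<and> length ys + j = k \<and>
    s' rI = [int j] \<and> (\<forall>r. r \<notin> {rI, a, b} \<longrightarrow> s' r = s r))" for j and s' :: state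
  have k: "k \<le> W"
    using s(3) length_le_list_size[of "s a"] bounded_stateD[OF W(1), of a] by linarith
  have "\<exists>s'. runs (While (Less (Const 0) (Top rI)) (move_n_body a b))
      s (loop_time (Less (Const 0) (Top rI)) (2 * W) (time_factor (move_n_body a b) * (2 * W)) k) s' \<and> Inv 0 s'"
  proof (rule runs_While_loop_free)
    show "Inv k s" using s by (auto simp: Inv_def)
    show "1 \<le> 2 * W" using W by simp
    show "bounded_state (2 * W) s'" if jk: "j \<le> k" and inv: "Inv j s'" for j s'
    proof -
      obtain ys where ys: "s a = ys @ s' a" "s' b = rev ys @ s b" "s' rI = [int j]"
        "\<And>r. r \<notin> {rI, a, b} \<Longrightarrow> s' r = s r" using inv by (auto simp: Inv_def)
      have a: "list_size ys + list_size (s' a) \<le> W"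
        using bounded_stateD[OF W(1), of a] ys(1) by simp
      have "int_size (int j) \<le> int_size (int k)" using jk by (intro int_size_mono) simp
      then have j: "int_size (int j) \<le> W" using bounded_stateD[OF W(1), of rI] s(1) by simp
      have "list_size (s' r) \<le> 2 * W" for r
      proof -
        consider "r = a" | "r = b" | "r = rI" | "r \<notin> {rI, a, b}" by blast
        then show ?thesis
          using a j ys bounded_stateD[OF W(1), of b] bounded_stateD[OF W(1), of r] by cases auto
      qed
      then show ?thesis by (simp add: bounded_state_def)
    qed
    show "bval (Less (Const 0) (Top rI)) s' \<and>
        Inv j (lf_state (move_n_body a b) s')"
      if jk: "j < k" and inv: "Inv (Suc j) s'" for j s'
    proof -
      obtain ys where ys: "s a = ys @ s' a" "s' b = rev ys @ s b" "length ys + Suc j = k" "s' rI = [int (Suc j)]"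
        "\<And>r. r \<notin> {rI, a, b} \<Longrightarrow> s' r = s r" using inv by (auto simp: Inv_def)
      have "length (s' a) \<noteq> 0" using ys(1,3) s(3) by auto
      then obtain x xs where x: "s' a = x # xs" by (cases "s' a") auto
      have X: "s' rX = []" using ys(5)[of rX] ab s(2) by simp
      show ?thesis using ys x X ab
        by (auto simp: Inv_def move_n_body_def assign_state intro!: exI[of _ "ys @ [x]"])
    qed
    show "\<not> bval (Less (Const 0) (Top rI)) s'" if "Inv 0 s'" for s'
      using that by (auto simp: Inv_def)
  qed (simp add: move_n_body_def)
  then obtain s' where s': "runs (move_n a b) s (move_n_time W) s'" "Inv 0 s'"
    unfolding move_n_def move_n_time_eq[of W a b] by (meson k loop_time_mono order_refl runs_mono)
  have "s' = s(rI := [0], a := drop k (s a), b := rev (take k (s a)) @ s b)"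
    using s'(2) ab by (intro ext) (auto simp: Inv_def)
  then show ?thesis using s'(1) by simp
qed

lemma runs_move_all:
  assumes ab: "a \<noteq> b" and W: "bounded_state W s" "1 \<le> W"
  obtains s' where "runs (move_all a b) s (move_all_time a b W) s'" "s' a = []"
    "s' b = rev (s a) @ s b" "\<And>r. r \<notin> {a, b} \<Longrightarrow> s' r = s r"
proof -
  define Inv where "Inv j s' \<longleftrightarrow> (\<exists>ys. s a = ys @ s' a \<and> s' b = rev ys @ s b \<and> length (s' a) = j \<and>
    (\<forall>r. r \<notin> {a, b} \<longrightarrow> s' r = s r))" for j and s' :: state
  define k where "k = length (s a)"
  have k: "k \<le> W"
    using length_le_list_size[of "s a"] bounded_stateD[OF W(1), of a] unfolding k_def by linarith
  have "\<exists>s'. runs (While (Nonempty a) (Seq (Push b (Top a)) (Pop a))) s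
      (loop_time (Nonempty a) (2 * W) (time_factor (Seq (Push b (Top a)) (Pop a)) * (2 * W)) k) s' \<and> Inv 0 s'"
  proof (rule runs_While_loop_free)
    show "Inv k s" by (auto simp: Inv_def k_def)
    show "1 \<le> 2 * W" using W by simp
    show "bounded_state (2 * W) s'" if jk: "j \<le> k" and inv: "Inv j s'" for j s'
    proof -
      obtain ys where ys: "s a = ys @ s' a" "s' b = rev ys @ s b"
        "\<And>r. r \<notin> {a, b} \<Longrightarrow> s' r = s r" using inv by (auto simp: Inv_def)
      have a: "list_size ys + list_size (s' a) \<le> W"
        using bounded_stateD[OF W(1), of a] ys(1) by simp
      have "list_size (s' r) \<le> 2 * W" for r
      proof -
        consider "r = a" | "r = b" | "r \<notin> {a, b}" by blast
        then show ?thesis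
          using a ys bounded_stateD[OF W(1), of b] bounded_stateD[OF W(1), of r] by cases auto
      qed
      then show ?thesis by (simp add: bounded_state_def)
    qed
    show "bval (Nonempty a) s' \<and> Inv j (lf_state (Seq (Push b (Top a)) (Pop a)) s')"
      if jk: "j < k" and inv: "Inv (Suc j) s'" for j s'
    proof -
      obtain ys where ys: "s a = ys @ s' a" "s' b = rev ys @ s b" "length (s' a) = Suc j"
        "\<And>r. r \<notin> {a, b} \<Longrightarrow> s' r = s r" using inv by (auto simp: Inv_def)
      then obtain x xs where x: "s' a = x # xs" by (cases "s' a") auto
      show ?thesis using ys x ab
        by (auto simp: Inv_def intro!: exI[of _ "ys @ [x]"])
    qed
    show "\<not> bval (Nonempty a) s'" if "Inv 0 s'" for s'
      using that by (auto simp: Inv_def)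
  qed simp
  then obtain s' where s': "runs (move_all a b) s (move_all_time a b W) s'" "Inv 0 s'"
    unfolding move_all_def move_all_time_def by (meson k loop_time_mono order_refl runs_mono)
  from s'(2) have "s' a = []" "s' b = rev (s a) @ s b" "\<And>r. r \<notin> {a, b} \<Longrightarrow> s' r = s r"
    by (auto simp: Inv_def)
  with s'(1) show ?thesis by (rule that)
qed

section \<open>Computing the upper bounds of a grid point\<close>

definition digit_aexp :: "nat \<Rightarrow> aexp" where
  "digit_aexp j = (let b = Add (Top rT) (Const 1); a = Div (Top rCnt) (pow_aexp b j)
     in Sub a (Mul (Div a b) b))"

text \<open>The machine has no remainder operation, so the digit is
  \<open>a - (a div b) * b\<close>.\<close>

lemma aval_digit_aexp:
  assumes "s rT = [int t]" "s rCnt = [int N]"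
  shows "aval (digit_aexp j) s = int (digit t N j)"
  using assms by (simp add: digit_aexp_def Let_def minus_div_mult_eq_mod digit_def zdiv_int zmod_int add.commute)

primrec cap_aexp :: "nat \<Rightarrow> aexp" where
  "cap_aexp 0 = Const 0"
| "cap_aexp (Suc k) = Add (cap_aexp k) (Mul (Top (rW k)) (digit_aexp k))"

lemma aval_cap_aexp:
  assumes "s rT = [int t]" "s rCnt = [int N]" "\<And>j. j < k \<Longrightarrow> aval (Top (rW j)) s = f j"
  shows "aval (cap_aexp k) s = (\<Sum>j<k. f j * int (digit t N j))"
  using assms(3) by (induction k) (auto simp: aval_digit_aexp[OF assms(1,2)])

text \<open>The membership rows are stored reversed: popping meets the last index first, and pushing
  the caps onto register 0 builds their list in the right order.\<close>

definition caps_body :: prog where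
  "caps_body = Seq (Cond (Less (Top rT) (cap_aexp K)) (Push 0 (Top rT)) (Push 0 (cap_aexp K)))
     (Seq (seqn (\<lambda>j. Pop (rW j)) K) (assign rI (Sub (Top rI) (Const 1))))"

definition caps_time :: "nat \<Rightarrow> nat" where
  "caps_time W = loop_time (Less (Const 0) (Top rI)) W (time_factor caps_body * W) W"

lemma loop_free_caps_body: "loop_free caps_body"
  by (simp add: caps_body_def loop_free_seqn)

definition cap_list :: "nat \<Rightarrow> nat \<Rightarrow> (nat \<Rightarrow> int list) \<Rightarrow> nat \<Rightarrow> int list" where
  "cap_list n t fs N = map (\<lambda>i. min (int t) (\<Sum>j<K. fs j ! i * int (digit t N j))) [0..<n]"

lemma list_size_cap_list:
  assumes "\<And>j i. j < K \<Longrightarrow> i < n \<Longrightarrow> 0 \<le> fs j ! i"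
  shows "list_size (cap_list n t fs N) \<le> n * (t + 1)"
proof -
  have "int_size v \<le> t + 1" if v: "v \<in> set (cap_list n t fs N)" for v
  proof -
    have "v \<in> (\<lambda>i. min (int t) (\<Sum>j<K. fs j ! i * int (digit t N j))) ` {..<n}"
      using v by (simp add: cap_list_def lessThan_atLeast0)
    then have "0 \<le> v" "v \<le> int t" using assms by (auto intro!: sum_nonneg)
    then show ?thesis using int_size_le_abs[of v] by linarith
  qed
  then have "list_size (cap_list n t fs N) \<le> length (cap_list n t fs N) * (t + 1)" by (rule list_size_le_length)
  then show ?thesis by (simp add: cap_list_def)
qed

lemma runs_caps:
  assumes s: "s rI = [int n]" "s rX = []" "s rT = [int t]" "s rCnt = [int N]" "s 0 = []"
    "\<And>j. j < K \<Longrightarrow> s (rW j) = rev (fs j)" "\<And>j. j < K \<Longrightarrow> length (fs j) = n"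
    and fs: "\<And>j i. j < K \<Longrightarrow> i < n \<Longrightarrow> 0 \<le> fs j ! i"
    and W: "bounded_state W s" "1 \<le> W" "n * (t + 1) \<le> W" "n \<le> W"
  obtains s' where "runs (While (Less (Const 0) (Top rI)) caps_body) s (caps_time W) s'" "s' rI = [0]"
    "s' 0 = cap_list n t fs N"
    "\<And>r. r \<notin> {0, rI} \<union> rW ` {..<K} \<Longrightarrow> s' r = s r" "bounded_state W s'"
proof -
  define g where "g i = min (int t) (\<Sum>j<K. fs j ! i * int (digit t N j))" for i
  define Inv where "Inv m s' \<longleftrightarrow> m \<le> n \<and> s' rI = [int m] \<and> (\<forall>j<K. s' (rW j) = rev (take m (fs j))) \<and>
    s' 0 = map g [m..<n] \<and> (\<forall>r. r \<notin> {0, rI} \<union> rW ` {..<K} \<longrightarrow> s' r = s r)" for m and s' :: state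
  have bd: "bounded_state W s'" if "Inv m s'" for m s'
  proof -
    have inv: "m \<le> n" "s' rI = [int m]" "\<And>j. j < K \<Longrightarrow> s' (rW j) = rev (take m (fs j))"
      "s' 0 = map g [m..<n]" "\<And>r. r \<notin> {0, rI} \<union> rW ` {..<K} \<Longrightarrow> s' r = s r"
      using that by (auto simp: Inv_def)
    have "map g [m..<n] = drop m (cap_list n t fs N)"
      by (simp add: cap_list_def g_def drop_map)
    then have "list_size (map g [m..<n]) \<le> n * (t + 1)"
      using order_trans[OF list_size_drop list_size_cap_list] fs by metis
    then have 0: "list_size (s' 0) \<le> W" using W(3) inv(4) by simp
    have "int_size (int m) \<le> int_size (int n)" using inv(1) by (intro int_size_mono) simp
    then have I: "list_size (s' rI) \<le> W" using bounded_stateD[OF W(1), of rI] s(1) inv(2) by simp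
    have W': "list_size (s' (rW j)) \<le> W" if "j < K" for j
      using inv(3)[OF that] bounded_stateD[OF W(1), of "rW j"] s(6)[OF that] list_size_take[of m "fs j"] by simp
    have "list_size (s' r) \<le> W" for r
    proof -
      consider "r = 0" | "r = rI" | j where "j < K" "r = rW j" | "r \<notin> {0, rI} \<union> rW ` {..<K}" by blast
      then show ?thesis
        using 0 I W' inv(5) bounded_stateD[OF W(1), of r] by cases auto
    qed
    then show ?thesis by (simp add: bounded_state_def)
  qed
  have "\<exists>s'. runs (While (Less (Const 0) (Top rI)) caps_body) s
      (loop_time (Less (Const 0) (Top rI)) W (time_factor caps_body * W) n) s' \<and> Inv 0 s'"
  proof (rule runs_While_loop_free[OF loop_free_caps_body W(2)])
    show "Inv n s" using s by (auto simp: Inv_def)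
    show "bounded_state W s'" if "m \<le> n" "Inv m s'" for m s' using bd[OF that(2)] .
    show "bval (Less (Const 0) (Top rI)) s' \<and> Inv m (lf_state caps_body s')"
      if m: "m < n" and I: "Inv (Suc m) s'" for m s'
    proof -
      have inv: "s' rI = [int (Suc m)]" "\<And>j. j < K \<Longrightarrow> s' (rW j) = rev (take (Suc m) (fs j))"
        "s' 0 = map g [Suc m..<n]" "\<And>r. r \<notin> {0, rI} \<union> rW ` {..<K} \<Longrightarrow> s' r = s r"
        using I by (auto simp: Inv_def)
      have Wj: "s' (rW j) = fs j ! m # rev (take m (fs j))" if "j < K" for j
        using inv(2)[OF that] s(7)[OF that] m by (simp add: take_Suc_conv_app_nth)
      have T: "s' rT = [int t]" "s' rCnt = [int N]" "s' rX = []"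
        using inv(4)[of rT] inv(4)[of rCnt] inv(4)[of rX] s B by auto
      have cap: "aval (cap_aexp K) s' = (\<Sum>j<K. fs j ! m * int (digit t N j))"
        using Wj by (intro aval_cap_aexp T) auto
      define s1 where "s1 = lf_state (Cond (Less (Top rT) (cap_aexp K)) (Push 0 (Top rT)) (Push 0 (cap_aexp K))) s'"
      have s1: "s1 0 = g m # s' 0" "\<And>r. r \<noteq> 0 \<Longrightarrow> s1 r = s' r"
        using T cap by (auto simp: s1_def g_def)
      define s2 where "s2 = lf_state (seqn (\<lambda>j. Pop (rW j)) K) s1"
      have s2: "\<And>j. j < K \<Longrightarrow> s2 (rW j) = tl (s1 (rW j))" "\<And>r. r \<notin> rW ` {..<K} \<Longrightarrow> s2 r = s1 r"
        using pop_family[of K rW s1] by (auto simp: s2_def)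
      have s2': "s2 0 = map g [m..<n]" "s2 rI = [int (Suc m)]" "s2 rX = []"
        "\<And>j. j < K \<Longrightarrow> s2 (rW j) = rev (take m (fs j))" "\<And>r. r \<notin> {0, rI} \<union> rW ` {..<K} \<Longrightarrow> s2 r = s r"
      proof -
        show "s2 0 = map g [m..<n]" using s2(2)[of 0] s1(1) inv(3) m B by (auto simp: upt_conv_Cons)
        show "s2 rI = [int (Suc m)]" "s2 rX = []"
          using s2(2)[of rI] s2(2)[of rX] s1(2) inv(1) T(3) B by auto
        show "s2 (rW j) = rev (take m (fs j))" if "j < K" for j
          using s2(1)[OF that] s1(2)[of "rW j"] Wj[OF that] B by simp
        show "s2 r = s r" if "r \<notin> {0, rI} \<union> rW ` {..<K}" for r
          using s2(2)[of r] s1(2)[of r] inv(4)[OF that] that by auto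
      qed
      have "lf_state caps_body s' = s2(rI := [int m])"
        using assign_state[of s2 rI "Sub (Top rI) (Const 1)"] s2' unfolding caps_body_def s2_def s1_def by simp
      then have "Inv m (lf_state caps_body s')"
        using s2' m B by (auto simp: Inv_def)
      then show ?thesis using inv(1) by simp
    qed
    show "\<not> bval (Less (Const 0) (Top rI)) s'" if "Inv 0 s'" for s'
      using that by (auto simp: Inv_def)
  qed
  then obtain s' where s': "runs (While (Less (Const 0) (Top rI)) caps_body) s (caps_time W) s'" "Inv 0 s'"
    unfolding caps_time_def by (meson W(4) loop_time_mono order_refl runs_mono)
  show ?thesis
    by (rule that[OF s'(1) _ _ _ bd[OF s'(2)]]) (use s'(2) in \<open>auto simp: Inv_def g_def cap_list_def\<close>)
qed


section \<open>Exact inner products of fractions\<close>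

definition dot_body :: prog where
  "dot_body = Seq (Push rX1 (Top rL)) (Seq (Pop rL) (Seq (Push rX2 (Top rL)) (Seq (Pop rL)
    (Seq (Push rX3 (Top rR)) (Seq (Pop rR) (Seq (Push rX4 (Top rR)) (Seq (Pop rR)
    (Seq (assign rNum (Add (Mul (Top rNum) (Mul (Top rX1) (Top rX3))) (Mul (Mul (Top rX2) (Top rX4)) (Top rDen))))
    (Seq (assign rDen (Mul (Top rDen) (Mul (Top rX1) (Top rX3))))
    (Seq (Pop rX1) (Seq (Pop rX2) (Seq (Pop rX3) (Pop rX4)))))))))))))"

definition dot_time :: "nat \<Rightarrow> nat" where
  "dot_time W = loop_time (Nonempty rL) W (time_factor dot_body * W) W"

text \<open>One step adds \<open>(n / d) * (n' / d')\<close> to \<open>a / b\<close> over the common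
  denominator \<open>b * (d * d')\<close>; fractions are never reduced.\<close>

lemma dot_body_state:
  assumes "s rL = d # n # xs" "s rR = d' # n' # ys" "s rNum = [a]" "s rDen = [b]" "s rX = []"
  shows "lf_state dot_body s r = (if r = rL then xs else if r = rR then ys
    else if r = rNum then [a * (d * d') + n * n' * b] else if r = rDen then [b * (d * d')] else s r)"
  using assms by (simp add: dot_body_def assign_def)

text \<open>The sizes of numerator and denominator grow by at most the size of the consumed entries, so
  the sum of the size of the accumulator and of the remaining input does not increase.\<close>

lemma dot_size:
  assumes "int_size a + (int_size d + int_size n) + (int_size d' + int_size n') + w \<le> W"
    "int_size b + (int_size d + int_size n) + (int_size d' + int_size n') + w \<le> W"
  shows "int_size (a * (d * d') + n * n' * b) + w \<le> W" "int_size (b * (d * d')) + w \<le> W"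
proof -
  have 1: "int_size (a * (d * d')) \<le> int_size a + (int_size d + int_size d')"
    "int_size (b * (d * d')) \<le> int_size b + (int_size d + int_size d')"
    using int_size_mult[of a "d * d'"] int_size_mult[of b "d * d'"] int_size_mult[of d d'] by linarith+
  have 2: "int_size (n * n' * b) \<le> int_size b + (int_size n + int_size n')"
    using int_size_mult[of "n * n'" b] int_size_mult[of n n'] by linarith
  define m where "m = max (int_size (a * (d * d'))) (int_size (n * n' * b))"
  have "int_size (a * (d * d') + n * n' * b) \<le> m + 1"
    by (rule int_size_add_le) (auto simp: m_def)
  \<comment> \<open>The carry of the addition is paid by consumed entries that do not occur in the
    larger summand: \<open>n\<close> and \<open>n'\<close>, or \<open>d\<close> and
    \<open>d'\<close>.\<close>
  moreover have "m + 1 + w \<le> W"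
    using 1 2 assms int_size_pos(1)[of n] int_size_pos(1)[of d] unfolding m_def by linarith
  ultimately show "int_size (a * (d * d') + n * n' * b) + w \<le> W" by linarith
  show "int_size (b * (d * d')) + w \<le> W" using 1 assms by linarith
qed

lemma runs_dot:
  assumes s: "s rL = flat_swap ps" "s rR = flat_swap qs" "s rNum = [0]" "s rDen = [1]" "s rX = []"
    and len: "length ps = length qs" and pos: "\<forall>(n, d)\<in>set ps \<union> set qs. 0 < d"
    and W: "bounded_state W s" "list_size (s rL) + list_size (s rR) + 2 \<le> W"
  obtains s' a b where "runs (While (Nonempty rL) dot_body) s (dot_time W) s'"
    "s' rL = []" "s' rR = []" "s' rNum = [a]" "s' rDen = [b]" "0 < b"
    "real_of_int a / real_of_int b = dot_value ps qs"
    "\<And>r. r \<notin> {rL, rR, rNum, rDen} \<Longrightarrow> s' r = s r" "bounded_state W s'"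
proof -
  \<comment> \<open>The accumulator plus the inner product of the unread entries is constant, and so
    is the bound on accumulator size plus unread size.\<close>
  define Inv where "Inv m s' \<longleftrightarrow> (\<exists>ps' qs' a b. s' rL = flat_swap ps' \<and> s' rR = flat_swap qs' \<and>
    length ps' = m \<and> length qs' = m \<and> (\<forall>(n, d)\<in>set ps' \<union> set qs'. 0 < d) \<and>
    s' rNum = [a] \<and> s' rDen = [b] \<and> 0 < b \<and>
    real_of_int a / real_of_int b + dot_value ps' qs' = dot_value ps qs \<and>
    int_size a + list_size (s' rL) + list_size (s' rR) \<le> W \<and>
    int_size b + list_size (s' rL) + list_size (s' rR) \<le> W \<and>
    (\<forall>r. r \<notin> {rL, rR, rNum, rDen} \<longrightarrow> s' r = s r))" for m and s' :: state
  have W1: "1 \<le> W" using W(2) by simp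
  have bd: "bounded_state W s'" if inv: "Inv m s'" for m s'
  proof -
    obtain a b where ab: "s' rNum = [a]" "s' rDen = [b]"
      "int_size a + list_size (s' rL) + list_size (s' rR) \<le> W"
      "int_size b + list_size (s' rL) + list_size (s' rR) \<le> W"
      "\<And>r. r \<notin> {rL, rR, rNum, rDen} \<Longrightarrow> s' r = s r" using inv by (auto simp: Inv_def)
    have "list_size (s' r) \<le> W" for r
    proof (cases "r \<in> {rL, rR, rNum, rDen}")
      case True
      then show ?thesis using ab by auto
    next
      case False
      then show ?thesis using ab(5)[OF False] bounded_stateD[OF W(1), of r] by simp
    qed
    then show ?thesis by (simp add: bounded_state_def)
  qed
  have len_W: "length ps \<le> W"
    using length_le_list_size[of "s rL"] W(2) s(1) by simp
  have "\<exists>s'. runs (While (Nonempty rL) dot_body) s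
      (loop_time (Nonempty rL) W (time_factor dot_body * W) (length ps)) s' \<and> Inv 0 s'"
  proof (rule runs_While_loop_free[OF _ W1])
    show "loop_free dot_body" by (simp add: dot_body_def)
    show "Inv (length ps) s"
      unfolding Inv_def
    proof (intro exI conjI)
      show "s rL = flat_swap ps" "s rR = flat_swap qs" "s rNum = [0]" "s rDen = [1]" by (fact s)+
      show "int_size 0 + list_size (s rL) + list_size (s rR) \<le> W"
        "int_size 1 + list_size (s rL) + list_size (s rR) \<le> W"
        using W(2) int_size_le_abs[of 0] int_size_le_abs[of 1] by simp_all
    qed (use len pos in auto)
    show "bounded_state W s'" if "m \<le> length ps" and inv: "Inv m s'" for m s' using bd[OF inv] .
    show "bval (Nonempty rL) s' \<and> Inv m (lf_state dot_body s')"
      if m: "m < length ps" and inv: "Inv (Suc m) s'" for m s'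
    proof -
      obtain ps0 qs0 a b where i: "s' rL = flat_swap ps0" "s' rR = flat_swap qs0"
        "length ps0 = Suc m" "length qs0 = Suc m" "\<forall>(n, d)\<in>set ps0 \<union> set qs0. 0 < d"
        "s' rNum = [a]" "s' rDen = [b]" "0 < b"
        "real_of_int a / real_of_int b + dot_value ps0 qs0 = dot_value ps qs"
        "int_size a + list_size (s' rL) + list_size (s' rR) \<le> W"
        "int_size b + list_size (s' rL) + list_size (s' rR) \<le> W"
        "\<And>r. r \<notin> {rL, rR, rNum, rDen} \<Longrightarrow> s' r = s r" using inv by (auto simp: Inv_def)
      obtain n d ps' where ps': "ps0 = (n, d) # ps'" using i(3) by (cases ps0) auto
      obtain n' d' qs' where qs': "qs0 = (n', d') # qs'" using i(4) by (cases qs0) auto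
      have d: "0 < d" "0 < d'" using i(5) ps' qs' by auto
      have X: "s' rX = []" using i(12)[of rX] s(5) by simp
      have st: "lf_state dot_body s' r = (if r = rL then flat_swap ps' else if r = rR then flat_swap qs'
        else if r = rNum then [a * (d * d') + n * n' * b] else if r = rDen then [b * (d * d')] else s' r)" for r
        using i ps' qs' X by (intro dot_body_state) auto
      note sz = dot_size[of a d n d' n' "list_size (flat_swap ps') + list_size (flat_swap qs')" W b]
      have sz: "int_size (a * (d * d') + n * n' * b) + (list_size (flat_swap ps') + list_size (flat_swap qs')) \<le> W"
        "int_size (b * (d * d')) + (list_size (flat_swap ps') + list_size (flat_swap qs')) \<le> W"
        using i(1,2,10,11) ps' qs' by (intro sz; simp)+
      have val: "real_of_int (a * (d * d') + n * n' * b) / real_of_int (b * (d * d')) + dot_value ps' qs' = dot_value ps qs"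
      proof -
        have "real_of_int (a * (d * d') + n * n' * b) / real_of_int (b * (d * d')) =
          real_of_int a / real_of_int b + (real_of_int n / real_of_int d) * (real_of_int n' / real_of_int d')"
          using d i(8) by (simp add: field_simps)
        then show ?thesis using i(9) ps' qs' by simp
      qed
      have "Inv m (lf_state dot_body s')"
        unfolding Inv_def
      proof (intro exI conjI)
        show "lf_state dot_body s' rL = flat_swap ps'" "lf_state dot_body s' rR = flat_swap qs'"
          "lf_state dot_body s' rNum = [a * (d * d') + n * n' * b]" "lf_state dot_body s' rDen = [b * (d * d')]"
          by (simp_all add: st)
        show "length ps' = m" "length qs' = m" using i(3,4) ps' qs' by auto
        show "\<forall>(n, d)\<in>set ps' \<union> set qs'. 0 < d" using i(5) ps' qs' by auto
        show "0 < b * (d * d')" using d i(8) by simp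
        show "\<forall>r. r \<notin> {rL, rR, rNum, rDen} \<longrightarrow> lf_state dot_body s' r = s r" using i(12) by (simp add: st)
      qed (use sz val in \<open>simp_all add: st add.assoc\<close>)
      then show ?thesis using i(1) ps' by simp
    qed
    show "\<not> bval (Nonempty rL) s'" if "Inv 0 s'" for s' using that by (auto simp: Inv_def)
  qed
  then obtain s' where s': "runs (While (Nonempty rL) dot_body) s (dot_time W) s'" "Inv 0 s'"
    unfolding dot_time_def by (meson len_W loop_time_mono order_refl runs_mono)
  from s'(2) obtain a b where "s' rL = []" "s' rR = []" "s' rNum = [a]" "s' rDen = [b]" "0 < b"
    "real_of_int a / real_of_int b = dot_value ps qs"
    "\<And>r. r \<notin> {rL, rR, rNum, rDen} \<Longrightarrow> s' r = s r" by (auto simp: Inv_def)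
  then show ?thesis using that[OF s'(1)] bd[OF s'(2)] by blast
qed

section \<open>Evaluating and comparing a candidate\<close>

definition grid_weights :: "nat \<Rightarrow> nat \<Rightarrow> (int \<times> int) list" where
  "grid_weights t N = map (\<lambda>j. (int (digit t N j), int t)) [0..<K]"

lemma push_weights:
  assumes "s rT = [int t]" "s rCnt = [int N]"
  shows "lf_state (seqn (\<lambda>j. Seq (Push rR (digit_aexp j)) (Push rR (Top rT))) k) s =
    s(rR := flat_swap (rev (map (\<lambda>j. (int (digit t N j), int t)) [0..<k])) @ s rR)"
proof (induction k)
  case (Suc k)
  then show ?case
    using assms by (simp add: aval_digit_aexp[of _ t N] fun_eq_iff)
qed simp

definition eval1 :: prog where
  "eval1 = Seq (Pop 0) (Seq (Copy rL rA) (Copy rR rEmpty))"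

definition eval2 :: prog where
  "eval2 = Seq (seqn (\<lambda>j. Seq (Push rR (digit_aexp j)) (Push rR (Top rT))) K)
     (Seq (assign rNum (Const 0)) (assign rDen (Const 1)))"

definition eval3 :: prog where
  "eval3 = Cond (Less (Mul (Top rNum) (Top rBestDen)) (Mul (Top rBestNum) (Top rDen)))
     (Seq (Copy rBest rSol) (Seq (Copy rBestNum rNum) (Copy rBestDen rDen))) Skip"

text \<open>After the success tag is popped, the solution and then the multipliers are stacked onto
  \<open>rR\<close>, in the reversed order of \<open>rA\<close>. The grid cost is thereby a single
  inner product of \<open>(C, c, \<Gamma>)\<close> with \<open>(x, y, u)\<close>, and its comparison
  with the best value is by cross-multiplication.\<close>

definition eval_prog :: prog where
  "eval_prog = Seq eval1 (Seq (move_all 0 rR) (Seq eval2 (Seq (While (Nonempty rL) dot_body) eval3)))"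

definition eval_time :: "nat \<Rightarrow> nat" where
  "eval_time W = time_factor eval1 * W + (move_all_time 0 rR W + (time_factor eval2 * W +
     (dot_time W + time_factor eval3 * W)))"

lemma runs_eval:
  assumes s: "s 0 = 1 # flat qs" "s rSol = 1 # flat qs" "s rA = flat_swap (rev ps)"
    "s rT = [int t]" "s rCnt = [int N]" "s rX = []" "s rEmpty = []" "s rBestNum = [bn]" "s rBestDen = [bd]"
    and len: "length qs + K = length ps" and pos: "\<forall>(n, d)\<in>set ps \<union> set qs. 0 < d" and t: "0 < t"
    and W: "bounded_state W s" "list_size (s rA) + list_size (s 0) + 2 * K * (t + 1) + 2 \<le> W"
  obtains s' a b where "runs eval_prog s (eval_time W) s'" "0 < b"
    "real_of_int a / real_of_int b = dot_value ps (qs @ grid_weights t N)"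
    "a * bd < bn * b \<longrightarrow> s' rBest = 1 # flat qs \<and> s' rBestNum = [a] \<and> s' rBestDen = [b]"
    "\<not> a * bd < bn * b \<longrightarrow> s' rBest = s rBest \<and> s' rBestNum = [bn] \<and> s' rBestDen = [bd]"
    "\<forall>r. r \<notin> {0, rL, rR, rNum, rDen, rBest, rBestNum, rBestDen} \<longrightarrow> s' r = s r" "bounded_state W s'"
proof -
  have W1: "1 \<le> W" using W(2) by simp
  have bs: "list_size (s r) \<le> W" for r using bounded_stateD[OF W(1)] .
  define us where "us = grid_weights t N"
  define s1 where "s1 = lf_state eval1 s"
  have s1: "s1 r = (if r = 0 then flat qs else if r = rL then s rA else if r = rR then [] else s r)" for r
    using s by (simp add: s1_def eval1_def)
  have r1: "runs eval1 s (time_factor eval1 * W) s1"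
    unfolding s1_def by (rule runs_loop_free) (use W W1 in \<open>auto simp: eval1_def\<close>)
  have b1: "bounded_state W s1" using bs bs[of 0] s(1) by (auto simp: bounded_state_def s1)
  obtain s2 where s2: "runs (move_all 0 rR) s1 (move_all_time 0 rR W) s2" "s2 0 = []"
    "s2 rR = rev (flat qs)" "\<And>r. r \<notin> {0, rR} \<Longrightarrow> s2 r = s1 r"
    using runs_move_all[OF _ b1 W1, of 0 rR] by (auto simp: s1)
  have b2: "bounded_state W s2"
    unfolding bounded_state_def
  proof
    fix r
    consider "r = 0" | "r = rR" | "r \<notin> {0, rR}" by blast
    then show "list_size (s2 r) \<le> W"
      using bs[of 0] s(1) s2 bounded_stateD[OF b1, of r] by cases auto
  qed
  define s3 where "s3 = lf_state eval2 s2"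
  have us: "flat_swap (rev (map (\<lambda>j. (int (digit t N j), int t)) [0..<K])) = flat_swap (rev us)"
    by (simp add: us_def grid_weights_def)
  have s3: "s3 = s2(rR := flat_swap (rev us) @ rev (flat qs), rNum := [0], rDen := [1])"
    using push_weights[of s2 t N K] s2 s s1
    by (simp add: s3_def eval2_def assign_state us)
  have r3: "runs eval2 s2 (time_factor eval2 * W) s3"
    unfolding s3_def by (rule runs_loop_free) (use b2 W1 in \<open>auto simp: eval2_def loop_free_seqn\<close>)
  have us_sz: "list_size (flat_swap (rev us)) \<le> 2 * K * (t + 1)"
  proof -
    have "int_size v \<le> t + 1" if "v \<in> set (flat_swap (rev us))" for v
    proof -
      have "v = int t \<or> (\<exists>j. v = int (digit t N j))"
        using that by (auto simp: us_def grid_weights_def flat_swap_def)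
      then show ?thesis using int_size_int_le[of t] int_size_int_le order_trans[OF int_size_int_le] digit_le[of t N] by fastforce
    qed
    then have "list_size (flat_swap (rev us)) \<le> length (flat_swap (rev us)) * (t + 1)"
      by (rule list_size_le_length)
    then show ?thesis by (simp add: us_def grid_weights_def)
  qed
  have szRL: "list_size (s3 rL) + list_size (s3 rR) + 2 \<le> W"
    using us_sz W(2) s(1) s2(4)[of rL] s1 by (simp add: s3)
  have b3: "bounded_state W s3"
    unfolding s3
    by (intro bounded_state_upd b2) (use szRL int_size_le_abs[of 0] int_size_le_abs[of 1] in \<open>auto simp: s3\<close>)
  have len': "length (rev ps) = length (rev (qs @ us))" using len by (simp add: us_def grid_weights_def)
  have L: "s3 rL = flat_swap (rev ps)" "s3 rR = flat_swap (rev (qs @ us))" "s3 rNum = [0]" "s3 rDen = [1]" "s3 rX = []"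
    using s s2 s1 by (simp_all add: s3 rev_flat)
  have "\<forall>(n, d)\<in>set (rev ps) \<union> set (rev (qs @ us)). 0 < d"
    using pos t by (auto simp: us_def grid_weights_def)
  from runs_dot[OF L len' this b3 szRL] obtain s4 a b where s4:
    "runs (While (Nonempty rL) dot_body) s3 (dot_time W) s4" "s4 rL = []" "s4 rR = []" "s4 rNum = [a]"
    "s4 rDen = [b]" "0 < b" "real_of_int a / real_of_int b = dot_value (rev ps) (rev (qs @ us))"
    "\<And>r. r \<notin> {rL, rR, rNum, rDen} \<Longrightarrow> s4 r = s3 r" "bounded_state W s4" by blast
  have s4s: "s4 r = s r" if "r \<notin> {0, rL, rR, rNum, rDen}" for r
    using s4(8)[of r] s3 s2(4)[of r] s1[of r] that by auto
  define s5 where "s5 = lf_state eval3 s4"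
  have r5: "runs eval3 s4 (time_factor eval3 * W) s5"
    unfolding s5_def by (rule runs_loop_free) (use s4(9) W1 in \<open>auto simp: eval3_def\<close>)
  have tops: "s4 rSol = 1 # flat qs" "s4 rBestNum = [bn]" "s4 rBestDen = [bd]" "s4 rBest = s rBest"
    using s4s s by simp_all
  have s5: "s5 = (if a * bd < bn * b then s4(rBest := 1 # flat qs, rBestNum := [a], rBestDen := [b]) else s4)"
    using tops s4(4,5) by (simp add: s5_def eval3_def)
  have b5: "bounded_state W s5"
    using bounded_stateD[OF s4(9), of rSol] bounded_stateD[OF s4(9), of rNum] bounded_stateD[OF s4(9), of rDen]
      tops s4(4,5,9) by (auto simp: s5 intro!: bounded_state_upd)
  have "runs eval_prog s (eval_time W) s5"
    unfolding eval_prog_def eval_time_def by (intro runs_Seq[OF r1] runs_Seq[OF s2(1)] runs_Seq[OF r3] runs_Seq[OF s4(1)] r5)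
  moreover have "real_of_int a / real_of_int b = dot_value ps (qs @ grid_weights t N)"
    using s4(7) dot_value_rev[of ps "qs @ us"] len' by (simp add: us_def)
  ultimately show ?thesis
    using that[of s5 b a] s4(6) tops s4s b5 by (auto simp: s5)
qed


section \<open>One round of the search\<close>

definition body1 :: prog where
  "body1 = Seq (assign rCnt (Sub (Top rCnt) (Const 1))) (Seq (seqn (\<lambda>j. Copy j rEmpty) B)
     (Seq (seqn (\<lambda>j. Copy (rW j) (rV j)) K) (assign rI (Top rN))))"

definition body2 :: prog where
  "body2 = Seq (Push 0 (Top rT)) (Copy rTmp rPre)"

text \<open>Register 0 is filled from back to front: the caps, then \<open>t\<close>, then the
  prefix, whose reversed copy is moved on top. The counter is decremented at the start, so the index
  treated is one less than the counter at the test. The copy \<open>rSol\<close> is kept because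
  evaluation consumes register 0.\<close>

definition body_prog :: prog where
  "body_prog = Seq body1 (Seq (While (Less (Const 0) (Top rI)) caps_body) (Seq body2
     (Seq (move_all rTmp 0) (Seq p (Seq (Copy rSol 0) (Cond (Less (Const 0) (Top 0)) eval_prog Skip))))))"

definition body_time :: "nat \<Rightarrow> nat \<Rightarrow> nat" where
  "body_time W Tp = time_factor body1 * W + (caps_time W + (time_factor body2 * W +
     (move_all_time rTmp 0 W + (Tp + (time_factor (Copy rSol 0) * W +
     (1 + bcost_factor (Less (Const 0) (Top 0)) * W + (eval_time W + 1)))))))"

lemma body1_state:
  assumes "s rCnt = [int (Suc N)]" "s rX = []" "s rN = [int n]" "s rEmpty = []"
  shows "lf_state body1 s rCnt = [int N]" "r < B \<Longrightarrow> lf_state body1 s r = []"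
    "j < K \<Longrightarrow> lf_state body1 s (rW j) = s (rV j)" "lf_state body1 s rI = [int n]"
    "\<And>r. B \<le> r \<Longrightarrow> r \<notin> {rCnt, rI} \<union> rW ` {..<K} \<Longrightarrow> lf_state body1 s r = s r"
proof -
  define s1 where "s1 = s(rCnt := [int N])"
  define s2 where "s2 = lf_state (seqn (\<lambda>j. Copy j rEmpty) B) s1"
  define s3 where "s3 = lf_state (seqn (\<lambda>j. Copy (rW j) (rV j)) K) s2"
  have s2: "\<And>r. r < B \<Longrightarrow> s2 r = []" "\<And>r. B \<le> r \<Longrightarrow> s2 r = s1 r"
    using copy_family[of B "\<lambda>j. j" "\<lambda>_. rEmpty" s1] assms(4) by (auto simp: s2_def s1_def)
  have s3: "\<And>j. j < K \<Longrightarrow> s3 (rW j) = s2 (rV j)" "\<And>r. r \<notin> rW ` {..<K} \<Longrightarrow> s3 r = s2 r"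
    using copy_family[of K rW rV s2] by (auto simp: s3_def)
  have "s3 rX = []" "s3 rN = [int n]" using s3(2) s2(2) assms by (simp_all add: s1_def)
  moreover have "lf_state (assign rCnt (Sub (Top rCnt) (Const 1))) s = s1"
    using assms by (simp add: assign_state s1_def)
  ultimately have eq: "lf_state body1 s = s3(rI := [int n])"
    unfolding body1_def using s3_def s2_def by (simp add: assign_state)
  show "lf_state body1 s rCnt = [int N]" using s3(2) s2(2) by (simp add: eq s1_def)
  show "lf_state body1 s r = []" if "r < B" using s3(2)[of r] s2(1)[OF that] that by (simp add: eq)
  show "lf_state body1 s (rW j) = s (rV j)" if "j < K" using s3(1)[OF that] s2(2) by (simp add: eq s1_def)
  show "lf_state body1 s rI = [int n]" by (simp add: eq)
  show "lf_state body1 s r = s r" if "B \<le> r" "r \<notin> {rCnt, rI} \<union> rW ` {..<K}" for r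
    using s3(2)[of r] s2(2)[OF that(1)] that by (simp add: eq s1_def)
qed

end

text \<open>\<open>Res N out\<close> says that \<open>out\<close> is a correct answer to the subproblem of the grid point \<open>N\<close>.\<close>

locale grid_search = grid_program +
  fixes n t Tp W :: nat and pre :: "int list" and ps :: "(int \<times> int) list" and fs :: "nat \<Rightarrow> int list"
    and Res :: "nat \<Rightarrow> int list \<Rightarrow> bool"
  assumes t: "0 < t" and ps_pos: "\<forall>(a, b)\<in>set ps. 0 < b"
    and fs: "\<And>j. j < K \<Longrightarrow> length (fs j) = n" "\<And>j i. j < K \<Longrightarrow> i < n \<Longrightarrow> 0 \<le> fs j ! i"
    and sub: "\<And>N. N < (t + 1) ^ K \<Longrightarrow> \<exists>out. outputs_within p (pre @ int t # cap_list n t fs N) Tp out \<and> Res N out"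
    and Res: "\<And>N out. N < (t + 1) ^ K \<Longrightarrow> Res N out \<Longrightarrow>
      out = [0] \<or> (\<exists>qs. out = 1 # flat qs \<and> length qs + K = length ps \<and> (\<forall>(a, b)\<in>set qs. 0 < b))"
    and W: "list_size pre + list_size (flat ps) + (n + 1 + 2 * K) * (t + 1) + Tp + 2 \<le> W"
begin

abbreviation "val N qs \<equiv> dot_value ps (qs @ grid_weights t N)"

text \<open>The data that every round must leave intact, together with the uniform size bound
  \<open>W\<close>.\<close>

definition ready :: "state \<Rightarrow> bool" where
  "ready s \<longleftrightarrow> s rN = [int n] \<and> s rT = [int t] \<and> s rPre = rev pre \<and> s rA = flat_swap (rev ps) \<and>
    (\<forall>j<K. s (rV j) = rev (fs j)) \<and> s rEmpty = [] \<and> s rX = [] \<and> s rTmp = [] \<and> bounded_state W s"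

text \<open>As long as no solution has been found, the best value is \<open>1 / 0\<close>; cross-multiplication treats
  it as infinity.\<close>

definition best :: "nat set \<Rightarrow> state \<Rightarrow> bool" where
  "best D s \<longleftrightarrow> (\<exists>bn bd. s rBestNum = [bn] \<and> s rBestDen = [bd] \<and>
     ((bn = 1 \<and> bd = 0 \<and> s rBest = [0] \<and> (\<forall>N\<in>D. Res N [0])) \<or>
      (0 < bd \<and> (\<exists>N qs. N < (t + 1) ^ K \<and> Res N (1 # flat qs) \<and> s rBest = 1 # flat qs \<and>
          real_of_int bn / real_of_int bd = val N qs) \<and>
        (\<forall>N\<in>D. Res N [0] \<or> (\<exists>qs. Res N (1 # flat qs) \<and> real_of_int bn / real_of_int bd \<le> val N qs)))))"

lemma best_infeasible:
  assumes "best D s" "Res N [0]" "s' rBest = s rBest" "s' rBestNum = s rBestNum" "s' rBestDen = s rBestDen"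
  shows "best (insert N D) s'"
  using assms unfolding best_def by auto

lemma best_eval:
  assumes best: "best D s" and N: "N < (t + 1) ^ K" "Res N (1 # flat qs)"
    and bs: "s rBestNum = [bn]" "s rBestDen = [bd]"
    and b: "0 < b" "real_of_int a / real_of_int b = val N qs"
    and upd: "a * bd < bn * b \<Longrightarrow> s' rBest = 1 # flat qs \<and> s' rBestNum = [a] \<and> s' rBestDen = [b]"
      "\<not> a * bd < bn * b \<Longrightarrow> s' rBest = s rBest \<and> s' rBestNum = [bn] \<and> s' rBestDen = [bd]"
  shows "best (insert N D) s'"
proof -
  have old: "(bn = 1 \<and> bd = 0 \<and> s rBest = [0] \<and> (\<forall>N\<in>D. Res N [0])) \<or>
      (0 < bd \<and> (\<exists>N qs. N < (t + 1) ^ K \<and> Res N (1 # flat qs) \<and> s rBest = 1 # flat qs \<and>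
          real_of_int bn / real_of_int bd = val N qs) \<and>
        (\<forall>N\<in>D. Res N [0] \<or> (\<exists>qs. Res N (1 # flat qs) \<and> real_of_int bn / real_of_int bd \<le> val N qs)))"
    (is "?none \<or> ?some")
    using best bs unfolding best_def by simp
  have cmp: "a * bd < bn * b \<longleftrightarrow> val N qs < real_of_int bn / real_of_int bd" if "0 < bd"
  proof -
    have "a * bd < bn * b \<longleftrightarrow> real_of_int a * real_of_int bd < real_of_int bn * real_of_int b"
      by (metis of_int_less_iff of_int_mult)
    also have "\<dots> \<longleftrightarrow> real_of_int a / real_of_int b < real_of_int bn / real_of_int bd"
      using that b(1) by (simp add: field_simps)
    finally show ?thesis using b(2) by simp
  qed
  show ?thesis
  proof (cases "a * bd < bn * b")
    case True
    have "Res M [0] \<or> (\<exists>qs. Res M (1 # flat qs) \<and> real_of_int a / real_of_int b \<le> val M qs)"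
      if M: "M \<in> insert N D" for M
    proof (cases "M = N")
      case True
      then show ?thesis using N(2) b(2) by (intro disjI2 exI[of _ qs]) simp
    next
      case False
      with M have "M \<in> D" by simp
      from old show ?thesis
      proof
        assume ?none
        then show ?thesis using \<open>M \<in> D\<close> by blast
      next
        assume o: ?some
        then have "real_of_int a / real_of_int b < real_of_int bn / real_of_int bd"
          using cmp True b(2) \<open>a * bd < bn * b\<close> by simp
        then show ?thesis using o \<open>M \<in> D\<close> by (meson less_le_trans less_imp_le)
      qed
    qed
    then show ?thesis
      unfolding best_def using upd(1)[OF True] b N by blast
  next
    case False
    from old show ?thesis
    proof
      assume ?none
      \<comment> \<open>Against the initial value \<open>1 / 0\<close> the test reads
        \<open>0 < b\<close> and cannot fail.\<close>
      then show ?thesis using False b(1) by simp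
    next
      assume o: ?some
      then have "real_of_int bn / real_of_int bd \<le> val N qs" using cmp False by simp
      then have "\<forall>M\<in>insert N D. Res M [0] \<or> (\<exists>qs. Res M (1 # flat qs) \<and> real_of_int bn / real_of_int bd \<le> val M qs)"
        using o N(2) by blast
      then show ?thesis unfolding best_def using upd(2)[OF False] o by auto
    qed
  qed
qed

lemma runs_body:
  assumes ready: "ready s" and cnt: "s rCnt = [int (Suc N)]" and N: "N < (t + 1) ^ K" and best: "best D s"
  shows "\<exists>s'. runs body_prog s (body_time W Tp) s' \<and> ready s' \<and> s' rCnt = [int N] \<and> best (insert N D) s'"
proof -
  have W_split: "list_size pre + list_size (flat ps) + (n * (t + 1) + (t + 1) + 2 * K * (t + 1)) + Tp + 2 \<le> W"
    using W by (simp add: algebra_simps)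
  have W1: "1 \<le> W" and nt: "n * (t + 1) \<le> W" using W_split by linarith+
  have "n * 1 \<le> n * (t + 1)" by (intro mult_left_mono) auto
  then have nW: "n + 1 \<le> W" using W_split by linarith
  have rd: "s rN = [int n]" "s rT = [int t]" "s rPre = rev pre" "s rA = flat_swap (rev ps)"
    "\<And>j. j < K \<Longrightarrow> s (rV j) = rev (fs j)" "s rEmpty = []" "s rX = []" "s rTmp = []" "bounded_state W s"
    using ready by (simp_all add: ready_def)
  obtain bn bd where bs: "s rBestNum = [bn]" "s rBestDen = [bd]" using best by (auto simp: best_def)
  define s1 where "s1 = lf_state body1 s"
  have s1: "s1 rCnt = [int N]" "\<And>r. r < B \<Longrightarrow> s1 r = []" "\<And>j. j < K \<Longrightarrow> s1 (rW j) = rev (fs j)" "s1 rI = [int n]"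
    "\<And>r. B \<le> r \<Longrightarrow> r \<notin> {rCnt, rI} \<union> rW ` {..<K} \<Longrightarrow> s1 r = s r"
    using body1_state[OF cnt rd(7) rd(1) rd(6)] rd(5) unfolding s1_def by auto
  have r1: "runs body1 s (time_factor body1 * W) s1"
    unfolding s1_def by (rule runs_loop_free) (use rd W1 in \<open>auto simp: body1_def loop_free_seqn\<close>)
  have b1: "bounded_state W s1"
    unfolding bounded_state_def
  proof
    fix r
    consider "r < B" | "r = rCnt" | "r = rI" | j where "j < K" "r = rW j" | "B \<le> r" "r \<notin> {rCnt, rI} \<union> rW ` {..<K}"
      by fastforce
    then show "list_size (s1 r) \<le> W"
    proof cases
      case 2
      have "int_size (int N) \<le> int_size (int (Suc N))" by (rule int_size_mono) simp
      then show ?thesis using 2 s1(1) bounded_stateD[OF rd(9), of rCnt] cnt by simp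
    next
      case 3
      then show ?thesis using s1(4) int_size_int_le[of n] nW by simp
    next
      case (4 j)
      then show ?thesis using s1(3) rd(5) bounded_stateD[OF rd(9), of "rV j"] by simp
    qed (use s1 bounded_stateD[OF rd(9), of r] in auto)
  qed
  have c: "s1 rX = []" "s1 rT = [int t]" "s1 0 = []" using s1(5)[of rX] s1(5)[of rT] s1(2)[OF B] rd by simp_all
  obtain s2 where s2: "runs (While (Less (Const 0) (Top rI)) caps_body) s1 (caps_time W) s2" "s2 rI = [0]"
    "s2 0 = cap_list n t fs N" "\<And>r. r \<notin> {0, rI} \<union> rW ` {..<K} \<Longrightarrow> s2 r = s1 r" "bounded_state W s2"
    using runs_caps[OF s1(4) c(1,2) s1(1) c(3) s1(3) fs b1 W1 nt] nW by (metis add_leD1)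
  have s2': "s2 r = s r" if "B \<le> r" "r \<notin> {rCnt, rI} \<union> rW ` {..<K}" for r
    using s2(4)[of r] s1(5)[OF that] that B by auto
  have s2z: "s2 r = []" if "0 < r" "r < B" for r using s2(4)[of r] s1(2)[of r] that by auto
  define s3 where "s3 = lf_state body2 s2"
  have s3: "s3 = s2(0 := int t # cap_list n t fs N, rTmp := rev pre)"
    using s2' rd s2(3) B by (auto simp: s3_def body2_def)
  have r3: "runs body2 s2 (time_factor body2 * W) s3"
    unfolding s3_def by (rule runs_loop_free) (use s2(5) W1 in \<open>auto simp: body2_def\<close>)
  define inp where "inp = pre @ int t # cap_list n t fs N"
  have cap_sz: "list_size (cap_list n t fs N) \<le> n * (t + 1)"
    using fs(2) by (rule list_size_cap_list)
  have inp_sz: "list_size inp \<le> list_size pre + (n * (t + 1) + (t + 1))"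
    using cap_sz int_size_int_le[of t] by (simp add: inp_def)
  have b3: "bounded_state W s3"
    unfolding s3 by (intro bounded_state_upd s2(5)) (use inp_sz W_split in \<open>auto simp: inp_def\<close>)
  obtain s4 where s4: "runs (move_all rTmp 0) s3 (move_all_time rTmp 0 W) s4" "s4 rTmp = []" "s4 0 = inp"
    "\<And>r. r \<notin> {rTmp, 0} \<Longrightarrow> s4 r = s3 r"
    using runs_move_all[OF _ b3 W1, of rTmp 0] by (auto simp: s3 inp_def)
  obtain out where out: "outputs_within p inp Tp out" "Res N out" using sub[OF N] unfolding inp_def by blast
  have "s4 r = []" if "0 < r" "r < B" for r using s4(4)[of r] s2z[OF that] that by (simp add: s3)
  from outputs_within_call[of p inp Tp out B s4, OF out(1) p_regs B s4(3) this] obtain s5 where s5: "runs p s4 Tp s5" "s5 0 = out"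
    "\<And>r. B \<le> r \<Longrightarrow> s5 r = s4 r" "\<And>r. r < B \<Longrightarrow> list_size (s5 r) \<le> list_size inp + Tp" by blast
  define s6 where "s6 = lf_state (Copy rSol 0) s5"
  have s6: "s6 = s5(rSol := out)" by (simp add: s6_def s5(2))
  \<comment> \<open>Whatever \<open>p\<close> leaves behind has at most this size, and its registers
    are cleared at the start of the next round; hence sizes do not accumulate over the
    rounds.\<close>
  have inpW: "list_size inp + Tp \<le> W" using inp_sz W_split by linarith
  have b5: "bounded_state W s5"
    unfolding bounded_state_def
  proof
    fix r
    consider "r < B" | "B \<le> r" "r = rTmp" | "B \<le> r" "r \<noteq> rTmp" by linarith
    then show "list_size (s5 r) \<le> W"
      using s5(3)[of r] s5(4)[of r] inpW s4(2) s4(4)[of r] bounded_stateD[OF b3, of r] B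
      by cases auto
  qed
  have r6: "runs (Copy rSol 0) s5 (time_factor (Copy rSol 0) * W) s6"
    unfolding s6_def by (rule runs_loop_free) (use b5 W1 in auto)
  have out_sz: "list_size out \<le> list_size inp + Tp" using s5(4)[OF B] s5(2) by simp
  have b6: "bounded_state W s6"
    unfolding s6 by (intro bounded_state_upd b5) (use out_sz inpW in simp)
  have s6': "s6 r = s r" if "B \<le> r" "r \<notin> {rCnt, rI, rTmp, rSol} \<union> rW ` {..<K}" for r
    using s5(3)[OF that(1)] s4(4)[of r] s2'[of r] that B by (auto simp: s6 s3)
  have s6f: "s6 0 = out" "s6 rSol = out" "s6 rTmp = []" "s6 rCnt = [int N]"
    using s5(2) s5(3)[of rTmp] s5(3)[of rCnt] s4(2) s4(4)[of rCnt] s2(4)[of rCnt] s1(1) B by (auto simp: s6 s3)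
  have ready6: "ready s6"
    using s6' s6f(3) rd b6 by (auto simp: ready_def)
  have best6: "s6 rBest = s rBest" "s6 rBestNum = [bn]" "s6 rBestDen = [bd]" using s6' bs by simp_all
  have "\<exists>s'. runs (Cond (Less (Const 0) (Top 0)) eval_prog Skip) s6
      (1 + bcost_factor (Less (Const 0) (Top 0)) * W + (eval_time W + 1)) s' \<and>
      ready s' \<and> s' rCnt = [int N] \<and> best (insert N D) s'"
    using Res[OF N out(2)]
  proof
    assume o: "out = [0]"
    have "runs Skip s6 (eval_time W + 1) s6" unfolding runs_def using exec.Skip[of s6] by auto
    then have "runs (Cond (Less (Const 0) (Top 0)) eval_prog Skip) s6
        (1 + bcost_factor (Less (Const 0) (Top 0)) * W + (eval_time W + 1)) s6"
      using o s6f(1) by (intro runs_Cond[OF b6 W1]) auto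
    moreover have "best (insert N D) s6"
      using best_infeasible[OF best] out(2) o best6 bs by simp
    ultimately show ?thesis using ready6 s6f(4) by blast
  next
    assume "\<exists>qs. out = 1 # flat qs \<and> length qs + K = length ps \<and> (\<forall>(a, b)\<in>set qs. 0 < b)"
    then obtain qs where o: "out = 1 # flat qs" and len: "length qs + K = length ps"
      and qpos: "\<forall>(a, b)\<in>set qs. 0 < b" by blast
    have pos: "\<forall>(n, d)\<in>set ps \<union> set qs. 0 < d" using ps_pos qpos by auto
    have rd6: "s6 rA = flat_swap (rev ps)" "s6 rT = [int t]" "s6 rX = []" "s6 rEmpty = []"
      using ready6 by (simp_all add: ready_def)
    have "list_size (s6 rA) = list_size (flat ps)"
      by (simp add: rd6 rev_flat[symmetric])
    then have szA: "list_size (s6 rA) + list_size (s6 0) + 2 * K * (t + 1) + 2 \<le> W"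
      using out_sz inp_sz W_split s6f(1) by simp
    have so: "s6 0 = 1 # flat qs" "s6 rSol = 1 # flat qs" using s6f o by simp_all
    obtain s7 a b where s7: "runs eval_prog s6 (eval_time W) s7" "0 < b"
      "real_of_int a / real_of_int b = dot_value ps (qs @ grid_weights t N)"
      "a * bd < bn * b \<longrightarrow> s7 rBest = 1 # flat qs \<and> s7 rBestNum = [a] \<and> s7 rBestDen = [b]"
      "\<not> a * bd < bn * b \<longrightarrow> s7 rBest = s6 rBest \<and> s7 rBestNum = [bn] \<and> s7 rBestDen = [bd]"
      "\<forall>r. r \<notin> {0, rL, rR, rNum, rDen, rBest, rBestNum, rBestDen} \<longrightarrow> s7 r = s6 r" "bounded_state W s7"
      by (rule runs_eval[OF so rd6(1,2) s6f(4) rd6(3,4) best6(2,3) len pos t b6 szA])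
    have "runs (Cond (Less (Const 0) (Top 0)) eval_prog Skip) s6
        (1 + bcost_factor (Less (Const 0) (Top 0)) * W + (eval_time W + 1)) s7"
      by (rule runs_Cond[OF b6 W1]) (use so runs_mono[OF s7(1)] in auto)
    moreover have "ready s7" using ready6 s7(6,7) B by (simp add: ready_def)
    moreover have "s7 rCnt = [int N]" using s7(6)[rule_format, of rCnt] s6f(4) B by simp
    moreover have "best (insert N D) s7"
      using out(2) s7(4,5) best6(1) unfolding o by (intro best_eval[OF best N _ bs s7(2,3)]) auto
    ultimately show ?thesis by blast
  qed
  then obtain s7 where s7: "runs (Cond (Less (Const 0) (Top 0)) eval_prog Skip) s6
      (1 + bcost_factor (Less (Const 0) (Top 0)) * W + (eval_time W + 1)) s7"
      "ready s7" "s7 rCnt = [int N]" "best (insert N D) s7" by blast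
  have "runs body_prog s (body_time W Tp) s7"
    unfolding body_prog_def body_time_def
    by (intro runs_Seq[OF r1] runs_Seq[OF s2(1)] runs_Seq[OF r3] runs_Seq[OF s4(1)] runs_Seq[OF s5(1)] runs_Seq[OF r6] s7(1))
  with s7(2-4) show ?thesis by blast
qed

lemma runs_search:
  assumes "ready s" "s rCnt = [int ((t + 1) ^ K)]" "s rBestNum = [1]" "s rBestDen = [0]" "s rBest = [0]"
  shows "\<exists>s'. runs (While (Less (Const 0) (Top rCnt)) body_prog) s
     (loop_time (Less (Const 0) (Top rCnt)) W (body_time W Tp) ((t + 1) ^ K)) s' \<and>
     ready s' \<and> best {..<(t + 1) ^ K} s'"
proof -
  \<comment> \<open>The index counts down: with \<open>k\<close> rounds left, exactly the grid
    points from \<open>k\<close> on have been treated.\<close>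
  define Inv where "Inv k s' \<longleftrightarrow> ready s' \<and> s' rCnt = [int k] \<and> best {k..<(t + 1) ^ K} s'" for k and s' :: state
  have "\<exists>s'. runs (While (Less (Const 0) (Top rCnt)) body_prog) s
     (loop_time (Less (Const 0) (Top rCnt)) W (body_time W Tp) ((t + 1) ^ K)) s' \<and> Inv 0 s'"
  proof (rule runs_While)
    show "1 \<le> W" using W by linarith
    show "bounded_state W s'" if inv: "Inv k s'" for k s' using inv by (simp add: Inv_def ready_def)
    show "bval (Less (Const 0) (Top rCnt)) s' \<and> (\<exists>s''. runs body_prog s' (body_time W Tp) s'' \<and> Inv k s'')"
      if k: "k < (t + 1) ^ K" and inv: "Inv (Suc k) s'" for k s'
    proof -
      have ins: "insert k {Suc k..<(t + 1) ^ K} = {k..<(t + 1) ^ K}" using k by auto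
      show ?thesis
        using runs_body[of s' k "{Suc k..<(t + 1) ^ K}"] inv k unfolding Inv_def ins by auto
    qed
    show "\<not> bval (Less (Const 0) (Top rCnt)) s'" if inv: "Inv 0 s'" for s' using inv by (simp add: Inv_def)
    show "Inv ((t + 1) ^ K) s" using assms by (simp add: Inv_def best_def)
  qed
  then show ?thesis by (auto simp: Inv_def lessThan_atLeast0)
qed

end

section \<open>Reading the input and fixing the grid\<close>

context grid_program
begin

definition load_body :: "nat \<Rightarrow> prog" where
  "load_body j = Seq (assign rI (Top rN)) (move_n 0 (rV j))"

definition load_time :: "nat \<Rightarrow> nat \<Rightarrow> nat" where
  "load_time W k = 1 + k * (time_factor (assign rI (Top rN)) * W + move_n_time W)"

lemma runs_load:
  assumes "s 0 = concat (map fs [0..<k]) @ rest" "s rN = [int n]" "s rX = []" "\<And>j. j < k \<Longrightarrow> s (rV j) = []"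
    "\<And>j. j < k \<Longrightarrow> length (fs j) = n" "bounded_state W s" "1 \<le> W"
  shows "\<exists>s'. runs (seqn load_body k) s (load_time W k) s' \<and> s' 0 = rest \<and>
    (\<forall>j<k. s' (rV j) = rev (fs j)) \<and> (\<forall>r. r \<notin> {0, rI} \<union> rV ` {..<k} \<longrightarrow> s' r = s r) \<and> bounded_state W s'"
  using assms(1,4,5)
proof (induction k arbitrary: rest)
  case 0
  have "runs Skip s (load_time W 0) s" unfolding runs_def load_time_def using exec.Skip[of s] by auto
  then show ?case using 0 assms(6) by auto
next
  case (Suc k)
  have W: "bounded_state W s" "1 \<le> W" by fact+
  have "s 0 = concat (map fs [0..<k]) @ (fs k @ rest)" using Suc.prems(1) by simp
  from Suc.IH[OF this] Suc.prems(2,3) obtain s1 where s1: "runs (seqn load_body k) s (load_time W k) s1"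
    "s1 0 = fs k @ rest" "\<And>j. j < k \<Longrightarrow> s1 (rV j) = rev (fs j)"
    "\<And>r. r \<notin> {0, rI} \<union> rV ` {..<k} \<Longrightarrow> s1 r = s r" "bounded_state W s1" by auto
  have regs: "s1 rN = [int n]" "s1 rX = []" "s1 (rV k) = []"
    using s1(4)[of rN] s1(4)[of rX] s1(4)[of "rV k"] assms(2,3) Suc.prems(2)[of k] B by auto
  define s2 where "s2 = s1(rI := [int n])"
  have "lf_state (assign rI (Top rN)) s1 = s2" using regs by (simp add: assign_state s2_def)
  then have r2: "runs (assign rI (Top rN)) s1 (time_factor (assign rI (Top rN)) * W) s2"
    using runs_loop_free[OF loop_free_assign s1(5) W(2), of rI "Top rN"] by simp
  have b2: "bounded_state W s2"
    unfolding s2_def using bounded_stateD[OF s1(5), of rN] regs(1) by (intro bounded_state_upd s1(5)) simp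
  define s3 where "s3 = s2(rI := [0], 0 := rest, rV k := rev (fs k))"
  have lk: "length (fs k) = n" using Suc.prems(3)[of k] by simp
  have "runs (move_n 0 (rV k)) s2 (move_n_time W) s3"
    using runs_move_n[of s2 n 0 "rV k", OF _ _ _ _ _ _ _ _ b2 W(2)] regs s1(2) lk B
    by (simp add: s2_def s3_def)
  then have "runs (load_body k) s1 (time_factor (assign rI (Top rN)) * W + move_n_time W) s3"
    unfolding load_body_def by (rule runs_Seq[OF r2])
  from runs_Seq[OF s1(1) this] have "runs (seqn load_body (Suc k)) s (load_time W (Suc k)) s3"
    by (simp add: load_time_def add_ac)
  moreover have "bounded_state W s3"
    unfolding s3_def using bounded_stateD[OF b2, of 0] s1(2) W(2) B int_size_le_abs[of 0]
    by (intro bounded_state_upd b2) (auto simp: s2_def)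
  moreover have "s3 (rV j) = rev (fs j)" if "j < Suc k" for j
    using s1(3)[of j] that by (auto simp: s3_def s2_def less_Suc_eq)
  moreover have "s3 r = s r" if "r \<notin> {0, rI} \<union> rV ` {..<Suc k}" for r
    using s1(4)[of r] that by (auto simp: s3_def s2_def lessThan_Suc)
  moreover have "s3 0 = rest" by (simp add: s3_def)
  ultimately show ?case by blast
qed

text \<open>The input has no separators, so block lengths are computed: the system consists of
  \<open>m * n + m\<close> fractions with two integers each.\<close>

definition setup1 :: prog where
  "setup1 = Seq (Push rM (Top 0)) (Seq (Push rPre (Top 0)) (Seq (Pop 0) (Seq (Push rN (Top 0))
     (Seq (Push rPre (Top 0)) (Seq (Pop 0) (assign rI (Mul (Const 2) (Add (Mul (Top rM) (Top rN)) (Top rM)))))))))"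

text \<open>The \<open>4 * n\<close> integers of \<open>C\<close> and \<open>c\<close> are needed
  both in \<open>rPre\<close> and in \<open>rA\<close>. As moving consumes its source,
  \<open>rA\<close> is served from the copy \<open>rTmp\<close> and \<open>rPre\<close> from
  register 0.\<close>

definition setup2 :: prog where
  "setup2 = Seq (Copy rTmp 0) (assign rI (Mul (Const 4) (Top rN)))"

definition setup3 :: prog where
  "setup3 = Seq (Copy rTmp rEmpty) (assign rI (Mul (Const 4) (Top rN)))"

definition setup4 :: prog where
  "setup4 = assign rI (Const (2 * int K))"

text \<open>The ceiling of \<open>1 / \<epsilon>\<close> is computed as \<open>- ((- den) div num)\<close>.\<close>

definition setup5 :: prog where
  "setup5 = Seq (Push rX1 (Top 0)) (Seq (Pop 0) (Seq (assign rX2 (Sub (Const 0) (Div (Sub (Const 0) (Top 0)) (Top rX1))))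
     (Seq (assign rT (Mul (Mul (Const (9 * (int K + 1))) (Add (Top rN) (Const 1))) (Mul (Top rX2) (Top rX2))))
     (Seq (assign rCnt (pow_aexp (Add (Top rT) (Const 1)) K))
     (Seq (assign rBestNum (Const 1)) (Seq (assign rBestDen (Const 0)) (assign rBest (Const 0))))))))"

definition setup_prog :: prog where
  "setup_prog = Seq setup1 (Seq (move_n 0 rPre) (Seq setup2 (Seq (move_n rTmp rA) (Seq setup3 (Seq (move_n 0 rPre)
     (Seq (seqn load_body K) (Seq setup4 (Seq (move_n 0 rA) setup5))))))))"

definition setup_time :: "nat \<Rightarrow> nat" where
  "setup_time W = time_factor setup1 * W + (move_n_time W + (time_factor setup2 * W + (move_n_time W +
     (time_factor setup3 * W + (move_n_time W + (load_time W K + (time_factor setup4 * W +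
     (move_n_time W + time_factor setup5 * W))))))))"

lemma runs_setup:
  fixes hg cc gam :: "int list" and fs :: "nat \<Rightarrow> int list" and num den :: int and m n e t W :: nat
  defines "inp \<equiv> [int m, int n] @ hg @ cc @ concat (map fs [0..<K]) @ gam @ [num, den]"
  assumes len: "length hg = 2 * (m * n + m)" "length cc = 4 * n" "\<And>j. j < K \<Longrightarrow> length (fs j) = n" "length gam = 2 * K"
    and e: "- ((- den) div num) = int e" and t: "t = 9 * (K + 1) * (n + 1) * e\<^sup>2"
    and W: "list_size inp + e + t + (t + 1) ^ K + 2 \<le> W"
  shows "\<exists>s'. runs setup_prog ((\<lambda>_. [])(0 := inp)) (setup_time W) s' \<and>
    s' rN = [int n] \<and> s' rT = [int t] \<and> s' rPre = rev ([int m, int n] @ hg @ cc) \<and> s' rA = rev (cc @ gam) \<and>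
    (\<forall>j<K. s' (rV j) = rev (fs j)) \<and> s' rEmpty = [] \<and> s' rX = [] \<and> s' rTmp = [] \<and> bounded_state W s' \<and>
    s' rCnt = [int ((t + 1) ^ K)] \<and> s' rBestNum = [1] \<and> s' rBestDen = [0] \<and> s' rBest = [0]"
proof -
  have W1: "1 \<le> W" using W by linarith
  define s :: state where "s = (\<lambda>_. [])(0 := inp)"
  define us where "us = concat (map fs [0..<K])"
  define rest where "rest = us @ gam @ [num, den]"
  have inpW: "list_size inp + 2 \<le> W" using W by linarith
  have parts: "int_size (int m) + (int_size (int n) + (list_size hg + (list_size cc + list_size rest))) = list_size inp"
    by (simp add: inp_def rest_def us_def)
  have rest_sz: "list_size rest = list_size us + (list_size gam + (int_size num + int_size den))"
    by (simp add: rest_def)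
  have lenW: "length hg + 1 \<le> W" "length cc + 1 \<le> W" "length gam + 1 \<le> W"
    using length_le_list_size[of hg] length_le_list_size[of cc] length_le_list_size[of gam] parts rest_sz inpW
    by linarith+
  have z0: "int_size 0 \<le> W" using int_size_le_abs[of 0] W1 by simp
  have b0: "bounded_state W s" using inpW by (simp add: s_def bounded_state_def)

  define s1 where "s1 = s(0 := hg @ cc @ rest, rM := [int m], rPre := [int n, int m], rN := [int n],
    rI := [int (2 * (m * n + m))])"
  have "lf_state setup1 s = s1"
    using B by (simp add: setup1_def assign_def s_def s1_def inp_def rest_def us_def fun_eq_iff algebra_simps)
  then have r1: "runs setup1 s (time_factor setup1 * W) s1"
    using runs_loop_free[of setup1 W s] b0 W1 by (simp add: setup1_def)
  have b1: "bounded_state W s1"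
    unfolding s1_def
    by (intro bounded_state_upd b0)
      (use parts inpW lenW int_size_int_le[of "2 * (m * n + m)"] len in \<open>simp_all\<close>)

  define s2 where "s2 = s1(rI := [0], 0 := cc @ rest, rPre := rev ([int m, int n] @ hg))"
  have r2: "runs (move_n 0 rPre) s1 (move_n_time W) s2"
    using runs_move_n[of s1 "length hg" 0 rPre, OF _ _ _ _ _ _ _ _ b1 W1] len B
    by (simp add: s1_def s2_def s_def)
  have b2: "bounded_state W s2"
    unfolding s2_def by (intro bounded_state_upd b1) (use parts inpW z0 in simp_all)

  define s3 where "s3 = s2(rTmp := cc @ rest, rI := [int (4 * n)])"
  have "lf_state setup2 s2 = s3"
    using B by (simp add: setup2_def assign_def s2_def s3_def s1_def s_def fun_eq_iff)
  then have r3: "runs setup2 s2 (time_factor setup2 * W) s3"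
    using runs_loop_free[of setup2 W s2] b2 W1 by (simp add: setup2_def)
  have b3: "bounded_state W s3"
    unfolding s3_def by (intro bounded_state_upd b2) (use parts inpW lenW int_size_int_le[of "4 * n"] len in simp_all)

  define s4 where "s4 = s3(rI := [0], rTmp := rest, rA := rev cc)"
  have r4: "runs (move_n rTmp rA) s3 (move_n_time W) s4"
    using runs_move_n[of s3 "4 * n" rTmp rA, OF _ _ _ _ _ _ _ _ b3 W1] len B
    by (simp add: s4_def s3_def s2_def s1_def s_def)
  have b4: "bounded_state W s4"
    unfolding s4_def by (intro bounded_state_upd b3) (use parts inpW z0 in simp_all)

  define s5 where "s5 = s4(rTmp := [], rI := [int (4 * n)])"
  have "lf_state setup3 s4 = s5"
    using B by (simp add: setup3_def assign_def s5_def s4_def s3_def s2_def s1_def s_def fun_eq_iff)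
  then have r5: "runs setup3 s4 (time_factor setup3 * W) s5"
    using runs_loop_free[of setup3 W s4] b4 W1 by (simp add: setup3_def)
  have b5: "bounded_state W s5"
    unfolding s5_def by (intro bounded_state_upd b4) (use parts inpW lenW int_size_int_le[of "4 * n"] len in simp_all)

  define s6 where "s6 = s5(rI := [0], 0 := rest, rPre := rev ([int m, int n] @ hg @ cc))"
  have r6: "runs (move_n 0 rPre) s5 (move_n_time W) s6"
    using runs_move_n[of s5 "4 * n" 0 rPre, OF _ _ _ _ _ _ _ _ b5 W1] len B
    by (simp add: s6_def s5_def s4_def s3_def s2_def s1_def s_def)
  have b6: "bounded_state W s6"
    unfolding s6_def by (intro bounded_state_upd b5) (use parts inpW z0 in simp_all)
  have s6v: "s6 r = (if r = 0 then rest else if r = rM then [int m] else if r = rPre then rev ([int m, int n] @ hg @ cc)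
    else if r = rN then [int n] else if r = rI then [0] else if r = rA then rev cc else [])" for r
    using B by (simp add: s6_def s5_def s4_def s3_def s2_def s1_def s_def)

  obtain s7 where s7: "runs (seqn load_body K) s6 (load_time W K) s7" "s7 0 = gam @ [num, den]"
    "\<And>j. j < K \<Longrightarrow> s7 (rV j) = rev (fs j)" "\<And>r. r \<notin> {0, rI} \<union> rV ` {..<K} \<Longrightarrow> s7 r = s6 r" "bounded_state W s7"
    using runs_load[of s6 fs K "gam @ [num, den]" n W] b6 W1 len(3) B by (auto simp: s6v rest_def us_def)
  have s7v: "s7 rN = [int n]" "s7 rX = []" "s7 rEmpty = []" "s7 rTmp = []" "s7 rA = rev cc"
    "s7 rPre = rev ([int m, int n] @ hg @ cc)"
    using s7(4) B by (simp_all add: s6v)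

  define s8 where "s8 = s7(rI := [int (2 * K)])"
  have "lf_state setup4 s7 = s8" using s7v by (simp add: setup4_def assign_state s8_def)
  then have r8: "runs setup4 s7 (time_factor setup4 * W) s8"
    using runs_loop_free[of setup4 W s7] s7(5) W1 by (simp add: setup4_def)
  have b8: "bounded_state W s8"
    unfolding s8_def by (intro bounded_state_upd s7(5)) (use lenW int_size_int_le[of "2 * K"] len in simp)

  define s9 where "s9 = s8(rI := [0], 0 := [num, den], rA := rev gam @ rev cc)"
  have r9: "runs (move_n 0 rA) s8 (move_n_time W) s9"
    using runs_move_n[of s8 "2 * K" 0 rA, OF _ _ _ _ _ _ _ _ b8 W1] len B s7(2) s7v
    by (simp add: s9_def s8_def)
  have b9: "bounded_state W s9"
    unfolding s9_def by (intro bounded_state_upd b8) (use parts rest_sz inpW z0 in simp_all)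
  have s9v: "s9 rN = [int n]" "s9 rX = []" "s9 0 = [num, den]" using s7v B by (simp_all add: s9_def s8_def)

  define s10 where "s10 = s9(rX1 := num # s9 rX1, 0 := [den], rX2 := [int e], rT := [int t], rCnt := [int ((t + 1) ^ K)],
    rBestNum := [1], rBestDen := [0], rBest := [0])"
  have tt: "9 * (int K + 1) * (int n + 1) * (int e * int e) = int t"
    by (simp add: t power2_eq_square algebra_simps)
  have "lf_state setup5 s9 = s10"
    using B s9v e tt by (simp add: setup5_def assign_state s10_def fun_eq_iff add.commute)
  then have r10: "runs setup5 s9 (time_factor setup5 * W) s10"
    using runs_loop_free[of setup5 W s9] b9 W1 by (simp add: setup5_def)
  have X1: "s9 rX1 = []" using s7(4)[of rX1] B by (simp add: s9_def s8_def s6v)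
  \<comment> \<open>The bound \<open>W\<close> dominates even the values of \<open>e\<close>,
    \<open>t\<close> and \<open>(t + 1) ^ K\<close>, hence their lengths.\<close>
  have b10: "bounded_state W s10"
    unfolding s10_def X1
    by (intro bounded_state_upd b9)
      (use parts rest_sz inpW z0 W int_size_int_le[of e] int_size_int_le[of t] int_size_int_le[of "(t + 1) ^ K"]
         int_size_le_abs[of 1] in \<open>simp_all\<close>)
  have "runs setup_prog s (setup_time W) s10"
    unfolding setup_prog_def setup_time_def
    by (intro runs_Seq[OF r1] runs_Seq[OF r2] runs_Seq[OF r3] runs_Seq[OF r4] runs_Seq[OF r5] runs_Seq[OF r6]
        runs_Seq[OF s7(1)] runs_Seq[OF r8] runs_Seq[OF r9] r10)
  moreover have "s10 (rV j) = rev (fs j)" if "j < K" for j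
    using s7(3)[OF that] B by (simp add: s10_def s9_def s8_def)
  ultimately show ?thesis
    unfolding s_def[symmetric] using s7v b10 B
    by (intro exI[of _ s10]) (simp add: s10_def s9_def s8_def)
qed


section \<open>The complete program and its running time\<close>

definition search_prog :: prog where
  "search_prog = Seq setup_prog (Seq (While (Less (Const 0) (Top rCnt)) body_prog) (Copy 0 rBest))"

definition search_time :: "nat \<Rightarrow> nat \<Rightarrow> nat \<Rightarrow> nat" where
  "search_time W Tp m = setup_time W + (loop_time (Less (Const 0) (Top rCnt)) W (body_time W Tp) m +
     time_factor (Copy 0 rBest) * W)"

text \<open>All time and cost factors are constants of the program text, so the running time is a
  polynomial expression in \<open>W\<close>, \<open>Tp\<close> and the number of rounds.\<close>

lemma poly_fun_search_time:
  assumes "poly_fun W" "poly_fun Tp" "poly_fun m"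
  shows "poly_fun (\<lambda>x. search_time (W x) (Tp x) (m x))"
  unfolding search_time_def setup_time_def load_time_def move_n_time_def loop_time_def body_time_def
    caps_time_def move_all_time_def eval_time_def dot_time_def
  by (intro poly_fun_intros assms)

lemma search_time_mono: "m \<le> m' \<Longrightarrow> search_time W Tp m \<le> search_time W Tp m'"
  unfolding search_time_def by (intro add_mono loop_time_mono) auto

end

section \<open>Encodings and inner products of rational vectors\<close>

lemma dot_value_sum:
  "length ps = length qs \<Longrightarrow> dot_value ps qs = (\<Sum>i<length ps.
     (of_int (fst (ps ! i)) / of_int (snd (ps ! i))) * (of_int (fst (qs ! i)) / of_int (snd (qs ! i))))"
  by (induction ps qs rule: dot_value.induct) (auto simp: sum.lessThan_Suc_shift simp del: sum.lessThan_Suc)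

lemma flat_inject: "flat ps = flat qs \<Longrightarrow> ps = qs"
proof (induction ps arbitrary: qs)
  case Nil
  then show ?case by (cases qs) auto
next
  case (Cons a ps)
  then show ?case by (cases a; cases qs) auto
qed

definition quotients :: "rat vec \<Rightarrow> (int \<times> int) list" where
  "quotients v = map quotient_of (list_of_vec v)"

lemma enc_vec_flat: "enc_vec v = flat (quotients v)"
  by (auto simp: enc_vec_def quotients_def flat_def enc_rat_def comp_def case_prod_beta
      intro!: arg_cong[of _ _ concat] map_cong)

lemma length_quotients [simp]: "length (quotients v) = dim_vec v"
  by (simp add: quotients_def)

lemma quotients_pos: "\<forall>(a, b)\<in>set (quotients v). 0 < b"
  by (auto simp: quotients_def quotient_of_denom_pos)

lemma list_of_vec_nth: "i < dim_vec v \<Longrightarrow> list_of_vec v ! i = v $ i"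
  by (simp add: list_of_vec_index)

lemma quotients_nth:
  assumes "i < dim_vec v"
  shows "real_of_int (fst (quotients v ! i)) / real_of_int (snd (quotients v ! i)) = real_of_rat (v $ i)"
proof -
  have "v $ i = of_int (fst (quotient_of (v $ i))) / of_int (snd (quotient_of (v $ i)))"
    by (rule quotient_of_div) simp
  then have "real_of_rat (v $ i) =
    real_of_rat (of_int (fst (quotient_of (v $ i))) / of_int (snd (quotient_of (v $ i))))" by simp
  then show ?thesis using assms by (simp add: quotients_def list_of_vec_nth of_rat_divide)
qed

lemma dot_value_quotients:
  assumes "dim_vec v = dim_vec w"
  shows "dot_value (quotients v) (quotients w) = real_vec v \<bullet> real_vec w"
  using assms by (simp add: dot_value_sum quotients_nth scalar_prod_def atLeast0LessThan)

lemma enc_solution_Some: "enc_solution (Some (x, y)) = 1 # flat (quotients x @ quotients y)"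
  by (simp add: enc_vec_flat)

lemma length_enc_vec: "length (enc_vec v) = 2 * dim_vec v"
  by (simp add: enc_vec_flat)

lemma length_enc_system:
  assumes "g \<in> carrier_vec (dim_row H)"
  shows "length (concat (map enc_vec (rows H)) @ enc_vec g) = 2 * (dim_row H * dim_col H + dim_row H)"
proof -
  have "length (concat (map enc_vec (rows H))) = sum_list (map (\<lambda>v. 2 * dim_vec v) (rows H))"
    by (simp add: length_concat comp_def length_enc_vec)
  also have "\<dots> = sum_list (map (\<lambda>v. 2 * dim_col H) (rows H))"
    by (intro arg_cong[of _ _ sum_list] map_cong) (auto simp: rows_def)
  also have "\<dots> = 2 * (dim_row H * dim_col H)" by (simp add: sum_list_triv)
  finally show ?thesis using assms by (simp add: length_enc_vec)
qed

lemma real_vec_nonneg: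
  assumes "v \<in> carrier_vec n" "0\<^sub>v n \<le> v"
  shows "real_vec v \<in> carrier_vec n" "0\<^sub>v n \<le> real_vec v"
proof -
  have d: "dim_vec v = n" using assms(1) by simp
  then show "real_vec v \<in> carrier_vec n" by (intro carrier_vecI) simp
  show "0\<^sub>v n \<le> real_vec v" using assms(2) d by (simp add: less_eq_vec_def)
qed

text \<open>The list built by the machine is the encoding of the caps, so \<open>p\<close> receives
  a proper subproblem instance; multiplying by a 0-1 entry replaces the membership test.\<close>

lemma (in grid_program) cap_list_eq:
  assumes "length Us = K"
  shows "cap_list n t (\<lambda>j. enc_subset n (Us ! j)) N = map int (list_of_vec (grid_caps n t Us N))"
proof -
  have "(\<Sum>j<K. enc_subset n (Us ! j) ! i * int (digit t N j)) = int (\<Sum>j<K. if i \<in> Us ! j then digit t N j else 0)"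
    if "i < n" for i
    using that by (auto simp: enc_subset_def intro!: sum.cong)
  then have "map (\<lambda>i. min (int t) (\<Sum>j<K. enc_subset n (Us ! j) ! i * int (digit t N j))) [0..<n] =
    map (\<lambda>i. int (min t (\<Sum>j<K. if i \<in> Us ! j then digit t N j else 0))) [0..<n]"
    by (intro map_cong) (auto simp: of_nat_min)
  then show ?thesis
    unfolding cap_list_def using assms
    by (simp add: grid_caps_def list_of_vec_vec comp_def)
qed

lemma outputs_within_mono: "outputs_within p inp T out \<Longrightarrow> T \<le> T' \<Longrightarrow> outputs_within p inp T' out"
  unfolding outputs_within_def using order_trans by blast

section \<open>Polynomial budgets and correctness of answers\<close>

definition fineness :: "nat \<Rightarrow> nat \<Rightarrow> nat" where
  "fineness K x = 9 * (K + 1) * (x + 1) * x\<^sup>2"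

text \<open>The parameter \<open>x\<close> stands for the input size plus the ceiling of
  \<open>1 / \<epsilon>\<close>; it dominates both \<open>n\<close> and \<open>e\<close>, so
  \<open>fineness K x\<close> dominates \<open>t\<close>. The argument of \<open>q\<close> bounds
  the size of any subproblem instance plus \<open>t\<close>.\<close>

definition sub_budget :: "nat \<Rightarrow> nat poly \<Rightarrow> nat \<Rightarrow> nat" where
  "sub_budget K q x = poly q (x + (x + 1) * (fineness K x + 1) + fineness K x)"

text \<open>The part up to the summand 2 covers the search; the parenthesized rest covers the input
  and \<open>e\<close>, \<open>t\<close> and the number of grid points written during setup.\<close>

definition size_budget :: "nat \<Rightarrow> nat poly \<Rightarrow> nat \<Rightarrow> nat" where
  "size_budget K q x = 2 * x + (x + 1 + 2 * K) * (fineness K x + 1) + sub_budget K q x + 2 +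
     (x + fineness K x + (fineness K x + 1) ^ K)"

text \<open>The correctness clauses of the hypothesis and of the conclusion are named, here and in
  \<open>approx_answer\<close>, so that each can be passed on as one predicate.\<close>

definition sub_answer :: "rat mat \<Rightarrow> rat vec \<Rightarrow> rat vec \<Rightarrow> rat vec \<Rightarrow> nat \<Rightarrow> nat vec \<Rightarrow> (rat vec \<times> rat vec) option \<Rightarrow> bool" where
  "sub_answer H g C c t k sol \<longleftrightarrow>
     (let d = vec (dim_col H) (\<lambda>i. real (k $ i) / real t)
      in case sol of
        None \<Rightarrow> sub_feasible (real_mat H) (real_vec g) d = {}
      | Some (x, y) \<Rightarrow> sub_optimal (real_mat H) (real_vec g) (real_vec C) (real_vec c) d (real_vec x, real_vec y))"

definition approx_answer :: "rat mat \<Rightarrow> rat vec \<Rightarrow> rat vec \<Rightarrow> real vec set \<Rightarrow> rat \<Rightarrow> (rat vec \<times> rat vec) option \<Rightarrow> bool" where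
  "approx_answer H g C U \<epsilon> sol \<longleftrightarrow>
     (case sol of
        None \<Rightarrow> first_stage_set (real_mat H) (real_vec g) = {}
      | Some (x, y) \<Rightarrow>
          real_vec x \<in> first_stage_set (real_mat H) (real_vec g) \<and>
          real_vec y \<in> recourse_set (real_mat H) (real_vec g) (real_vec x) \<and>
          worst_case_cost (real_vec C) U (real_vec x) (real_vec y)
            \<le> (1 + real_of_rat \<epsilon>) * MM_value (real_mat H) (real_vec g) (real_vec C) U)"

lemma sub_answer_cases:
  assumes ans: "sub_answer H g C c t k sol" and dims: "dim_vec C = dim_col H" "dim_vec c = dim_col H"
  shows "enc_solution sol = [0] \<and> sol = None \<or> (\<exists>x y. sol = Some (x, y) \<and>
     enc_solution sol = 1 # flat (quotients x @ quotients y) \<and> dim_vec x = dim_col H \<and> dim_vec y = dim_col H \<and>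
     (real_vec x, real_vec y) \<in> sub_feasible (real_mat H) (real_vec g) (vec (dim_col H) (\<lambda>i. real (k $ i) / real t)))"
proof (cases sol)
  case (Some z)
  obtain x y where z: "z = (x, y)" by fastforce
  have "sub_optimal (real_mat H) (real_vec g) (real_vec C) (real_vec c) (vec (dim_col H) (\<lambda>i. real (k $ i) / real t))
      (real_vec x, real_vec y)"
    using ans by (simp add: sub_answer_def Some z)
  then have f: "(real_vec x, real_vec y) \<in> sub_feasible (real_mat H) (real_vec g) (vec (dim_col H) (\<lambda>i. real (k $ i) / real t))"
    by (simp add: sub_optimal_def is_arg_min_def)
  have "dim_vec x = dim_col H" "dim_vec y = dim_col H"
    using carrier_vecD[OF sub_feasible_bounds(2)[OF f]] carrier_vecD[OF sub_feasible_bounds(3)[OF f]] by simp_all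
  then show ?thesis using f Some z enc_solution_Some by auto
qed simp

section \<open>Correctness on a single instance\<close>

context grid_program
begin

text \<open>The value of the returned answer is the minimal grid cost. Weak duality puts the worst
  case of the answer below it, and the rounding argument puts it below \<open>1 + 1 / e\<close>
  times the optimum, where \<open>1 / e \<le> \<epsilon>\<close>.\<close>

lemma solves_instance:
  fixes H :: "rat mat" and g C c \<Gamma> :: "rat vec" and \<epsilon> :: rat and Us :: "nat set list" and x :: nat and q :: "nat poly"
  defines "n \<equiv> dim_col H" and "inp \<equiv> enc_MM_instance H g C c Us \<Gamma> \<epsilon>"
    and "U \<equiv> HP1_set (real_vec c) Us (real_vec \<Gamma>)"
  assumes g: "g \<in> carrier_vec (dim_row H)"
    and int: "integral_polyhedron n (box_polyhedron (real_mat H) (real_vec g))"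
    and C: "C \<in> carrier_vec n" "0\<^sub>v n \<le> C" and c: "c \<in> carrier_vec n" "0\<^sub>v n \<le> c"
    and \<Gamma>: "\<Gamma> \<in> carrier_vec K" "0\<^sub>v K \<le> \<Gamma>"
    and Us: "length Us = K" "\<And>j. j < K \<Longrightarrow> Us ! j \<subseteq> {..<n}"
    and \<epsilon>: "0 < \<epsilon>" and compact: "compact_vecs n U"
    and p: "\<And>t k. k \<in> carrier_vec n \<Longrightarrow> 1 \<le> t \<Longrightarrow> \<forall>i<n. k $ i \<le> t \<Longrightarrow>
      \<exists>sol. outputs_within p (enc_sub_instance H g C c t k) (poly q (list_size (enc_sub_instance H g C c t k) + t))
        (enc_solution sol) \<and> sub_answer H g C c t k sol"
    and x: "x = list_size inp + nat \<lceil>1 / \<epsilon>\<rceil>"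
  shows "\<exists>sol. outputs_within search_prog inp
      (search_time (size_budget K q x) (sub_budget K q x) ((fineness K x + 1) ^ K)) (enc_solution sol) \<and>
    approx_answer H g C U \<epsilon> sol"
proof -
  define m where "m = dim_row H"
  define e where "e = nat \<lceil>1 / \<epsilon>\<rceil>"
  define t where "t = 9 * (K + 1) * (n + 1) * e\<^sup>2"
  define hg where "hg = concat (map enc_vec (rows H)) @ enc_vec g"
  define cc where "cc = enc_vec C @ enc_vec c"
  define gam where "gam = enc_vec \<Gamma>"
  define fs where "fs = (\<lambda>j. enc_subset n (Us ! j))"
  define num where "num = fst (quotient_of \<epsilon>)"
  define den where "den = snd (quotient_of \<epsilon>)"
  define pre where "pre = [int m, int n] @ hg @ cc"
  define ps where "ps = quotients C @ quotients c @ quotients \<Gamma>"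
  define Res where "Res N out \<longleftrightarrow> (\<exists>sol. out = enc_solution sol \<and> sub_answer H g C c t (grid_caps n t Us N) sol)" for N out
  have dimCc: "dim_vec C = n" "dim_vec c = n" "dim_vec \<Gamma> = K" using C c \<Gamma> by auto
  have Hn: "dim_col (real_mat H) = n" by (simp add: n_def)

  have "\<epsilon> = of_int num / of_int den" unfolding num_def den_def by (rule quotient_of_div) simp
  moreover have "0 < den" using quotient_of_denom_pos'[of \<epsilon>] by (simp add: den_def)
  ultimately have "\<lceil>1 / \<epsilon>\<rceil> = - ((- den) div num)"
    using ceiling_divide_eq_div[of den num, where 'a = rat] by simp
  moreover have e_pos: "0 < \<lceil>1 / \<epsilon>\<rceil>" using \<epsilon> by simp
  ultimately have e_eq: "- ((- den) div num) = int e" by (simp add: e_def)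
  have e1: "1 \<le> e" using e_pos unfolding e_def by linarith
  have e_\<epsilon>: "1 / real e \<le> real_of_rat \<epsilon>"
  proof -
    have "1 / \<epsilon> \<le> of_int \<lceil>1 / \<epsilon>\<rceil>" by (rule le_of_int_ceiling)
    also have "\<dots> = of_nat e" using e_pos by (simp add: e_def)
    finally have "1 / \<epsilon> \<le> of_nat e" .
    then have "1 \<le> of_nat e * \<epsilon>" using \<epsilon> by (simp add: pos_divide_le_eq)
    then have "real_of_rat 1 \<le> real_of_rat (of_nat e * \<epsilon>)" by (simp only: of_rat_less_eq)
    then have "1 \<le> real e * real_of_rat \<epsilon>" by (simp add: of_rat_mult)
    then show ?thesis using e1 by (simp add: pos_divide_le_eq mult.commute)
  qed
  have t1: "1 \<le> t" using e1 by (simp add: t_def)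

  have inp: "inp = [int m, int n] @ hg @ cc @ concat (map fs [0..<K]) @ gam @ [num, den]"
  proof -
    have "map (enc_subset n) Us = map fs [0..<K]"
      using Us(1) by (intro nth_equalityI) (auto simp: fs_def)
    then show ?thesis
      by (simp add: inp_def enc_MM_instance_def enc_system_def hg_def cc_def gam_def enc_rat_def num_def den_def
          m_def n_def[symmetric])
  qed
  have len: "length hg = 2 * (m * n + m)" "length cc = 4 * n" "\<And>j. length (fs j) = n" "length gam = 2 * K"
    using length_enc_system[OF g] dimCc
    by (simp_all add: hg_def m_def n_def cc_def length_enc_vec fs_def enc_subset_def gam_def)
  have flat_ps: "flat ps = cc @ gam" by (simp add: ps_def cc_def gam_def enc_vec_flat)
  have inp_x: "list_size inp \<le> x" "e \<le> x" by (simp_all add: x e_def)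
  have n_x: "n \<le> x" using len(2) length_le_list_size[of cc] inp_x(1) by (simp add: inp)
  have pre_x: "list_size pre \<le> x" "list_size (flat ps) \<le> x"
    using inp_x(1) by (simp_all add: inp pre_def flat_ps)
  have t_x: "t \<le> fineness K x"
    unfolding t_def fineness_def using n_x inp_x(2) by (intro mult_le_mono power_mono) auto

  interpret I: HP1_instance n K "real_vec C" "real_vec c" "real_vec \<Gamma>" Us
    using real_vec_nonneg[OF C] real_vec_nonneg[OF c] real_vec_nonneg[OF \<Gamma>] Us compact
    by unfold_locales (auto simp: U_def)

  interpret S: grid_search B K p n t "sub_budget K q x" "size_budget K q x" pre ps fs Res
  proof unfold_locales
    show "0 < t" using t1 by simp
    show "\<forall>(a, b)\<in>set ps. 0 < b"
      using quotients_pos[of C] quotients_pos[of c] quotients_pos[of \<Gamma>] by (auto simp: ps_def)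
    show "length (fs j) = n" for j by (rule len(3))
    show "0 \<le> fs j ! i" if "i < n" for j i using that by (simp add: fs_def enc_subset_def)
    show "\<exists>out. outputs_within p (pre @ int t # cap_list n t fs N) (sub_budget K q x) out \<and> Res N out" for N
    proof -
      define k where "k = grid_caps n t Us N"
      have k: "k \<in> carrier_vec n" "\<forall>i<n. k $ i \<le> t" by (auto simp: k_def grid_caps_def)
      have eq: "enc_sub_instance H g C c t k = pre @ int t # cap_list n t fs N"
        unfolding enc_sub_instance_def fs_def cap_list_eq[OF Us(1)] k_def
        by (simp add: pre_def enc_system_def hg_def cc_def m_def n_def)
      have "list_size (cap_list n t fs N) \<le> n * (t + 1)"
        by (rule list_size_cap_list) (simp add: fs_def enc_subset_def)
      then have "list_size (enc_sub_instance H g C c t k) \<le> x + (n + 1) * (t + 1)"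
        using pre_x(1) int_size_int_le[of t] by (simp add: eq)
      also have "\<dots> \<le> x + (x + 1) * (fineness K x + 1)"
        using n_x t_x by (intro add_mono mult_le_mono) auto
      finally have "list_size (enc_sub_instance H g C c t k) + t \<le> x + (x + 1) * (fineness K x + 1) + fineness K x"
        using t_x by linarith
      then have "poly q (list_size (enc_sub_instance H g C c t k) + t) \<le> sub_budget K q x"
        unfolding sub_budget_def by (rule poly_nat_mono)
      moreover obtain sol where sol: "sub_answer H g C c t k sol"
        "outputs_within p (enc_sub_instance H g C c t k) (poly q (list_size (enc_sub_instance H g C c t k) + t)) (enc_solution sol)"
        using p[OF k(1) t1 k(2)] by blast
      ultimately have "outputs_within p (pre @ int t # cap_list n t fs N) (sub_budget K q x) (enc_solution sol)"
        using outputs_within_mono unfolding eq by blast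
      then show ?thesis using sol(1) unfolding Res_def k_def by blast
    qed
    show "out = [0] \<or> (\<exists>qs. out = 1 # flat qs \<and> length qs + K = length ps \<and> (\<forall>(a, b)\<in>set qs. 0 < b))"
      if r: "Res N out" for N out
    proof -
      obtain sol where sol: "out = enc_solution sol" "sub_answer H g C c t (grid_caps n t Us N) sol"
        using r by (auto simp: Res_def)
      from sub_answer_cases[OF sol(2) dimCc(1,2)[unfolded n_def]] show ?thesis
      proof (elim disjE exE conjE)
        fix x y assume o: "enc_solution sol = 1 # flat (quotients x @ quotients y)"
          "dim_vec x = dim_col H" "dim_vec y = dim_col H"
        have "\<forall>(a, b)\<in>set (quotients x @ quotients y). 0 < b"
          using quotients_pos[of x] quotients_pos[of y] by auto
        moreover have "length (quotients x @ quotients y) + K = length ps" using o dimCc by (simp add: ps_def n_def)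
        ultimately show ?thesis using sol(1) o(1) by blast
      qed (use sol in \<open>auto simp: n_def\<close>)
    qed
    have "(n + 1 + 2 * K) * (t + 1) \<le> (x + 1 + 2 * K) * (fineness K x + 1)"
      using n_x t_x by (intro mult_le_mono) auto
    then show "list_size pre + list_size (flat ps) + (n + 1 + 2 * K) * (t + 1) + sub_budget K q x + 2 \<le> size_budget K q x"
      using pre_x unfolding size_budget_def by linarith
  qed

  have tK: "(t + 1) ^ K \<le> (fineness K x + 1) ^ K" using t_x by (intro power_mono) auto
  have "list_size inp + e + t + (t + 1) ^ K + 2 \<le> size_budget K q x"
    using t_x tK unfolding size_budget_def x e_def by linarith
  from runs_setup[of hg m n cc fs gam den num e t "size_budget K q x", OF len(1,2,3,4) e_eq t_def, folded inp, OF this]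
  obtain s1 where s1: "runs setup_prog ((\<lambda>_. [])(0 := inp)) (setup_time (size_budget K q x)) s1"
    "s1 rN = [int n]" "s1 rT = [int t]" "s1 rPre = rev pre" "s1 rA = flat_swap (rev ps)"
    "\<forall>j<K. s1 (rV j) = rev (fs j)" "s1 rEmpty = []" "s1 rX = []" "s1 rTmp = []" "bounded_state (size_budget K q x) s1"
    "s1 rCnt = [int ((t + 1) ^ K)]" "s1 rBestNum = [1]" "s1 rBestDen = [0]" "s1 rBest = [0]"
    unfolding pre_def rev_flat[symmetric] flat_ps by blast
  have "S.ready s1" using s1 by (simp add: S.ready_def)
  from S.runs_search[OF this s1(11-14)] obtain s2 where
    s2: "runs (While (Less (Const 0) (Top rCnt)) body_prog) s1
      (loop_time (Less (Const 0) (Top rCnt)) (size_budget K q x) (body_time (size_budget K q x) (sub_budget K q x)) ((t + 1) ^ K)) s2"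
    "S.ready s2" "S.best {..<(t + 1) ^ K} s2" by blast
  have W1: "1 \<le> size_budget K q x" by (simp add: size_budget_def)
  have "runs (Copy 0 rBest) s2 (time_factor (Copy 0 rBest) * size_budget K q x) (s2(0 := s2 rBest))"
    using runs_loop_free[of "Copy 0 rBest" "size_budget K q x" s2] s2(2) W1 by (simp add: S.ready_def)
  from runs_Seq[OF s1(1) runs_Seq[OF s2(1) this]]
  have "runs search_prog ((\<lambda>_. [])(0 := inp)) (search_time (size_budget K q x) (sub_budget K q x) ((t + 1) ^ K)) (s2(0 := s2 rBest))"
    unfolding search_prog_def search_time_def .
  from runs_mono[OF this search_time_mono[OF tK]] obtain \<tau> where
    "\<tau> \<le> search_time (size_budget K q x) (sub_budget K q x) ((fineness K x + 1) ^ K)"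
    "exec search_prog ((\<lambda>_. [])(0 := inp)) \<tau> (s2(0 := s2 rBest))" unfolding runs_def by blast
  then have out: "outputs_within search_prog inp (search_time (size_budget K q x) (sub_budget K q x) ((fineness K x + 1) ^ K)) (s2 rBest)"
    unfolding outputs_within_def by (intro exI[of _ \<tau>] exI[of _ "s2(0 := s2 rBest)"]) simp

  define Hr where "Hr = real_mat H"
  define gr where "gr = real_vec g"
  have int': "integral_polyhedron n (box_polyhedron Hr gr)" using int by (simp add: Hr_def gr_def)
  have int'': "integral_polyhedron (dim_col Hr) (box_polyhedron Hr gr)" using int' by (simp add: Hr_def n_def)
  have Hrn: "dim_col Hr = n" by (simp add: Hr_def n_def)
  have cost: "S.val N (quotients x @ quotients y) = grid_cost (real_vec C) (real_vec c) (real_vec \<Gamma>) t N (real_vec x, real_vec y)"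
    if "dim_vec x = n" "dim_vec y = n" for x y N
  proof -
    have "dot_value (quotients \<Gamma>) (grid_weights t N) = (\<Sum>j<K. real_of_rat (\<Gamma> $ j) * (real (digit t N j) / real t))"
      using dimCc by (simp add: dot_value_sum quotients_nth grid_weights_def)
    then show ?thesis
      using that dimCc by (simp add: ps_def dot_value_append dot_value_quotients grid_cost_def)
  qed
  \<comment> \<open>At a fixed grid point the dual term is constant, so an optimal solution of the
    subproblem also minimizes the grid cost.\<close>
  have opt: "grid_cost (real_vec C) (real_vec c) (real_vec \<Gamma>) t N (real_vec x, real_vec y) \<le>
      grid_cost (real_vec C) (real_vec c) (real_vec \<Gamma>) t N z"
    if "sub_answer H g C c t (grid_caps n t Us N) (Some (x, y))" "z \<in> sub_feasible Hr gr (grid_bounds n t Us N)" for x y z N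
    using that unfolding sub_answer_def
    by (cases z) (auto simp: sub_optimal_def is_arg_min_def n_def Hr_def gr_def grid_cost_def not_less Let_def)
  have Res0: "sub_feasible Hr gr (grid_bounds n t Us N) = {}" if r: "Res N [0]" for N
  proof -
    obtain sol where sol: "[0] = enc_solution sol" "sub_answer H g C c t (grid_caps n t Us N) sol"
      using r by (auto simp: Res_def)
    have "sol = None" using sol(1) by (cases sol) auto
    then show ?thesis using sol(2) by (simp add: sub_answer_def n_def Hr_def gr_def)
  qed
  have Res1: "\<exists>x y. qs = quotients x @ quotients y \<and> dim_vec x = n \<and> dim_vec y = n \<and>
      sub_answer H g C c t (grid_caps n t Us N) (Some (x, y)) \<and>
      (real_vec x, real_vec y) \<in> sub_feasible Hr gr (grid_bounds n t Us N)" if r: "Res N (1 # flat qs)" for N qs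
  proof -
    obtain sol where sol: "1 # flat qs = enc_solution sol" "sub_answer H g C c t (grid_caps n t Us N) sol"
      using r by (auto simp: Res_def)
    from sub_answer_cases[OF sol(2) dimCc(1,2)[unfolded n_def]] sol(1) obtain x y where xy:
      "sol = Some (x, y)" "enc_solution sol = 1 # flat (quotients x @ quotients y)" "dim_vec x = n" "dim_vec y = n"
      "(real_vec x, real_vec y) \<in> sub_feasible Hr gr (grid_bounds n t Us N)"
      unfolding Hr_def gr_def n_def by auto
    moreover have "qs = quotients x @ quotients y"
      using sol(1) xy(2) by (intro flat_inject) simp
    ultimately show ?thesis using sol(2) by blast
  qed
  from s2(3) obtain bn bd where best: "(s2 rBest = [0] \<and> (\<forall>N\<in>{..<(t + 1) ^ K}. Res N [0])) \<or>
      ((\<exists>N qs. N < (t + 1) ^ K \<and> Res N (1 # flat qs) \<and> s2 rBest = 1 # flat qs \<and>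
          real_of_int bn / real_of_int bd = S.val N qs) \<and>
        (\<forall>N\<in>{..<(t + 1) ^ K}. Res N [0] \<or> (\<exists>qs. Res N (1 # flat qs) \<and> real_of_int bn / real_of_int bd \<le> S.val N qs)))"
    (is "?none \<or> ?some")
    unfolding S.best_def by blast
  then show ?thesis
  proof
    assume a: ?none
    then have "\<not> (\<exists>N<(t + 1) ^ K. sub_feasible Hr gr (grid_bounds n t Us N) \<noteq> {})" using Res0 by blast
    then have "first_stage_set Hr gr = {}" using I.sub_feasible_nonempty[OF Hrn int' t_def e1] by blast
    then show ?thesis using a out by (intro exI[of _ None]) (simp add: approx_answer_def Hr_def gr_def)
  next
    assume a: ?some
    define v where "v = real_of_int bn / real_of_int bd"
    obtain N qs where N: "Res N (1 # flat qs)" "s2 rBest = 1 # flat qs" "v = S.val N qs"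
      using a by (auto simp: v_def)
    obtain x y where xy: "qs = quotients x @ quotients y" "dim_vec x = n" "dim_vec y = n"
      "(real_vec x, real_vec y) \<in> sub_feasible Hr gr (grid_bounds n t Us N)"
      using Res1[OF N(1)] by blast
    have v_le: "v \<le> grid_cost (real_vec C) (real_vec c) (real_vec \<Gamma>) t M z"
      if M: "M < (t + 1) ^ K" and z: "z \<in> sub_feasible Hr gr (grid_bounds n t Us M)" for M z
    proof -
      have "\<not> Res M [0]" using Res0 z by blast
      then obtain qs' where qs': "Res M (1 # flat qs')" "v \<le> S.val M qs'" using a M by (auto simp: v_def)
      obtain x' y' where xy': "qs' = quotients x' @ quotients y'" "dim_vec x' = n" "dim_vec y' = n"
        "sub_answer H g C c t (grid_caps n t Us M) (Some (x', y'))"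
        using Res1[OF qs'(1)] by blast
      show ?thesis using qs'(2) opt[OF xy'(4) z] cost[OF xy'(2,3), of M] xy'(1) by simp
    qed
    have rec: "real_vec y \<in> recourse_set Hr gr (real_vec x)" "real_vec x \<in> binary_vecs (dim_col Hr)"
      using sub_feasible_bounds[OF xy(4)] by auto
    have fs: "real_vec x \<in> first_stage_set Hr gr" by (rule recourse_imp_first_stage[OF int'' rec(2,1)])
    \<comment> \<open>Nonnegativity of the optimum is what allows the factor
      \<open>1 + 1 / e\<close> to be enlarged to \<open>1 + \<epsilon>\<close>.\<close>
    have MM0: "0 \<le> MM_value Hr gr (real_vec C) U"
    proof -
      have "0 \<le> worst_case_cost (real_vec C) U x' y'"
        if x': "x' \<in> first_stage_set Hr gr" and y': "y' \<in> recourse_set Hr gr x'" for x' y'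
      proof -
        have b: "x' \<in> binary_vecs n" using first_stage_recourse(1)[OF x'] Hrn by simp
        then have xn: "x' \<in> carrier_vec n" and x0: "\<And>i. i < n \<Longrightarrow> 0 \<le> x' $ i" by (auto simp: binary_vecs_def)
        have y: "y' \<in> carrier_vec n" "\<And>i. i < n \<Longrightarrow> 0 \<le> y' $ i" "\<And>i. i < n \<Longrightarrow> y' $ i \<le> 1 - x' $ i"
          using y' mem_recourse_set_iff[of x' Hr y' gr] xn Hrn by auto
        have "y' $ i \<le> 1" if "i < n" for i using y(3)[OF that] x0[OF that] by linarith
        then show ?thesis
          unfolding U_def using xn x0 y(1,2) vec_le_iff[OF zero_carrier_vec xn] vec_le_iff[OF zero_carrier_vec y(1)]
            vec_le_iff[OF y(1), of "ones_vec n"]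
          by (intro I.worst_case_cost_nonneg) auto
      qed
      then show ?thesis
        unfolding MM_value_def using fs first_stage_recourse(2) by (intro cINF_greatest) auto
    qed
    have "worst_case_cost (real_vec C) U (real_vec x) (real_vec y) \<le> v"
      using I.grid_point_cost[OF Hrn xy(4) t1] N(3) cost[OF xy(2,3)] xy(1) by (simp add: U_def)
    also have "\<dots> \<le> (1 + 1 / real e) * MM_value Hr gr (real_vec C) U"
      unfolding U_def using fs by (intro I.grid_minimum_approximates[OF Hrn int' e1 t_def _ v_le]) auto
    also have "\<dots> \<le> (1 + real_of_rat \<epsilon>) * MM_value Hr gr (real_vec C) U"
      using e_\<epsilon> MM0 by (intro mult_right_mono) auto
    finally have "worst_case_cost (real_vec C) U (real_vec x) (real_vec y) \<le> (1 + real_of_rat \<epsilon>) * MM_value Hr gr (real_vec C) U" .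
    moreover have "s2 rBest = enc_solution (Some (x, y))" using N(2) xy(1) enc_solution_Some by simp
    ultimately show ?thesis
      using out fs rec(1) by (intro exI[of _ "Some (x, y)"]) (simp add: approx_answer_def Hr_def gr_def)
  qed
qed

end

theorem theorem9:
  fixes \<H> :: "(rat mat \<times> rat vec) set" and K :: nat
  assumes dims: "\<And>H g. (H, g) \<in> \<H> \<Longrightarrow> g \<in> carrier_vec (dim_row H)"
    and integral: "\<And>H g. (H, g) \<in> \<H> \<Longrightarrow>
      integral_polyhedron (dim_col H) (box_polyhedron (real_mat H) (real_vec g))"
    and solvable: "subproblem_poly_solvable \<H>"
  shows "MM_HP1_has_FPTAS \<H> K"
proof -
  obtain p :: prog and q :: "nat poly" where pq:
    "\<forall>(H, g) \<in> \<H>. \<forall>C \<in> carrier_vec (dim_col H). \<forall>c \<in> carrier_vec (dim_col H).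
     \<forall>t. \<forall>k \<in> carrier_vec (dim_col H).
       0\<^sub>v (dim_col H) \<le> C \<longrightarrow> 0\<^sub>v (dim_col H) \<le> c \<longrightarrow> 1 \<le> t \<longrightarrow> (\<forall>i<dim_col H. k $ i \<le> t) \<longrightarrow>
       (\<exists>sol. outputs_within p (enc_sub_instance H g C c t k)
          (poly q (list_size (enc_sub_instance H g C c t k) + t)) (enc_solution sol) \<and> sub_answer H g C c t k sol)"
    using solvable unfolding subproblem_poly_solvable_def sub_answer_def Let_def by blast
  \<comment> \<open>Inserting 0 makes the maximum exist even for a program that mentions no
    register; the successor makes \<open>B\<close> positive, so that the input register 0 lies below
    it.\<close>
  define B where "B = Suc (Max (insert 0 (prog_regs p)))"
  have "prog_regs p \<subseteq> {..<B}"
    using finite_prog_regs[of p] by (auto simp: B_def less_Suc_eq_le)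
  then have gp: "grid_program B p" by (simp add: grid_program_def B_def)
  interpret grid_program B K p by (rule gp)
  have fin: "poly_fun (fineness K)" unfolding fineness_def[abs_def] by (intro poly_fun_intros)
  have sub: "poly_fun (sub_budget K q)" unfolding sub_budget_def[abs_def] by (intro poly_fun_intros fin)
  have size: "poly_fun (size_budget K q)"
    unfolding size_budget_def[abs_def] by (intro poly_fun_intros fin sub)
  have "poly_fun (\<lambda>x. search_time (size_budget K q x) (sub_budget K q x) ((fineness K x + 1) ^ K))"
    by (intro poly_fun_search_time poly_fun_intros fin sub size)
  then obtain Q where Q: "(\<lambda>x. search_time (size_budget K q x) (sub_budget K q x) ((fineness K x + 1) ^ K)) = poly Q"
    by (auto simp: poly_fun_def)
  have main: "\<exists>sol. outputs_within search_prog (enc_MM_instance H g C c Us \<Gamma> \<epsilon>)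
        (poly Q (list_size (enc_MM_instance H g C c Us \<Gamma> \<epsilon>) + nat \<lceil>1 / \<epsilon>\<rceil>)) (enc_solution sol) \<and>
      approx_answer H g C (HP1_set (real_vec c) Us (real_vec \<Gamma>)) \<epsilon> sol"
    if Hg: "(H, g) \<in> \<H>" and C: "C \<in> carrier_vec (dim_col H)" "0\<^sub>v (dim_col H) \<le> C"
      and c: "c \<in> carrier_vec (dim_col H)" "0\<^sub>v (dim_col H) \<le> c"
      and \<Gamma>: "\<Gamma> \<in> carrier_vec K" "0\<^sub>v K \<le> \<Gamma>" and \<epsilon>: "0 < \<epsilon>"
      and Us: "length Us = K" "\<forall>j<K. Us ! j \<subseteq> {..<dim_col H}"
      and compact: "compact_vecs (dim_col H) (HP1_set (real_vec c) Us (real_vec \<Gamma>))"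
    for H g C c Us \<Gamma> \<epsilon>
  proof -
    have sub: "\<exists>sol. outputs_within p (enc_sub_instance H g C c t k)
        (poly q (list_size (enc_sub_instance H g C c t k) + t)) (enc_solution sol) \<and> sub_answer H g C c t k sol"
      if "k \<in> carrier_vec (dim_col H)" "1 \<le> t" "\<forall>i<dim_col H. k $ i \<le> t" for t k
      using pq Hg C c that by fast
    have "\<And>j. j < K \<Longrightarrow> Us ! j \<subseteq> {..<dim_col H}" using Us(2) by blast
    from solves_instance[OF dims[OF Hg] integral[OF Hg] C c \<Gamma> Us(1) this \<epsilon> compact sub refl]
    show ?thesis unfolding fun_cong[OF Q] .
  qed
  show ?thesis
    unfolding MM_HP1_has_FPTAS_def Let_def
  proof (intro exI[of _ search_prog] exI[of _ Q] ballI, goal_cases)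
    case (1 Hg)
    then show ?case using main unfolding approx_answer_def by (cases Hg) simp
  qed
qed

end
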